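(* The category $\mathbf{OS}$ of operator spaces and linear complete contractions is locally countably presentable.
   Context: Conventions: all vector spaces are over $\mathbb C$, all maps are linear, $\mathbb N=\{1,2,\dots\}$. For a vector space $V$, $\mathbb M_n(V)$ is the vector space of $n\times n$ matrices with entries in $V$; $M_n$ denotes $\mathbb M_n(\mathbb C)$ with the operator norm on $\mathbb C^n$. An (abstract) operator space is a vector space $X$ with norms $\|\cdot\|_n$ on $\mathbb M_n(X)$, $n\in\mathbb N$, such that: $(\mathbb M_1(X),\|\cdot\|_1)\cong X$ is a Banach space; $\|x\oplus y\|_{m+n}=\max\{\|x\|_m,\|y\|_n\}$ for $x\in \mathbb M_m(X)$, $y\in \mathbb M_n(X)$, where $x\oplus y$ is the block-diagonal matrix; and $\|\alpha x\beta\|_m\le\|\alpha\|\,\|x\|_m\,\|\beta\|$ for $x\in\mathbb M_m(X)$, $\alpha,\beta\in M_m$. Write $M_n(X)=(\mathbb M_n(X),\|\cdot\|_n)$. For a linear map $u:X\to Y$ let $u_n:\mathbb M_n(X)\to\mathbb M_n(Y)$ be entrywise application of $u$; $u$ is a complete contraction if every $u_n:M_n(X)\to M_n(Y)$ is a contraction ($\|u_n\|\le 1$). $\mathbf{OS}$ is the category with operator spaces as objects and linear complete contractions as morphisms. A poset is countably directed ($\aleph_1$-directed) if each of its countable subsets has an upper bound. A countably-directed colimit is a colimit of a functor from a countably-directed poset (viewed as a category). An object $A$ of a category $\mathbf C$ is countably-presentable if $\mathbf C(A,-):\mathbf C\to\mathbf{Set}$ preserves countably-directed colimits. A category $\mathbf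 C$ is locally countably presentable (locally $\aleph_1$-presentable) if: (1) it is cocomplete (has all small colimits); (2) every object is a countably-directed colimit of countably-presentable objects; (3) up to isomorphism there is only a small set of countably-presentable objects. *)

theory Defs
  imports
    "Jordan_Normal_Form.VS_Connect"
    "HOL-Library.FuncSet"
    "HOL-Library.Countable_Set"
begin

unbundle cardinal_syntax

section \<open>Smallness\<close>

text \<open>
  A type \<open>'u\<close> plays the role of the universe of sets: a set (of any type) is small if it has
  fewer elements than \<open>'u\<close>, so small sets are, up to bijection, the subsets of \<open>'u\<close> of smaller
  cardinality. Write kappa for the cardinality of \<open>'u\<close>. For a Grothendieck universe kappa is an
  uncountable strongly inaccessible cardinal; every such kappa satisfies \<open>universe\<close>. The predicate
  only asks that kappa is infinite and regular (small unions of small sets are small) and that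
  the countable sequences in a small set form a small set; with a two-element set this gives
  \<open>2^aleph_0 < kappa\<close>. It also holds if kappa is the successor of \<open>2^aleph_0\<close>, so, unlike
  inaccessibility, it is satisfied by types that can be constructed in HOL.
\<close>

definition small :: "'u itself \<Rightarrow> 'a set \<Rightarrow> bool" where
  "small (_ :: 'u itself) A \<longleftrightarrow> |A| <o |UNIV :: 'u set|"

definition universe :: "'u itself \<Rightarrow> bool" where
  "universe U \<longleftrightarrow>
     infinite (UNIV :: 'u set) \<and>
     regularCard |UNIV :: 'u set| \<and>
     (\<forall>A :: 'u set. small U A \<longrightarrow> small U {s :: nat \<Rightarrow> 'u. range s \<subseteq> A})"


section \<open>Categories, functors and colimits\<close>

text \<open>
  Hom-sets need not be disjoint, so composition takes the three objects as arguments: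
  \<open>Comp C A B D g f\<close> is the composite of \<open>f : A \<rightarrow> B\<close> and \<open>g : B \<rightarrow> D\<close>.
\<close>

record ('o, 'm) category =
  Obj :: "'o set"
  Hom :: "'o \<Rightarrow> 'o \<Rightarrow> 'm set"
  Ident :: "'o \<Rightarrow> 'm"
  Comp :: "'o \<Rightarrow> 'o \<Rightarrow> 'o \<Rightarrow> 'm \<Rightarrow> 'm \<Rightarrow> 'm"

definition is_category :: "('o, 'm) category \<Rightarrow> bool" where
  "is_category C \<longleftrightarrow>
     (\<forall>A\<in>Obj C. Ident C A \<in> Hom C A A) \<and>
     (\<forall>A\<in>Obj C. \<forall>B\<in>Obj C. \<forall>D\<in>Obj C. \<forall>f\<in>Hom C A B. \<forall>g\<in>Hom C B D.
        Comp C A B D g f \<in> Hom C A D) \<and>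
     (\<forall>A\<in>Obj C. \<forall>B\<in>Obj C. \<forall>f\<in>Hom C A B.
        Comp C A A B f (Ident C A) = f \<and> Comp C A B B (Ident C B) f = f) \<and>
     (\<forall>A\<in>Obj C. \<forall>B\<in>Obj C. \<forall>D\<in>Obj C. \<forall>E\<in>Obj C.
        \<forall>f\<in>Hom C A B. \<forall>g\<in>Hom C B D. \<forall>h\<in>Hom C D E.
        Comp C A B E (Comp C B D E h g) f = Comp C A D E h (Comp C A B D g f))"

definition isomorphic :: "('o, 'm) category \<Rightarrow> 'o \<Rightarrow> 'o \<Rightarrow> bool" where
  "isomorphic C A B \<longleftrightarrow>
     (\<exists>f\<in>Hom C A B. \<exists>g\<in>Hom C B A.
        Comp C A B A g f = Ident C A \<and> Comp C B A B f g = Ident C B)"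

definition small_category :: "'u itself \<Rightarrow> ('j, 'k) category \<Rightarrow> bool" where
  "small_category U J \<longleftrightarrow>
     is_category J \<and> small U (Obj J) \<and> small U (SIGMA (i, j) : Obj J \<times> Obj J. Hom J i j)"

record ('j, 'k, 'o, 'm) functor_data =
  fobj :: "'j \<Rightarrow> 'o"
  farr :: "'j \<Rightarrow> 'j \<Rightarrow> 'k \<Rightarrow> 'm"

definition is_functor ::
    "('j, 'k) category \<Rightarrow> ('o, 'm) category \<Rightarrow> ('j, 'k, 'o, 'm) functor_data \<Rightarrow> bool" where
  "is_functor J C F \<longleftrightarrow>
     (\<forall>i\<in>Obj J. fobj F i \<in> Obj C) \<and>
     (\<forall>i\<in>Obj J. \<forall>j\<in>Obj J. \<forall>a\<in>Hom J i j. farr F i j a \<in> Hom C (fobj F i) (fobj F j)) \<and>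
     (\<forall>i\<in>Obj J. farr F i i (Ident J i) = Ident C (fobj F i)) \<and>
     (\<forall>i\<in>Obj J. \<forall>j\<in>Obj J. \<forall>k\<in>Obj J. \<forall>a\<in>Hom J i j. \<forall>b\<in>Hom J j k.
        farr F i k (Comp J i j k b a) =
        Comp C (fobj F i) (fobj F j) (fobj F k) (farr F j k b) (farr F i j a))"

definition functor_comp ::
    "('o, 'm, 'p, 'n) functor_data \<Rightarrow> ('j, 'k, 'o, 'm) functor_data \<Rightarrow>
     ('j, 'k, 'p, 'n) functor_data" where
  "functor_comp G F =
     \<lparr>fobj = (\<lambda>i. fobj G (fobj F i)),
      farr = (\<lambda>i j a. farr G (fobj F i) (fobj F j) (farr F i j a))\<rparr>"

definition is_cocone ::
    "('j, 'k) category \<Rightarrow> ('o, 'm) category \<Rightarrow> ('j, 'k, 'o, 'm) functor_data \<Rightarrow>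
     'o \<Rightarrow> ('j \<Rightarrow> 'm) \<Rightarrow> bool" where
  "is_cocone J C F L c \<longleftrightarrow>
     L \<in> Obj C \<and>
     (\<forall>i\<in>Obj J. c i \<in> Hom C (fobj F i) L) \<and>
     (\<forall>i\<in>Obj J. \<forall>j\<in>Obj J. \<forall>a\<in>Hom J i j.
        Comp C (fobj F i) (fobj F j) L (c j) (farr F i j a) = c i)"

definition is_colimit ::
    "('j, 'k) category \<Rightarrow> ('o, 'm) category \<Rightarrow> ('j, 'k, 'o, 'm) functor_data \<Rightarrow>
     'o \<Rightarrow> ('j \<Rightarrow> 'm) \<Rightarrow> bool" where
  "is_colimit J C F L c \<longleftrightarrow>
     is_cocone J C F L c \<and>
     (\<forall>L' c'. is_cocone J C F L' c' \<longrightarrow>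
        (\<exists>!h. h \<in> Hom C L L' \<and> (\<forall>i\<in>Obj J. Comp C (fobj F i) L L' h (c i) = c' i)))"

text \<open>Every small category is isomorphic to one whose objects and arrows are elements of \<open>'u\<close>.\<close>

definition cocomplete :: "'u itself \<Rightarrow> ('o, 'm) category \<Rightarrow> bool" where
  "cocomplete U C \<longleftrightarrow>
     (\<forall>(J :: ('u, 'u) category) F.
        small_category U J \<and> is_functor J C F \<longrightarrow> (\<exists>L c. is_colimit J C F L c))"


section \<open>Countably presentable objects\<close>

definition poset_category :: "'i set \<Rightarrow> 'i rel \<Rightarrow> ('i, 'i \<times> 'i) category" where
  "poset_category I r =
     \<lparr>Obj = I, Hom = (\<lambda>i j. {(i, j)} \<inter> r), Ident = (\<lambda>i. (i, i)),
      Comp = (\<lambda>i j k _ _. (i, k))\<rparr>"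

definition countably_directed :: "'i set \<Rightarrow> 'i rel \<Rightarrow> bool" where
  "countably_directed I r \<longleftrightarrow>
     partial_order_on I r \<and>
     (\<forall>S. S \<subseteq> I \<and> countable S \<longrightarrow> (\<exists>u\<in>I. \<forall>s\<in>S. (s, u) \<in> r))"

text \<open>
  The category of sets containing the hom-sets of a category with arrows of type \<open>'m\<close>: all sets
  of elements of \<open>'m\<close>. Functions are made extensional so that equality of arrows is equality of
  functions. No bound on the size of the sets is needed: whether a cocone under a diagram of
  sets is a colimit does not depend on it, as two-element sets already detect this.
\<close>

definition set_category :: "('a set, 'a \<Rightarrow> 'a) category" where
  "set_category =
     \<lparr>Obj = UNIV, Hom = (\<lambda>X Y. X \<rightarrow>\<^sub>E Y), Ident = (\<lambda>X. \<lambda>x\<in>X. x),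
      Comp = (\<lambda>X Y Z g f. compose X g f)\<rparr>"

definition hom_functor :: "('o, 'm) category \<Rightarrow> 'o \<Rightarrow> ('o, 'm, 'm set, 'm \<Rightarrow> 'm) functor_data" where
  "hom_functor C A =
     \<lparr>fobj = (\<lambda>B. Hom C A B),
      farr = (\<lambda>B B' f. \<lambda>g\<in>Hom C A B. Comp C A B B' f g)\<rparr>"

definition preserves_countably_directed_colimits ::
    "'u itself \<Rightarrow> ('o, 'm) category \<Rightarrow> ('p, 'n) category \<Rightarrow> ('o, 'm, 'p, 'n) functor_data \<Rightarrow> bool" where
  "preserves_countably_directed_colimits U C D G \<longleftrightarrow>
     (\<forall>(I :: 'u set) r F L c.
        small U I \<and> countably_directed I r \<and> is_functor (poset_category I r) C F \<and>
        is_colimit (poset_category I r) C F L c \<longrightarrow>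
        is_colimit (poset_category I r) D (functor_comp G F) (fobj G L)
          (\<lambda>i. farr G (fobj F i) L (c i)))"

definition countably_presentable :: "'u itself \<Rightarrow> ('o, 'm) category \<Rightarrow> 'o \<Rightarrow> bool" where
  "countably_presentable U C A \<longleftrightarrow>
     A \<in> Obj C \<and> preserves_countably_directed_colimits U C set_category (hom_functor C A)"

definition locally_countably_presentable :: "'u itself \<Rightarrow> ('o, 'm) category \<Rightarrow> bool" where
  "locally_countably_presentable U C \<longleftrightarrow>
     is_category C \<and>
     cocomplete U C \<and>
     (\<forall>X\<in>Obj C. \<exists>(I :: 'u set) r F c.
        small U I \<and> countably_directed I r \<and> is_functor (poset_category I r) C F \<and>
        (\<forall>i\<in>I. countably_presentable U C (fobj F i)) \<and>
        is_colimit (poset_category I r) C F X c) \<and>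
     (\<exists>S. S \<subseteq> Obj C \<and> small U S \<and>
        (\<forall>A. countably_presentable U C A \<longrightarrow> (\<exists>B\<in>S. isomorphic C A B)))"


section \<open>Operator spaces\<close>

definition euclid_norm :: "complex Matrix.vec \<Rightarrow> real" where
  "euclid_norm v = sqrt (\<Sum>i<dim_vec v. (cmod (v $ i))\<^sup>2)"

definition op_norm :: "complex mat \<Rightarrow> real" where
  "op_norm \<alpha> = (SUP v \<in> {v \<in> carrier_vec (dim_col \<alpha>). euclid_norm v \<le> 1}. euclid_norm (\<alpha> *\<^sub>v v))"

text \<open>
  The ring multiplication and unit that \<open>module\<close> inherits from \<open>ring\<close> are not used; neither are
  values of the operations outside the carrier. \<open>mnorm V x\<close> is the norm of an \<open>n \<times> n\<close> matrix \<open>x\<close>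
  for every \<open>n \<ge> 1\<close>, the size being part of \<open>x\<close>.
\<close>

record 'a opspace = "(complex, 'a) module" +
  mnorm :: "'a mat \<Rightarrow> real"

definition mats :: "nat \<Rightarrow> 'a opspace \<Rightarrow> 'a mat set" where
  "mats n V = {x \<in> carrier_mat n n. elements_mat x \<subseteq> carrier V}"

definition mats_zero :: "nat \<Rightarrow> nat \<Rightarrow> 'a opspace \<Rightarrow> 'a mat" where
  "mats_zero m n V = mat m n (\<lambda>_. \<zero>\<^bsub>V\<^esub>)"

definition mats_add :: "'a opspace \<Rightarrow> 'a mat \<Rightarrow> 'a mat \<Rightarrow> 'a mat" where
  "mats_add V x y = mat (dim_row x) (dim_col x) (\<lambda>ij. x $$ ij \<oplus>\<^bsub>V\<^esub> y $$ ij)"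

definition mats_smult :: "'a opspace \<Rightarrow> complex \<Rightarrow> 'a mat \<Rightarrow> 'a mat" where
  "mats_smult V a x = map_mat (\<lambda>v. a \<odot>\<^bsub>V\<^esub> v) x"

definition mats_dsum :: "'a opspace \<Rightarrow> 'a mat \<Rightarrow> 'a mat \<Rightarrow> 'a mat" where
  "mats_dsum V x y =
     four_block_mat x (mats_zero (dim_row x) (dim_col y) V) (mats_zero (dim_row y) (dim_col x) V) y"

definition mats_sandwich :: "'a opspace \<Rightarrow> complex mat \<Rightarrow> 'a mat \<Rightarrow> complex mat \<Rightarrow> 'a mat" where
  "mats_sandwich V \<alpha> x \<beta> =
     mat (dim_row \<alpha>) (dim_col \<beta>) (\<lambda>(i, j).
       finsum V (\<lambda>k. finsum V (\<lambda>l. (\<alpha> $$ (i, k) * \<beta> $$ (l, j)) \<odot>\<^bsub>V\<^esub> x $$ (k, l)) {..<dim_col x})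
         {..<dim_row x})"

definition vnorm :: "'a opspace \<Rightarrow> 'a \<Rightarrow> real" where
  "vnorm V v = mnorm V (mat 1 1 (\<lambda>_. v))"

definition operator_space :: "'a opspace \<Rightarrow> bool" where
  "operator_space V \<longleftrightarrow>
     vectorspace class_ring V \<and>
     \<comment> \<open>norms on the matrix spaces\<close>
     (\<forall>n\<ge>1. \<forall>x\<in>mats n V. 0 \<le> mnorm V x) \<and>
     (\<forall>n\<ge>1. \<forall>x\<in>mats n V. mnorm V x = 0 \<longleftrightarrow> x = mats_zero n n V) \<and>
     (\<forall>n\<ge>1. \<forall>x\<in>mats n V. \<forall>a. mnorm V (mats_smult V a x) = cmod a * mnorm V x) \<and>
     (\<forall>n\<ge>1. \<forall>x\<in>mats n V. \<forall>y\<in>mats n V. mnorm V (mats_add V x y) \<le> mnorm V x + mnorm V y) \<and>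
     \<comment> \<open>completeness of the first norm\<close>
     (\<forall>s. range s \<subseteq> carrier V \<and>
          (\<forall>e>0. \<exists>N. \<forall>p\<ge>N. \<forall>q\<ge>N. vnorm V (s p \<ominus>\<^bsub>V\<^esub> s q) < e) \<longrightarrow>
          (\<exists>l\<in>carrier V. (\<lambda>p. vnorm V (s p \<ominus>\<^bsub>V\<^esub> l)) \<longlonglongrightarrow> 0)) \<and>
     \<comment> \<open>the axioms relating the norms of different sizes\<close>
     (\<forall>m\<ge>1. \<forall>n\<ge>1. \<forall>x\<in>mats m V. \<forall>y\<in>mats n V.
        mnorm V (mats_dsum V x y) = max (mnorm V x) (mnorm V y)) \<and>
     (\<forall>m\<ge>1. \<forall>x\<in>mats m V. \<forall>\<alpha>\<in>carrier_mat m m. \<forall>\<beta>\<in>carrier_mat m m.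
        mnorm V (mats_sandwich V \<alpha> x \<beta>) \<le> op_norm \<alpha> * mnorm V x * op_norm \<beta>)"

definition complete_contraction :: "'a opspace \<Rightarrow> 'b opspace \<Rightarrow> ('a \<Rightarrow> 'b) \<Rightarrow> bool" where
  "complete_contraction V W u \<longleftrightarrow>
     (\<forall>n\<ge>1. \<forall>x\<in>mats n V. mnorm W (map_mat u x) \<le> mnorm V x)"

text \<open>
  Operator spaces with a small underlying set. A morphism is a function that is extensional, i.e.
  carries no information outside the carrier of its domain.
\<close>

definition OS :: "('u opspace, 'u \<Rightarrow> 'u) category" where
  "OS =
     \<lparr>Obj = {V. operator_space V \<and> small TYPE('u) (carrier V)},
      Hom = (\<lambda>V W. {u \<in> extensional (carrier V).
                       u \<in> LinearCombinations.module_hom class_ring V W \<and> complete_contraction V W u}),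
      Ident = (\<lambda>V. \<lambda>v\<in>carrier V. v),
      Comp = (\<lambda>V W Z g f. compose (carrier V) g f)\<rparr>"

end

theory Submission
  imports Defs
begin

text \<open>
  A colimit of a small diagram is the closed span of the images of the diagram in the
  \<open>\<ell>\<^sup>\<infinity>\<close>-product of all its cocones; it is small because each of its elements is the limit of a
  sequence of linear combinations with coefficients in \<open>\<rat>(i)\<close>.

  For a countably directed diagram the norms of a family that is eventually compatible with the
  transition maps are eventually constant, and the eventual value is a complete seminorm on the
  space of such families. Hence every element of the colimit comes from a single stage, and
  countably many norms in the colimit are attained at a common stage. A morphism from a
  countably generated space \<open>A\<close> is determined by countably many norm inequalities, namely those for
  the matrices of \<open>\<rat>(i)\<close>-combinations of the generators, so it factors through a stage:
  \<open>A\<close> is countably presentable.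

  Every \<open>X\<close> is the countably directed colimit of the closed spans of its countable subsets. If \<open>X\<close>
  is countably presentable, its identity factors through one of them, so \<open>X\<close> is countably
  generated; and up to isomorphism it is determined by countably many real numbers, the norms of
  the matrices of \<open>\<rat>(i)\<close>-combinations of the generators.
\<close>

section \<open>Modules over the complex numbers and matrices over them\<close>

text \<open>Two features of the setting shape the proof. Objects of \<open>OS\<close> live on the
  type \<open>'u\<close>, while products and spaces of families live on function types;
  \<open>realize\<close> moves a complete seminormed space back to \<open>'u\<close> once its points
  are separated, up to distance 0, by a small set of labels. For this reason Ruan's axioms
  (\<open>ruan\<close>) are kept apart from completeness and definiteness: some intermediate spaces
  carry only seminorms. Also, the product over all cocones need not be small, and only the closed
  span inside it is transported. Countable directedness replaces the completion that an ordinary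
  directed colimit needs. A decreasing net of non-negative reals over such a poset attains its
  infimum, because stages within \<open>1 / (n + 1)\<close> of it have a common upper bound; a
  Cauchy sequence of families is represented at one stage, where its limit can be taken. Meeting
  countably many conditions at one stage also explains the coefficients in \<open>qc\<close>:
  arbitrary complex ones would give uncountably many norm inequalities. Density and
  \<open>norm_le_add_eps\<close> recover the inequalities for all matrices.\<close>

locale vsp = Module.module "class_ring :: complex ring" V for V :: "'a opspace" (structure)
begin

lemma smult_in [simp, intro]: "x \<in> carrier V \<Longrightarrow> a \<odot> x \<in> carrier V"
  using smult_closed[of a x] by simp

lemma smult_add_left: "x \<in> carrier V \<Longrightarrow> (a + b) \<odot> x = a \<odot> x \<oplus> b \<odot> x"
  using smult_l_distr[of a b x] by simp

lemma smult_add_right: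
  "x \<in> carrier V \<Longrightarrow> y \<in> carrier V \<Longrightarrow> a \<odot> (x \<oplus> y) = a \<odot> x \<oplus> a \<odot> y"
  using smult_r_distr[of a x y] by simp

lemma smult_smult: "x \<in> carrier V \<Longrightarrow> a \<odot> (b \<odot> x) = (a * b) \<odot> x"
  using smult_assoc1[of a b x] by simp

lemma smult_1 [simp]: "x \<in> carrier V \<Longrightarrow> 1 \<odot> x = x"
  using smult_one[of x] by simp

lemma smult_0 [simp]: "x \<in> carrier V \<Longrightarrow> 0 \<odot> x = \<zero>"
  using smult_l_null[of x] by simp

lemma smult_zero [simp]: "a \<odot> \<zero> = \<zero>"
  using smult_r_null[of a] by simp

lemma neg_eq: "x \<in> carrier V \<Longrightarrow> \<ominus> x = (-1) \<odot> x"
  using smult_l_minus[of 1 x] by (simp add: class_ring_simps)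

lemma minus_eq': "x \<in> carrier V \<Longrightarrow> y \<in> carrier V \<Longrightarrow> x \<ominus> y = x \<oplus> (-1) \<odot> y"
  by (simp add: a_minus_def neg_eq)

end

text \<open>The scalar laws provide the additive inverses: \<open>(-1) \<odot> x\<close> is one,
  because \<open>0 \<odot> x = \<zero>\<close>.\<close>

lemma vspI:
  fixes V :: "'a opspace" (structure)
  assumes zero: "\<zero> \<in> carrier V"
    and add: "\<And>x y. x \<in> carrier V \<Longrightarrow> y \<in> carrier V \<Longrightarrow> x \<oplus> y \<in> carrier V"
    and smult: "\<And>a x. x \<in> carrier V \<Longrightarrow> a \<odot> x \<in> carrier V"
    and assoc: "\<And>x y z. x \<in> carrier V \<Longrightarrow> y \<in> carrier V \<Longrightarrow> z \<in> carrier V \<Longrightarrow>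
      (x \<oplus> y) \<oplus> z = x \<oplus> (y \<oplus> z)"
    and comm: "\<And>x y. x \<in> carrier V \<Longrightarrow> y \<in> carrier V \<Longrightarrow> x \<oplus> y = y \<oplus> x"
    and l_zero: "\<And>x. x \<in> carrier V \<Longrightarrow> \<zero> \<oplus> x = x"
    and distl: "\<And>a b x. x \<in> carrier V \<Longrightarrow> (a + b) \<odot> x = a \<odot> x \<oplus> b \<odot> x"
    and distr: "\<And>a x y. x \<in> carrier V \<Longrightarrow> y \<in> carrier V \<Longrightarrow> a \<odot> (x \<oplus> y) = a \<odot> x \<oplus> a \<odot> y"
    and assoc': "\<And>a b x. x \<in> carrier V \<Longrightarrow> (a * b) \<odot> x = a \<odot> (b \<odot> x)"
    and one: "\<And>x. x \<in> carrier V \<Longrightarrow> 1 \<odot> x = x"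
    and null: "\<And>x. x \<in> carrier V \<Longrightarrow> 0 \<odot> x = \<zero>"
  shows "vsp V"
proof -
  have inv: "\<exists>y\<in>carrier V. y \<oplus> x = \<zero>" if x: "x \<in> carrier V" for x
  proof
    show "(-1) \<odot> x \<oplus> x = \<zero>"
      using distl[OF x, of "-1" 1] by (simp add: one null x)
  qed (use smult x in auto)
  have "abelian_group V"
    by (rule abelian_groupI[OF add zero assoc comm l_zero inv])
  then have "Module.module (class_ring :: complex ring) V"
    by (intro Module.moduleI) (simp_all add: smult distl distr assoc' one class_cring.is_cring)
  then show ?thesis
    by (simp add: vsp_def)
qed

lemma in_mats:
  "x \<in> mats n V \<longleftrightarrow> x \<in> carrier_mat n n \<and> (\<forall>i<n. \<forall>j<n. x $$ (i, j) \<in> carrier V)"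
proof -
  have "elements_mat x \<subseteq> carrier V \<longleftrightarrow> (\<forall>i<n. \<forall>j<n. x $$ (i, j) \<in> carrier V)"
    if "x \<in> carrier_mat n n"
    using that by (fastforce simp: elements_mat_def)
  then show ?thesis
    by (auto simp: mats_def)
qed

lemma matsD:
  assumes "x \<in> mats n V"
  shows "dim_row x = n" "dim_col x = n" "\<And>i j. i < n \<Longrightarrow> j < n \<Longrightarrow> x $$ (i, j) \<in> carrier V"
  using assms by (auto simp: in_mats)

lemma mats_mat [intro]:
  "(\<And>i j. i < n \<Longrightarrow> j < n \<Longrightarrow> f (i, j) \<in> carrier V) \<Longrightarrow> mat n n f \<in> mats n V"
  by (auto simp: in_mats)

lemma mats_map:
  assumes "x \<in> mats n V" "\<And>v. v \<in> carrier V \<Longrightarrow> u v \<in> carrier W"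
  shows "map_mat u x \<in> mats n W"
  using assms by (auto simp: in_mats)

lemma map_mat_cong':
  assumes "x \<in> mats n V" "\<And>v. v \<in> carrier V \<Longrightarrow> u v = w v"
  shows "map_mat u x = map_mat w x"
  using assms by (intro eq_matI) (auto simp: in_mats)

lemma map_mat_id':
  assumes "x \<in> mats n V" "\<And>v. v \<in> carrier V \<Longrightarrow> u v = v"
  shows "map_mat u x = x"
  using assms by (intro eq_matI) (auto simp: in_mats)

lemma map_mat_comp': "map_mat u (map_mat w x) = map_mat (\<lambda>v. u (w v)) x"
  by (intro eq_matI) auto

context vsp
begin

lemma mats_zero_in: "mats_zero n n V \<in> mats n V"
  by (auto simp: mats_zero_def)

lemma mats_add_in: "x \<in> mats n V \<Longrightarrow> y \<in> mats n V \<Longrightarrow> mats_add V x y \<in> mats n V"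
  by (auto simp: mats_add_def in_mats)

lemma mats_smult_in: "x \<in> mats n V \<Longrightarrow> mats_smult V a x \<in> mats n V"
  by (auto simp: mats_smult_def in_mats)

lemma mats_dsum_in: "x \<in> mats m V \<Longrightarrow> y \<in> mats n V \<Longrightarrow> mats_dsum V x y \<in> mats (m + n) V"
  by (auto simp: mats_dsum_def in_mats mats_zero_def)

lemma mats_sandwich_in:
  assumes "x \<in> mats m V" "\<alpha> \<in> carrier_mat m m" "\<beta> \<in> carrier_mat m m"
  shows "mats_sandwich V \<alpha> x \<beta> \<in> mats m V"
  using assms unfolding mats_sandwich_def
  by (auto simp: in_mats intro!: finsum_closed)

end

abbreviation lin :: "'a opspace \<Rightarrow> 'b opspace \<Rightarrow> ('a \<Rightarrow> 'b) set" where
  "lin V W \<equiv> LinearCombinations.module_hom (class_ring :: complex ring) V W"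

lemma lin_iff:
  "u \<in> lin V W \<longleftrightarrow> (\<forall>x\<in>carrier V. u x \<in> carrier W) \<and>
     (\<forall>x\<in>carrier V. \<forall>y\<in>carrier V. u (x \<oplus>\<^bsub>V\<^esub> y) = u x \<oplus>\<^bsub>W\<^esub> u y) \<and>
     (\<forall>a. \<forall>x\<in>carrier V. u (a \<odot>\<^bsub>V\<^esub> x) = a \<odot>\<^bsub>W\<^esub> u x)"
  unfolding LinearCombinations.module_hom_def by auto

lemma linD:
  assumes "u \<in> lin V W"
  shows "x \<in> carrier V \<Longrightarrow> u x \<in> carrier W"
    "x \<in> carrier V \<Longrightarrow> y \<in> carrier V \<Longrightarrow> u (x \<oplus>\<^bsub>V\<^esub> y) = u x \<oplus>\<^bsub>W\<^esub> u y"
    "x \<in> carrier V \<Longrightarrow> u (a \<odot>\<^bsub>V\<^esub> x) = a \<odot>\<^bsub>W\<^esub> u x"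
  using assms by (auto simp: lin_iff)

locale vsp_hom = V: vsp V + W: vsp W
  for V :: "'a opspace" and W :: "'b opspace" +
  fixes u assumes u: "u \<in> lin V W"
begin

lemmas u_in = linD(1)[OF u] and u_add = linD(2)[OF u] and u_smult = linD(3)[OF u]

lemma u_zero: "u \<zero>\<^bsub>V\<^esub> = \<zero>\<^bsub>W\<^esub>"
proof -
  have "u \<zero>\<^bsub>V\<^esub> = u (0 \<odot>\<^bsub>V\<^esub> \<zero>\<^bsub>V\<^esub>)" by simp
  also have "\<dots> = 0 \<odot>\<^bsub>W\<^esub> u \<zero>\<^bsub>V\<^esub>" by (rule u_smult) simp
  finally show ?thesis by (simp add: u_in)
qed

lemma u_minus:
  "x \<in> carrier V \<Longrightarrow> y \<in> carrier V \<Longrightarrow> u (x \<ominus>\<^bsub>V\<^esub> y) = u x \<ominus>\<^bsub>W\<^esub> u y"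
  by (simp add: V.minus_eq' W.minus_eq' u_in u_add u_smult)

lemma u_finsum:
  "finite A \<Longrightarrow> (\<And>i. i \<in> A \<Longrightarrow> f i \<in> carrier V) \<Longrightarrow>
   u (finsum V f A) = finsum W (\<lambda>i. u (f i)) A"
proof (induction rule: finite_induct)
  case empty
  then show ?case by (simp add: u_zero)
next
  case (insert a A)
  then show ?case
    by (subst V.finsum_insert; (subst W.finsum_insert)?) (auto simp: u_add u_in intro!: V.finsum_closed)
qed

lemma map_add:
  "x \<in> mats n V \<Longrightarrow> y \<in> mats n V \<Longrightarrow>
   map_mat u (mats_add V x y) = mats_add W (map_mat u x) (map_mat u y)"
  by (intro eq_matI) (auto simp: mats_add_def in_mats u_add)

lemma map_smult:
  "x \<in> mats n V \<Longrightarrow> map_mat u (mats_smult V a x) = mats_smult W a (map_mat u x)"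
  by (intro eq_matI) (auto simp: mats_smult_def in_mats u_smult)

lemma map_dsum:
  "x \<in> mats m V \<Longrightarrow> y \<in> mats n V \<Longrightarrow>
   map_mat u (mats_dsum V x y) = mats_dsum W (map_mat u x) (map_mat u y)"
  by (intro eq_matI) (auto simp: mats_dsum_def in_mats mats_zero_def u_zero)

text \<open>Each entry is a double sum, so \<open>u_finsum\<close> is applied to the outer and the
  inner sum in turn; the congruence rules for \<open>finsum\<close> ask for carrier membership of
  every summand.\<close>

lemma map_sandwich:
  assumes "x \<in> mats m V" "\<alpha> \<in> carrier_mat m m" "\<beta> \<in> carrier_mat m m"
  shows "map_mat u (mats_sandwich V \<alpha> x \<beta>) = mats_sandwich W \<alpha> (map_mat u x) \<beta>"
proof -
  have dims: "dim_row x = m" "dim_col x = m" "dim_row \<alpha> = m" "dim_col \<beta> = m"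
    and X: "\<And>k l. k < m \<Longrightarrow> l < m \<Longrightarrow> x $$ (k, l) \<in> carrier V"
    using assms by (auto simp: in_mats)
  have inner: "u (\<Oplus>\<^bsub>V\<^esub>l\<in>{..<m}. c l \<odot>\<^bsub>V\<^esub> x $$ (k, l)) = (\<Oplus>\<^bsub>W\<^esub>l\<in>{..<m}. c l \<odot>\<^bsub>W\<^esub> u (x $$ (k, l)))"
    if k: "k < m" for k c
    using k X by (subst u_finsum) (auto simp: u_smult u_in intro!: W.finsum_cong')
  have "u (\<Oplus>\<^bsub>V\<^esub>k\<in>{..<m}. \<Oplus>\<^bsub>V\<^esub>l\<in>{..<m}. c k l \<odot>\<^bsub>V\<^esub> x $$ (k, l)) =
      (\<Oplus>\<^bsub>W\<^esub>k\<in>{..<m}. \<Oplus>\<^bsub>W\<^esub>l\<in>{..<m}. c k l \<odot>\<^bsub>W\<^esub> map_mat u x $$ (k, l))" for c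
  proof -
    have "u (\<Oplus>\<^bsub>V\<^esub>l\<in>{..<m}. c k l \<odot>\<^bsub>V\<^esub> x $$ (k, l)) =
        (\<Oplus>\<^bsub>W\<^esub>l\<in>{..<m}. c k l \<odot>\<^bsub>W\<^esub> map_mat u x $$ (k, l))" if k: "k < m" for k
      unfolding inner[OF k] using k X dims by (intro W.finsum_cong') (auto simp: u_in)
    moreover have "map_mat u x $$ (k, l) \<in> carrier W" if "k < m" "l < m" for k l
      using that X dims by (simp add: u_in)
    ultimately show ?thesis
      using X by (subst u_finsum) (auto intro!: W.finsum_cong' V.finsum_closed W.finsum_closed)
  qed
  then show ?thesis
    by (intro eq_matI) (simp_all add: mats_sandwich_def dims)
qed

lemma map_in: "x \<in> mats n V \<Longrightarrow> map_mat u x \<in> mats n W"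
  by (erule mats_map) (rule u_in)

end

section \<open>Consequences of Ruan's axioms\<close>

lemma euclid_norm_nonneg [simp]: "0 \<le> euclid_norm v"
  by (simp add: euclid_norm_def sum_nonneg)

text \<open>The two sides differ by the mixed products, which are non-negative.\<close>

lemma sum_squares_le_square_sum:
  fixes f :: "nat \<Rightarrow> real"
  assumes "\<And>i. 0 \<le> f i"
  shows "(\<Sum>i<n. (f i)\<^sup>2) \<le> (\<Sum>i<n. f i)\<^sup>2"
proof (induction n)
  case (Suc n)
  have "0 \<le> (\<Sum>i<n. f i) * f n"
    using assms by (simp add: sum_nonneg)
  then show ?case
    using Suc by (simp add: power2_sum)
qed simp

lemma euclid_norm_le_sum: "euclid_norm v \<le> (\<Sum>i<dim_vec v. cmod (v $ i))"
  unfolding euclid_norm_def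
  by (rule real_le_lsqrt) (simp_all add: sum_nonneg sum_squares_le_square_sum)

lemma component_le_euclid_norm: "i < dim_vec v \<Longrightarrow> cmod (v $ i) \<le> euclid_norm v"
  unfolding euclid_norm_def
  by (rule real_le_rsqrt) (rule member_le_sum[where f = "\<lambda>i. (cmod (v $ i))\<^sup>2"], auto)

text \<open>\<open>op_norm\<close> is a real supremum and says something only once this set is
  bounded. The sum of the moduli of all entries is a crude bound, as the coordinates of a vector in
  the unit ball have modulus at most 1.\<close>

lemma op_norm_bdd:
  "bdd_above (euclid_norm ` (*\<^sub>v) \<alpha> ` {v \<in> carrier_vec (dim_col \<alpha>). euclid_norm v \<le> 1})"
proof (rule bdd_aboveI2)
  fix w assume "w \<in> (*\<^sub>v) \<alpha> ` {v \<in> carrier_vec (dim_col \<alpha>). euclid_norm v \<le> 1}"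
  then obtain v where v: "v \<in> carrier_vec (dim_col \<alpha>)" "euclid_norm v \<le> 1" "w = \<alpha> *\<^sub>v v"
    by auto
  have "euclid_norm w \<le> (\<Sum>i<dim_row \<alpha>. cmod (w $ i))"
    using euclid_norm_le_sum[of w] v by simp
  also have "\<dots> \<le> (\<Sum>i<dim_row \<alpha>. \<Sum>j<dim_col \<alpha>. cmod (\<alpha> $$ (i, j)))"
  proof (rule sum_mono)
    fix i assume i: "i \<in> {..<dim_row \<alpha>}"
    have "cmod (v $ j) \<le> 1" if "j < dim_col \<alpha>" for j
      using component_le_euclid_norm[of j v] v that by auto
    then have "cmod (\<alpha> $$ (i, j) * v $ j) \<le> cmod (\<alpha> $$ (i, j))" if "j < dim_col \<alpha>" for j
      using that by (simp add: norm_mult mult_left_le)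
    moreover have "w $ i = (\<Sum>j<dim_col \<alpha>. \<alpha> $$ (i, j) * v $ j)"
      using i v by (auto simp: scalar_prod_def atLeast0LessThan)
    ultimately show "cmod (w $ i) \<le> (\<Sum>j<dim_col \<alpha>. cmod (\<alpha> $$ (i, j)))"
      by (auto intro!: sum_norm_le)
  qed
  finally show "euclid_norm w \<le> (\<Sum>i<dim_row \<alpha>. \<Sum>j<dim_col \<alpha>. cmod (\<alpha> $$ (i, j)))" .
qed

lemma op_norm_nonneg: "0 \<le> op_norm \<alpha>"
proof -
  have "0\<^sub>v (dim_col \<alpha>) \<in> {v \<in> carrier_vec (dim_col \<alpha>). euclid_norm v \<le> 1}"
    by (auto simp: euclid_norm_def)
  then have "euclid_norm (\<alpha> *\<^sub>v 0\<^sub>v (dim_col \<alpha>)) \<le> op_norm \<alpha>"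
    unfolding op_norm_def using op_norm_bdd[of \<alpha>] by (intro cSUP_upper) (auto simp: image_image)
  then show ?thesis
    by (rule order_trans[rotated]) simp
qed

text \<open>The matrix units. Multiplying by them from both sides isolates one entry and moves it to
  an arbitrary position, which turns the axiom on two-sided multiplication into estimates for
  entries.\<close>

definition unit_mat :: "nat \<Rightarrow> nat \<Rightarrow> nat \<Rightarrow> complex mat" where
  "unit_mat n i j = mat n n (\<lambda>kl. if kl = (i, j) then 1 else 0)"

lemma unit_mat_carrier [simp]: "unit_mat n i j \<in> carrier_mat n n"
  by (simp add: unit_mat_def)

text \<open>The image of \<open>v\<close> has at most one nonzero coordinate, namely
  \<open>v $ j\<close> in place \<open>i\<close>.\<close>

lemma op_norm_unit_mat: 
  assumes "i < n" "j < n"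
  shows "op_norm (unit_mat n i j) \<le> 1"
  unfolding op_norm_def
proof (rule cSUP_least)
  have "0\<^sub>v n \<in> {v \<in> carrier_vec (dim_col (unit_mat n i j)). euclid_norm v \<le> 1}"
    by (auto simp: euclid_norm_def unit_mat_def)
  then show "{v \<in> carrier_vec (dim_col (unit_mat n i j)). euclid_norm v \<le> 1} \<noteq> {}" by blast
next
  fix v assume "v \<in> {v \<in> carrier_vec (dim_col (unit_mat n i j)). euclid_norm v \<le> 1}"
  then have v: "v \<in> carrier_vec n" "euclid_norm v \<le> 1" by (auto simp: unit_mat_def)
  have "(unit_mat n i j *\<^sub>v v) $ k = (if k = i then v $ j else 0)" if "k < n" for k
    using that v assms by (auto simp: unit_mat_def scalar_prod_def if_distrib[of "\<lambda>x. x * _"] cong: if_cong)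
  then have "(\<Sum>k<n. cmod ((unit_mat n i j *\<^sub>v v) $ k)) = (\<Sum>k<n. if k = i then cmod (v $ j) else 0)"
    by (intro sum.cong) auto
  also have "\<dots> \<le> euclid_norm v"
    using assms v component_le_euclid_norm[of j v] by auto
  finally show "euclid_norm (unit_mat n i j *\<^sub>v v) \<le> 1"
    using euclid_norm_le_sum[of "unit_mat n i j *\<^sub>v v"] v by (simp add: unit_mat_def)
qed

section \<open>Matrix norms and the norms of the entries\<close>

definition single :: "nat \<Rightarrow> 'a opspace \<Rightarrow> nat \<Rightarrow> nat \<Rightarrow> 'a \<Rightarrow> 'a mat" where
  "single n V i j v = mat n n (\<lambda>kl. if kl = (i, j) then v else \<zero>\<^bsub>V\<^esub>)"

definition vdist :: "'a opspace \<Rightarrow> 'a \<Rightarrow> 'a \<Rightarrow> real" where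
  "vdist V x y = vnorm V (x \<ominus>\<^bsub>V\<^esub> y)"

text \<open>Ruan's axioms for seminorms, without definiteness and completeness, so that spaces of
  families can be treated before passing to a quotient. The bounded quantifiers repeat the form of
  \<open>operator_space\<close>, so that unfolding is enough to compare the two.\<close>

locale ruan = vsp V for V :: "'a opspace" (structure) +
  assumes all_nonneg: "\<forall>n\<ge>1. \<forall>x\<in>mats n V. 0 \<le> mnorm V x"
    and all_smult: "\<forall>n\<ge>1. \<forall>x\<in>mats n V. \<forall>a. mnorm V (mats_smult V a x) = cmod a * mnorm V x"
    and all_add: "\<forall>n\<ge>1. \<forall>x\<in>mats n V. \<forall>y\<in>mats n V. mnorm V (mats_add V x y) \<le> mnorm V x + mnorm V y"
    and all_dsum: "\<forall>m\<ge>1. \<forall>n\<ge>1. \<forall>x\<in>mats m V. \<forall>y\<in>mats n V.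
      mnorm V (mats_dsum V x y) = max (mnorm V x) (mnorm V y)"
    and all_sandwich: "\<forall>m\<ge>1. \<forall>x\<in>mats m V. \<forall>\<alpha>\<in>carrier_mat m m. \<forall>\<beta>\<in>carrier_mat m m.
      mnorm V (mats_sandwich V \<alpha> x \<beta>) \<le> op_norm \<alpha> * mnorm V x * op_norm \<beta>"

lemmas ruanI = ruan.intro[OF _ ruan_axioms.intro, rule_format]

context ruan
begin

lemmas norm_nonneg = all_nonneg[rule_format]
  and norm_smult = all_smult[rule_format]
  and norm_add = all_add[rule_format]
  and norm_dsum = all_dsum[rule_format]
  and norm_sandwich = all_sandwich[rule_format]

lemma single_in: "v \<in> carrier V \<Longrightarrow> single n V i j v \<in> mats n V"
  by (auto simp: single_def)

lemma norm_zero: 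
  assumes "n \<ge> 1"
  shows "mnorm V (mats_zero n n V) = 0"
proof -
  have "mats_smult V 0 (mats_zero n n V) = mats_zero n n V"
    by (intro eq_matI) (auto simp: mats_smult_def mats_zero_def)
  then show ?thesis
    using norm_smult[OF assms mats_zero_in, of 0] by simp
qed

lemma finsum_delta:
  assumes "finite A" "a \<in> A" "v \<in> carrier V" 
  shows "finsum V (\<lambda>k. if k = a then v else \<zero>) A = v"
proof -
  have "finsum V (\<lambda>k. if k = a then v else \<zero>) A = finsum V (\<lambda>k. if a = k then v else \<zero>) A"
    using assms by (intro finsum_cong') auto
  then show ?thesis
    using finsum_singleton[of a A "\<lambda>_. v"] assms by auto
qed

lemma sandwich_unit_mat:
  assumes x: "x \<in> mats n V" and "i < n" "j < n" "i' < n" "j' < n"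
  shows "mats_sandwich V (unit_mat n i' i) x (unit_mat n j j') = single n V i' j' (x $$ (i, j))"
proof (rule eq_matI)
  fix p q assume "p < dim_row (single n V i' j' (x $$ (i, j)))" "q < dim_col (single n V i' j' (x $$ (i, j)))"
  then have pq: "p < n" "q < n" by (auto simp: single_def)
  note X = matsD[OF x]
  let ?w = "if (p, q) = (i', j') then x $$ (i, j) else \<zero>"
  have w: "?w \<in> carrier V" using X assms by auto
  have *: "(unit_mat n i' i $$ (p, k) * unit_mat n j j' $$ (l, q)) \<odot> x $$ (k, l) =
      (if l = j then (if k = i then ?w else \<zero>) else \<zero>)" if "k < n" "l < n" for k l
    using that pq X by (auto simp: unit_mat_def)
  have "(\<Oplus>l\<in>{..<n}. (unit_mat n i' i $$ (p, k) * unit_mat n j j' $$ (l, q)) \<odot> x $$ (k, l)) =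
      (if k = i then ?w else \<zero>)" if "k < n" for k
  proof -
    have "(\<Oplus>l\<in>{..<n}. (unit_mat n i' i $$ (p, k) * unit_mat n j j' $$ (l, q)) \<odot> x $$ (k, l)) =
        (\<Oplus>l\<in>{..<n}. if l = j then (if k = i then ?w else \<zero>) else \<zero>)"
      using that w * by (intro finsum_cong') auto
    also have "\<dots> = (if k = i then ?w else \<zero>)"
      using assms w by (intro finsum_delta) auto
    finally show ?thesis .
  qed
  then have "(\<Oplus>k\<in>{..<n}. \<Oplus>l\<in>{..<n}. (unit_mat n i' i $$ (p, k) * unit_mat n j j' $$ (l, q)) \<odot> x $$ (k, l))
      = (\<Oplus>k\<in>{..<n}. if k = i then ?w else \<zero>)"
    using w by (intro finsum_cong') auto
  also have "\<dots> = ?w"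
    using assms w by (intro finsum_delta) auto
  finally show "mats_sandwich V (unit_mat n i' i) x (unit_mat n j j') $$ (p, q) =
      single n V i' j' (x $$ (i, j)) $$ (p, q)"
    using pq X by (simp add: mats_sandwich_def single_def unit_mat_def)
qed (auto simp: mats_sandwich_def single_def unit_mat_def)

text \<open>Compression by matrix units is contractive, since both factors have operator norm at
  most 1.\<close>

lemma norm_single_entry_le:
  assumes x: "x \<in> mats n V" and ij: "i < n" "j < n" "i' < n" "j' < n"
  shows "mnorm V (single n V i' j' (x $$ (i, j))) \<le> mnorm V x"
proof -
  have n: "n \<ge> 1" using ij by simp
  have "mnorm V (single n V i' j' (x $$ (i, j))) \<le>
      op_norm (unit_mat n i' i) * mnorm V x * op_norm (unit_mat n j j')"
    using norm_sandwich[OF n x, of "unit_mat n i' i" "unit_mat n j j'"] sandwich_unit_mat[OF assms]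
    by simp
  also have "\<dots> \<le> 1 * mnorm V x * 1"
    using op_norm_unit_mat ij norm_nonneg[OF n x] op_norm_nonneg by (intro mult_mono) auto
  finally show ?thesis by simp
qed

text \<open>The matrix is the block sum of \<open>v\<close> and a zero block. The direct-sum axiom
  asks for two blocks of positive size, hence the separate case \<open>n = 1\<close>.\<close>

lemma norm_single_0:
  assumes v: "v \<in> carrier V" and n: "n \<ge> 1"
  shows "mnorm V (single n V 0 0 v) = vnorm V v"
proof (cases "n = 1")
  case True
  then have "single n V 0 0 v = mat 1 1 (\<lambda>_. v)"
    by (intro eq_matI) (auto simp: single_def)
  then show ?thesis by (simp add: vnorm_def)
next
  case False
  then have m: "n - 1 \<ge> 1" using n by simp
  have "single n V 0 0 v = mats_dsum V (mat 1 1 (\<lambda>_. v)) (mats_zero (n - 1) (n - 1) V)"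
    using n by (intro eq_matI) (auto simp: single_def mats_dsum_def mats_zero_def)
  moreover have "mat 1 1 (\<lambda>_. v) \<in> mats 1 V" using v by auto
  ultimately show ?thesis
    using norm_dsum[OF _ m _ mats_zero_in, of 1 "mat 1 1 (\<lambda>_. v)"] norm_zero[OF m] 
      norm_nonneg[of 1 "mat 1 1 (\<lambda>_. v)"] by (simp add: vnorm_def)
qed

lemma vnorm_entry_le:
  assumes x: "x \<in> mats n V" and ij: "i < n" "j < n"
  shows "vnorm V (x $$ (i, j)) \<le> mnorm V x"
  using norm_single_entry_le[OF x ij, of 0 0] norm_single_0[of "x $$ (i, j)" n] matsD(3)[OF x ij] ij
  by simp

lemma norm_single_le:
  assumes v: "v \<in> carrier V" and ij: "i < n" "j < n"
  shows "mnorm V (single n V i j v) \<le> vnorm V v"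
  using norm_single_entry_le[OF single_in[OF v, of n 0 0], of 0 0 i j] norm_single_0[OF v, of n] ij
  by (simp add: single_def)

text \<open>A matrix is the sum of its one-entry matrices, each of norm at most that of its entry.
  Together with \<open>vnorm_entry_le\<close> this lets convergence and boundedness of matrices be
  checked in the first norm.\<close>

lemma norm_le_sum_entries:
  assumes x: "x \<in> mats n V" and n: "n \<ge> 1"
  shows "mnorm V x \<le> (\<Sum>(i, j)\<in>{..<n} \<times> {..<n}. vnorm V (x $$ (i, j)))"
proof -
  \<comment> \<open>Blanking the positions outside \<open>P\<close> allows an induction that adds
    one position at a time, from the zero matrix to \<open>x\<close>.\<close>
  define part where "part P = mat n n (\<lambda>ij. if ij \<in> P then x $$ ij else \<zero>)" for P
  note X = matsD[OF x]
  have in_part: "part P \<in> mats n V" for P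
    using X by (auto simp: part_def in_mats)
  have "mnorm V (part P) \<le> (\<Sum>(i, j)\<in>P. vnorm V (x $$ (i, j)))"
    if "finite P" "P \<subseteq> {..<n} \<times> {..<n}" for P
    using that
  proof (induction P rule: finite_induct)
    case empty
    have "part {} = mats_zero n n V" by (simp add: part_def mats_zero_def)
    then show ?case using norm_zero[OF n] by simp
  next
    case (insert ij P)
    obtain i j where ij: "ij = (i, j)" by force
    have lt: "i < n" "j < n" using insert.prems ij by auto
    have "part (insert ij P) = mats_add V (single n V i j (x $$ (i, j))) (part P)"
      using X insert.hyps ij by (intro eq_matI) (auto simp: part_def mats_add_def single_def)
    then have "mnorm V (part (insert ij P)) \<le> mnorm V (single n V i j (x $$ (i, j))) + mnorm V (part P)"
      using norm_add[OF n single_in in_part] X lt by simp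
    also have "\<dots> \<le> vnorm V (x $$ (i, j)) + (\<Sum>(i, j)\<in>P. vnorm V (x $$ (i, j)))"
      using norm_single_le[of "x $$ (i, j)" i n j] X lt insert by (intro add_mono) auto
    finally show ?case using insert.hyps ij by simp
  qed
  moreover have "part ({..<n} \<times> {..<n}) = x"
    using X by (intro eq_matI) (auto simp: part_def)
  ultimately show ?thesis by (metis finite_SigmaI finite_lessThan subset_refl)
qed

lemma mat1_in: "v \<in> carrier V \<Longrightarrow> mat 1 1 (\<lambda>_. v) \<in> mats 1 V"
  by auto

lemma vnorm_nonneg: "v \<in> carrier V \<Longrightarrow> 0 \<le> vnorm V v"
  using norm_nonneg[of 1, OF _ mat1_in] by (simp add: vnorm_def)

lemma vnorm_smult: "v \<in> carrier V \<Longrightarrow> vnorm V (a \<odot> v) = cmod a * vnorm V v"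
proof -
  assume v: "v \<in> carrier V"
  have "mats_smult V a (mat 1 1 (\<lambda>_. v)) = mat 1 1 (\<lambda>_. a \<odot> v)"
    by (intro eq_matI) (auto simp: mats_smult_def)
  then show ?thesis
    using norm_smult[of 1, OF _ mat1_in, of v a] v by (simp add: vnorm_def)
qed

lemma vnorm_add: "v \<in> carrier V \<Longrightarrow> w \<in> carrier V \<Longrightarrow> vnorm V (v \<oplus> w) \<le> vnorm V v + vnorm V w"
proof -
  assume vw: "v \<in> carrier V" "w \<in> carrier V"
  have "mats_add V (mat 1 1 (\<lambda>_. v)) (mat 1 1 (\<lambda>_. w)) = mat 1 1 (\<lambda>_. v \<oplus> w)"
    by (intro eq_matI) (auto simp: mats_add_def)
  then show ?thesis
    using norm_add[of 1, OF _ mat1_in mat1_in, of v w] vw by (simp add: vnorm_def)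
qed

lemma vnorm_zero [simp]: "vnorm V \<zero> = 0"
  using vnorm_smult[of \<zero> 0] by simp

section \<open>The distance given by the first norm\<close>

lemma vdist_self [simp]: "x \<in> carrier V \<Longrightarrow> vdist V x x = 0"
  by (simp add: vdist_def a_minus_def r_neg)

lemma vdist_nonneg: "x \<in> carrier V \<Longrightarrow> y \<in> carrier V \<Longrightarrow> 0 \<le> vdist V x y"
  by (simp add: vdist_def vnorm_nonneg)

lemma vdist_commute:
  assumes "x \<in> carrier V" "y \<in> carrier V"
  shows "vdist V x y = vdist V y x"
proof -
  have "x \<ominus> y = (-1) \<odot> (y \<ominus> x)"
    using assms by (simp add: minus_eq' smult_add_right smult_smult a_comm)
  then show ?thesis
    using vnorm_smult[of "y \<ominus> x" "-1"] assms by (simp add: vdist_def)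
qed

lemma vdist_triangle:
  assumes "x \<in> carrier V" "y \<in> carrier V" "z \<in> carrier V"
  shows "vdist V x z \<le> vdist V x y + vdist V y z"
proof -
  have "x \<ominus> z = (x \<ominus> y) \<oplus> (y \<ominus> z)"
    using assms by (simp add: a_minus_def a_assoc r_neg1)
  then show ?thesis
    using vnorm_add[of "x \<ominus> y" "y \<ominus> z"] assms by (simp add: vdist_def)
qed

lemma vdist_add:
  assumes "x \<in> carrier V" "y \<in> carrier V" "z \<in> carrier V" "w \<in> carrier V"
  shows "vdist V (x \<oplus> y) (z \<oplus> w) \<le> vdist V x z + vdist V y w"
proof -
  have "(x \<oplus> y) \<ominus> (z \<oplus> w) = (x \<ominus> z) \<oplus> (y \<ominus> w)"
    using assms by (simp add: a_minus_def minus_add a_ac)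
  then show ?thesis
    using vnorm_add[of "x \<ominus> z" "y \<ominus> w"] assms by (simp add: vdist_def)
qed

lemma vdist_smult:
  assumes "x \<in> carrier V" "y \<in> carrier V"
  shows "vdist V (a \<odot> x) (a \<odot> y) = cmod a * vdist V x y"
proof -
  have "a \<odot> x \<ominus> a \<odot> y = a \<odot> (x \<ominus> y)"
    using assms by (simp add: minus_eq' smult_add_right smult_smult)
  then show ?thesis
    using vnorm_smult[of "x \<ominus> y" a] assms by (simp add: vdist_def)
qed

lemma vdist_smult_left:
  assumes "x \<in> carrier V"
  shows "vdist V (a \<odot> x) (b \<odot> x) = cmod (a - b) * vnorm V x"
proof -
  have "a \<odot> x \<ominus> b \<odot> x = (a - b) \<odot> x"
    using assms smult_add_left[of x a "- b"] by (simp add: minus_eq' smult_smult)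
  then show ?thesis
    using vnorm_smult[of x "a - b"] assms by (simp add: vdist_def)
qed

lemma vdist_zero: "x \<in> carrier V \<Longrightarrow> vdist V x \<zero> = vnorm V x"
  by (simp add: vdist_def minus_eq')

lemma norm_le_add_dist:
  assumes x: "x \<in> mats n V" and y: "y \<in> mats n V" and n: "n \<ge> 1"
  shows "mnorm V x \<le> mnorm V y + (\<Sum>(i, j)\<in>{..<n} \<times> {..<n}. vdist V (x $$ (i, j)) (y $$ (i, j)))"
proof -
  note X = matsD[OF x] and Y = matsD[OF y]
  define z where "z = mat n n (\<lambda>ij. x $$ ij \<ominus> y $$ ij)"
  have z: "z \<in> mats n V" using X Y by (auto simp: z_def)
  have "x = mats_add V y z"
  proof (rule eq_matI)
    fix i j assume "i < dim_row (mats_add V y z)" "j < dim_col (mats_add V y z)"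
    then have ij: "i < n" "j < n" using Y by (auto simp: mats_add_def)
    have "a = b \<oplus> (a \<ominus> b)" if "a \<in> carrier V" "b \<in> carrier V" for a b
      using that by (simp add: a_minus_def a_comm[of a] r_neg2)
    then show "x $$ (i, j) = mats_add V y z $$ (i, j)"
      using ij X Y by (simp add: mats_add_def z_def)
  qed (use X Y in \<open>auto simp: mats_add_def\<close>)
  then have "mnorm V x \<le> mnorm V y + mnorm V z"
    using norm_add[OF n y z] by simp
  also have "mnorm V z \<le> (\<Sum>(i, j)\<in>{..<n} \<times> {..<n}. vnorm V (z $$ (i, j)))"
    by (rule norm_le_sum_entries[OF z n])
  also have "\<dots> = (\<Sum>(i, j)\<in>{..<n} \<times> {..<n}. vdist V (x $$ (i, j)) (y $$ (i, j)))"
    by (intro sum.cong) (auto simp: vdist_def z_def)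
  finally show ?thesis by simp
qed

text \<open>The form in which density is used: matrices with entries in a dense subset control all
  matrices, with a factor \<open>n * n\<close> for the number of entries. For \<open>e = 0\<close>
  it shows that entries at distance 0 can be exchanged without changing the norm.\<close>

lemma norm_le_add_eps:
  assumes x: "x \<in> mats n V" and y: "y \<in> mats n V" and n: "n \<ge> 1"
    and e: "\<And>i j. i < n \<Longrightarrow> j < n \<Longrightarrow> vdist V (x $$ (i, j)) (y $$ (i, j)) \<le> e"
  shows "mnorm V x \<le> mnorm V y + real (n * n) * e"
proof -
  have "(\<Sum>(i, j)\<in>{..<n} \<times> {..<n}. vdist V (x $$ (i, j)) (y $$ (i, j))) \<le>
      (\<Sum>(i, j)\<in>{..<n} \<times> {..<n}. e)"
    using e by (intro sum_mono) auto
  also have "\<dots> = real (n * n) * e" by simp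
  finally show ?thesis using norm_le_add_dist[OF x y n] by linarith
qed

end

section \<open>Constructions of operator spaces\<close>

text \<open>The epsilon form is convenient for transport along isometries;
  \<open>operator_space_iff\<close> links it with the sequential limit in
  \<open>operator_space\<close>.\<close>

definition os_complete :: "'a opspace \<Rightarrow> bool" where
  "os_complete V \<longleftrightarrow> (\<forall>s :: nat \<Rightarrow> 'a. range s \<subseteq> carrier V \<and>
     (\<forall>e>0. \<exists>N. \<forall>p\<ge>N. \<forall>q\<ge>N. vdist V (s p) (s q) < e) \<longrightarrow>
     (\<exists>l\<in>carrier V. \<forall>e>0. \<exists>N. \<forall>p\<ge>N. vdist V (s p) l < e))"

text \<open>Stating it for vectors is enough: by \<open>vnorm_entry_le\<close>, the entries of a
  matrix of norm 0 have norm 0.\<close>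

definition os_definite :: "'a opspace \<Rightarrow> bool" where
  "os_definite V \<longleftrightarrow> (\<forall>v\<in>carrier V. vnorm V v = 0 \<longrightarrow> v = \<zero>\<^bsub>V\<^esub>)"

lemma vectorspace_iff: "vectorspace (class_ring :: complex ring) V \<longleftrightarrow> vsp V"
  unfolding vectorspace_def vsp_def using class_field.field_axioms by auto

lemma operator_space_iff: "operator_space V \<longleftrightarrow> ruan V \<and> os_complete V \<and> os_definite V"
proof (cases "ruan V")
  case True
  then interpret ruan V .
  have lim: "(\<lambda>p. vdist V (s p) l) \<longlonglongrightarrow> 0 \<longleftrightarrow> (\<forall>e>0. \<exists>N. \<forall>p\<ge>N. vdist V (s p) l < e)"
    if "range s \<subseteq> carrier V" "l \<in> carrier V" for s :: "nat \<Rightarrow> 'a" and l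
    unfolding lim_sequentially using that
    by (simp add: dist_real_def vdist_nonneg image_subset_iff)
  have c: "os_complete V \<longleftrightarrow> (\<forall>s :: nat \<Rightarrow> 'a. range s \<subseteq> carrier V \<and>
          (\<forall>e>0. \<exists>N. \<forall>p\<ge>N. \<forall>q\<ge>N. vnorm V (s p \<ominus>\<^bsub>V\<^esub> s q) < e) \<longrightarrow>
          (\<exists>l\<in>carrier V. (\<lambda>p. vnorm V (s p \<ominus>\<^bsub>V\<^esub> l)) \<longlonglongrightarrow> 0))"
    unfolding os_complete_def vdist_def[symmetric]
    by (rule all_cong1, rule imp_cong, rule refl, rule bex_cong, rule refl, rule lim[symmetric]) auto
  have d: "os_definite V \<longleftrightarrow> (\<forall>n\<ge>1. \<forall>x\<in>mats n V. mnorm V x = 0 \<longleftrightarrow> x = mats_zero n n V)"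
  proof
    assume d: "os_definite V"
    show "\<forall>n\<ge>1. \<forall>x\<in>mats n V. mnorm V x = 0 \<longleftrightarrow> x = mats_zero n n V"
    proof (intro allI impI ballI iffI)
      fix n x assume n: "1 \<le> n" and x: "x \<in> mats n V" and z: "mnorm V x = 0"
      have "x $$ (i, j) = \<zero>\<^bsub>V\<^esub>" if "i < n" "j < n" for i j
        using d vnorm_entry_le[OF x that] z vnorm_nonneg[of "x $$ (i, j)"] matsD(3)[OF x that]
        by (auto simp: os_definite_def)
      then show "x = mats_zero n n V"
        using matsD[OF x] by (intro eq_matI) (auto simp: mats_zero_def)
    qed (simp add: norm_zero)
  next
    assume *: "\<forall>n\<ge>1. \<forall>x\<in>mats n V. mnorm V x = 0 \<longleftrightarrow> x = mats_zero n n V"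
    show "os_definite V"
      unfolding os_definite_def
    proof (intro ballI impI)
      fix v assume v: "v \<in> carrier V" and z: "vnorm V v = 0"
      have "mat 1 1 (\<lambda>_. v) = mats_zero 1 1 V"
        using * z mat1_in[OF v] unfolding vnorm_def by blast
      then have "mat 1 1 (\<lambda>_. v) $$ (0, 0) = mats_zero 1 1 V $$ (0, 0)" by simp
      then show "v = \<zero>\<^bsub>V\<^esub>" by (simp add: mats_zero_def)
    qed
  qed
  show ?thesis
    unfolding operator_space_def c d vectorspace_iff ruan_def ruan_axioms_def
    by (rule iffI; elim conjE; intro conjI; assumption)
next
  case False
  moreover have "operator_space V \<Longrightarrow> ruan V"
    unfolding operator_space_def vectorspace_iff ruan_def ruan_axioms_def
    by (elim conjE; intro conjI; assumption)
  ultimately show ?thesis by blast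
qed

lemma os_completeD:
  fixes s :: "nat \<Rightarrow> 'a"
  assumes "os_complete V" "\<And>p. s p \<in> carrier V"
    "\<And>e. e > 0 \<Longrightarrow> \<exists>N. \<forall>p\<ge>N. \<forall>q\<ge>N. vdist V (s p) (s q) < e"
  shows "\<exists>l\<in>carrier V. \<forall>e>0. \<exists>N. \<forall>p\<ge>N. vdist V (s p) l < e"
  using assms unfolding os_complete_def image_subset_iff by simp

lemma os_completeI:
  assumes "\<And>s :: nat \<Rightarrow> 'a. (\<And>p. s p \<in> carrier V) \<Longrightarrow>
    (\<And>e. e > 0 \<Longrightarrow> \<exists>N. \<forall>p\<ge>N. \<forall>q\<ge>N. vdist V (s p) (s q) < e) \<Longrightarrow>
    \<exists>l\<in>carrier V. \<forall>e>0. \<exists>N. \<forall>p\<ge>N. vdist V (s p) l < e"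
  shows "os_complete V"
  unfolding os_complete_def image_subset_iff by (intro allI impI assms) auto

locale os = ruan V for V :: "'a opspace" (structure) +
  assumes complete: "os_complete V" and definite: "os_definite V"
begin

lemma vdist_0: "x \<in> carrier V \<Longrightarrow> y \<in> carrier V \<Longrightarrow> vdist V x y = 0 \<Longrightarrow> x = y"
proof -
  assume xy: "x \<in> carrier V" "y \<in> carrier V" "vdist V x y = 0"
  then have "x \<ominus> y = \<zero>"
    using definite by (simp add: os_definite_def vdist_def)
  moreover have "x = (x \<ominus> y) \<oplus> y"
    using xy by (simp add: a_minus_def a_assoc l_neg)
  ultimately show "x = y" using xy by simp
qed

lemma vdist_le_0: "x \<in> carrier V \<Longrightarrow> y \<in> carrier V \<Longrightarrow> (\<And>e. e > 0 \<Longrightarrow> vdist V x y \<le> e) \<Longrightarrow> x = y"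
proof (rule vdist_0)
  assume "x \<in> carrier V" "y \<in> carrier V" "\<And>e. e > 0 \<Longrightarrow> vdist V x y \<le> e"
  then show "vdist V x y = 0"
    using vdist_nonneg[of x y] field_le_epsilon[of "vdist V x y" 0] by fastforce
qed

end

lemma os_iff: "os V \<longleftrightarrow> operator_space V"
  by (simp add: os_def os_axioms_def operator_space_iff)

text \<open>The element 0 makes the supremum over an empty index set meaningful.\<close>

definition Sup0 :: "'k set \<Rightarrow> ('k \<Rightarrow> real) \<Rightarrow> real" where
  "Sup0 K f = Sup (insert 0 (f ` K))"

lemma Sup0_upper: "bdd_above (f ` K) \<Longrightarrow> k \<in> K \<Longrightarrow> f k \<le> Sup0 K f"
  unfolding Sup0_def by (intro cSup_upper) auto

lemma Sup0_nonneg: "bdd_above (f ` K) \<Longrightarrow> 0 \<le> Sup0 K f"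
  unfolding Sup0_def by (intro cSup_upper) auto

lemma Sup0_least: "(\<And>k. k \<in> K \<Longrightarrow> f k \<le> b) \<Longrightarrow> 0 \<le> b \<Longrightarrow> Sup0 K f \<le> b"
  unfolding Sup0_def by (intro cSup_least) auto

text \<open>Each axiom survives a supremum of seminorms pulled back along linear maps, since it
  bounds norms by expressions monotone in the norms. Products use it with the coordinate
  projections, subspaces with a single inclusion.\<close>

lemma ruan_Sup0:
  fixes W :: "'a opspace" and V :: "'k \<Rightarrow> 'b opspace"
  assumes W: "vsp W" and V: "\<And>k. k \<in> K \<Longrightarrow> ruan (V k)" and u: "\<And>k. k \<in> K \<Longrightarrow> u k \<in> lin W (V k)"
    and bdd: "\<And>n x. n \<ge> 1 \<Longrightarrow> x \<in> mats n W \<Longrightarrow> bdd_above ((\<lambda>k. mnorm (V k) (map_mat (u k) x)) ` K)"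
    and N: "\<And>n x. n \<ge> 1 \<Longrightarrow> x \<in> mats n W \<Longrightarrow> mnorm W x = Sup0 K (\<lambda>k. mnorm (V k) (map_mat (u k) x))"
  shows "ruan W"
proof -
  interpret W: vsp W by fact
  let ?N = "\<lambda>k x. mnorm (V k) (map_mat (u k) x)"
  have hom: "vsp_hom W (V k) (u k)" if "k \<in> K" for k
    using W V u that by (simp add: vsp_hom_def vsp_hom_axioms_def ruan.axioms(1))
  note in_V = vsp_hom.map_in[OF hom]
  have up: "?N k x \<le> mnorm W x" if "n \<ge> 1" "x \<in> mats n W" "k \<in> K" for n x k
    using N[OF that(1,2)] Sup0_upper[OF bdd[OF that(1,2)] that(3)] by simp
  have least: "mnorm W x \<le> b" if "n \<ge> 1" "x \<in> mats n W" "\<And>k. k \<in> K \<Longrightarrow> ?N k x \<le> b" "0 \<le> b" for n x b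
    using N[OF that(1,2)] Sup0_least[of K "\<lambda>k. ?N k x"] that by simp
  have nn: "0 \<le> mnorm W x" if "n \<ge> 1" "x \<in> mats n W" for n x
    using N[OF that(1,2)] Sup0_nonneg[OF bdd[OF that(1,2)]] by simp
  have smult_le: "mnorm W (mats_smult W a x) \<le> cmod a * mnorm W x" if n: "n \<ge> 1" and x: "x \<in> mats n W" for n x a
  proof (rule least[OF n W.mats_smult_in[OF x]])
    fix k assume k: "k \<in> K"
    show "?N k (mats_smult W a x) \<le> cmod a * mnorm W x"
      using vsp_hom.map_smult[OF hom[OF k] x, of a] ruan.norm_smult[OF V[OF k] n in_V[OF k x], of a]
        up[OF n x k] by (simp add: mult_left_mono)
  qed (simp add: nn[OF n x])
  have smult_eq: "mnorm W (mats_smult W a x) = cmod a * mnorm W x" if n: "n \<ge> 1" and x: "x \<in> mats n W" for n x a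
  proof (cases "a = 0")
    case True
    then show ?thesis
      using smult_le[OF n x, of a] nn[OF n W.mats_smult_in[OF x, of a]] by simp
  next
    case False
    \<comment> \<open>The bound by the supremum gives one inequality; the same inequality for the
      inverse scalar gives the other.\<close>
    have "mats_smult W (inverse a) (mats_smult W a x) = x"
      using matsD[OF x] False by (intro eq_matI) (auto simp: mats_smult_def W.smult_smult)
    then have "mnorm W x \<le> cmod (inverse a) * mnorm W (mats_smult W a x)"
      using smult_le[OF n W.mats_smult_in[OF x, of a], of "inverse a"] by simp
    then have "cmod a * mnorm W x \<le> mnorm W (mats_smult W a x)"
      using False by (simp add: norm_divide field_simps)
    then show ?thesis using smult_le[OF n x, of a] by simp
  qed
  have add: "mnorm W (mats_add W x y) \<le> mnorm W x + mnorm W y"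
    if n: "n \<ge> 1" and x: "x \<in> mats n W" and y: "y \<in> mats n W" for n x y
  proof (rule least[OF n W.mats_add_in[OF x y]])
    fix k assume k: "k \<in> K"
    show "?N k (mats_add W x y) \<le> mnorm W x + mnorm W y"
      using vsp_hom.map_add[OF hom[OF k] x y] ruan.norm_add[OF V[OF k] n in_V[OF k x] in_V[OF k y]]
        up[OF n x k] up[OF n y k] by simp
  qed (simp add: nn[OF n x] nn[OF n y])
  have dsum: "mnorm W (mats_dsum W x y) = max (mnorm W x) (mnorm W y)"
    if m: "m \<ge> 1" and n: "n \<ge> 1" and x: "x \<in> mats m W" and y: "y \<in> mats n W" for m n x y
  proof -
    have mn: "m + n \<ge> 1" using m by simp
    note xy = W.mats_dsum_in[OF x y]
    have eq: "?N k (mats_dsum W x y) = max (?N k x) (?N k y)" if k: "k \<in> K" for k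
      using vsp_hom.map_dsum[OF hom[OF k] x y] ruan.norm_dsum[OF V[OF k] m n in_V[OF k x] in_V[OF k y]] by simp
    have "mnorm W (mats_dsum W x y) \<le> max (mnorm W x) (mnorm W y)"
      by (rule least[OF mn xy]) (use eq up[OF m x] up[OF n y] nn[OF m x] in \<open>fastforce simp: le_max_iff_disj\<close>)+
    moreover have "mnorm W x \<le> mnorm W (mats_dsum W x y)"
      by (rule least[OF m x]) (use eq up[OF mn xy] nn[OF mn xy] in \<open>fastforce+\<close>)
    moreover have "mnorm W y \<le> mnorm W (mats_dsum W x y)"
      by (rule least[OF n y]) (use eq up[OF mn xy] nn[OF mn xy] in \<open>fastforce+\<close>)
    ultimately show ?thesis by simp
  qed
  have sand: "mnorm W (mats_sandwich W \<alpha> x \<beta>) \<le> op_norm \<alpha> * mnorm W x * op_norm \<beta>"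
    if m: "m \<ge> 1" and x: "x \<in> mats m W" and \<alpha>: "\<alpha> \<in> carrier_mat m m" and \<beta>: "\<beta> \<in> carrier_mat m m" for m x \<alpha> \<beta>
  proof (rule least[OF m W.mats_sandwich_in[OF x \<alpha> \<beta>]])
    fix k assume k: "k \<in> K"
    have "?N k (mats_sandwich W \<alpha> x \<beta>) \<le> op_norm \<alpha> * ?N k x * op_norm \<beta>"
      using vsp_hom.map_sandwich[OF hom[OF k] x \<alpha> \<beta>] ruan.norm_sandwich[OF V[OF k] m in_V[OF k x] \<alpha> \<beta>] by simp
    also have "\<dots> \<le> op_norm \<alpha> * mnorm W x * op_norm \<beta>"
      using up[OF m x k] by (intro mult_right_mono mult_left_mono op_norm_nonneg)
    finally show "?N k (mats_sandwich W \<alpha> x \<beta>) \<le> op_norm \<alpha> * mnorm W x * op_norm \<beta>" .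
  qed (simp add: op_norm_nonneg nn[OF m x])
  show ?thesis
    by (rule ruanI[OF W nn smult_eq add dsum sand])
qed

text \<open>Matrices over \<open>W\<close> are lifted entrywise along a right inverse of
  \<open>u\<close>; since \<open>u\<close> preserves all matrix norms, each axiom is that of
  \<open>V\<close> for the lifts.\<close>

lemma ruan_surj:
  assumes V: "ruan V" and W: "vsp W" and u: "u \<in> lin V W" and surj: "u ` carrier V = carrier W"
    and N: "\<And>n x. n \<ge> 1 \<Longrightarrow> x \<in> mats n V \<Longrightarrow> mnorm W (map_mat u x) = mnorm V x"
  shows "ruan W"
proof -
  interpret V: ruan V by (rule V)
  interpret W: vsp W by fact
  interpret vsp_hom V W u by unfold_locales fact
  have lift: "\<exists>x\<in>mats n V. y = map_mat u x" if y: "y \<in> mats n W" for n y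
  proof (intro bexI)
    let ?s = "inv_into (carrier V) u"
    have s: "?s w \<in> carrier V" "u (?s w) = w" if "w \<in> carrier W" for w
      using that surj by (auto simp: inv_into_into f_inv_into_f)
    show "map_mat ?s y \<in> mats n V" using mats_map[OF y] s by blast
    show "y = map_mat u (map_mat ?s y)"
      using map_mat_id'[OF y, of "\<lambda>w. u (?s w)"] s by (simp add: map_mat_comp')
  qed
  have "0 \<le> mnorm W y" if "n \<ge> 1" "y \<in> mats n W" for n y
    using lift[OF that(2)] N[OF that(1)] V.norm_nonneg[OF that(1)] by force
  moreover have "mnorm W (mats_smult W a y) = cmod a * mnorm W y" if n: "n \<ge> 1" and y: "y \<in> mats n W" for n y a
  proof -
    obtain x where x: "x \<in> mats n V" "y = map_mat u x"
      using lift[OF y] by blast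
    then show ?thesis
      using N[OF n x(1)] N[OF n V.mats_smult_in[OF x(1)]] V.norm_smult[OF n x(1)]
      by (simp flip: map_smult[OF x(1)])
  qed
  moreover have "mnorm W (mats_add W x y) \<le> mnorm W x + mnorm W y"
    if n: "n \<ge> 1" and x: "x \<in> mats n W" and y: "y \<in> mats n W" for n x y
  proof -
    obtain x' y' where x': "x' \<in> mats n V" "x = map_mat u x'" and y': "y' \<in> mats n V" "y = map_mat u y'"
      using lift[OF x] lift[OF y] by blast
    then show ?thesis
      using N[OF n x'(1)] N[OF n y'(1)] N[OF n V.mats_add_in[OF x'(1) y'(1)]]
        V.norm_add[OF n x'(1) y'(1)]
      by (simp flip: map_add[OF x'(1) y'(1)])
  qed
  moreover have "mnorm W (mats_dsum W x y) = max (mnorm W x) (mnorm W y)"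
    if mn: "m \<ge> 1" "n \<ge> 1" and xy: "x \<in> mats m W" "y \<in> mats n W" for m n x y
  proof -
    obtain x' y' where x': "x' \<in> mats m V" "x = map_mat u x'" and y': "y' \<in> mats n V" "y = map_mat u y'"
      using lift[OF xy(1)] lift[OF xy(2)] by blast
    then show ?thesis
      using N[of "m + n", OF _ V.mats_dsum_in[OF x'(1) y'(1)]] N[OF mn(1) x'(1)] N[OF mn(2) y'(1)]
        map_dsum[OF x'(1) y'(1)] V.norm_dsum[OF mn x'(1) y'(1)] mn by simp
  qed
  moreover have "mnorm W (mats_sandwich W \<alpha> x \<beta>) \<le> op_norm \<alpha> * mnorm W x * op_norm \<beta>"
    if m: "m \<ge> 1" and x: "x \<in> mats m W" and ab: "\<alpha> \<in> carrier_mat m m" "\<beta> \<in> carrier_mat m m" for m x \<alpha> \<beta>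
  proof -
    obtain x' where x': "x' \<in> mats m V" "x = map_mat u x'"
      using lift[OF x] by blast
    then show ?thesis
      using N[OF m V.mats_sandwich_in[OF x'(1) ab]] N[OF m x'(1)] map_sandwich[OF x'(1) ab]
        V.norm_sandwich[OF m x'(1) ab] by simp
  qed
  ultimately show ?thesis
    by (rule ruanI[OF W])
qed

lemma map_mat1: "map_mat u (mat 1 1 (\<lambda>_. v)) = mat 1 1 (\<lambda>_. u v)"
  by (intro eq_matI) auto

lemma complete_surj:
  fixes W :: "'b opspace"
  assumes V: "ruan V" "os_complete V" and W: "vsp W" and u: "u \<in> lin V W" and surj: "u ` carrier V = carrier W"
    and N: "\<And>v. v \<in> carrier V \<Longrightarrow> vnorm W (u v) = vnorm V v"
  shows "os_complete W"
proof (rule os_completeI)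
  interpret V: ruan V by (rule V(1))
  interpret W: vsp W by fact
  interpret vsp_hom V W u by unfold_locales fact
  let ?s = "inv_into (carrier V) u"
  have s: "?s w \<in> carrier V" "u (?s w) = w" if "w \<in> carrier W" for w
    using that surj by (auto simp: inv_into_into f_inv_into_f)
  have d: "vdist W (u v) (u v') = vdist V v v'" if "v \<in> carrier V" "v' \<in> carrier V" for v v'
    using that N[of "v \<ominus>\<^bsub>V\<^esub> v'"] u_minus[OF that] by (simp add: vdist_def)
  fix f :: "nat \<Rightarrow> 'b" assume f: "\<And>p. f p \<in> carrier W"
    and C: "\<And>e. e > 0 \<Longrightarrow> \<exists>N. \<forall>p\<ge>N. \<forall>q\<ge>N. vdist W (f p) (f q) < e"
  have ds: "vdist V (?s (f p)) v = vdist W (f p) (u v)" if "v \<in> carrier V" for p v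
    using d[of "?s (f p)" v] s f that by simp
  have "vdist V (?s (f p)) (?s (f q)) = vdist W (f p) (f q)" for p q
    using ds s f by simp
  then obtain l where l: "l \<in> carrier V" "\<And>e. e > 0 \<Longrightarrow> \<exists>N. \<forall>p\<ge>N. vdist V (?s (f p)) l < e"
    using os_completeD[OF V(2), of "\<lambda>p. ?s (f p)"] s f C by auto
  then show "\<exists>l\<in>carrier W. \<forall>e>0. \<exists>N. \<forall>p\<ge>N. vdist W (f p) l < e"
    using ds u_in by (intro bexI[of _ "u l"]) auto
qed

text \<open>
  Both the quotient by the kernel of a seminorm and the transport along a bijection: \<open>u\<close> is meant
  to identify precisely the points at distance 0.
\<close>

definition image_os :: "'a opspace \<Rightarrow> ('a \<Rightarrow> 'b) \<Rightarrow> 'b opspace" where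
  "image_os V u = (let s = inv_into (carrier V) u in
     \<lparr>carrier = u ` carrier V, mult = undefined, one = undefined, zero = u \<zero>\<^bsub>V\<^esub>,
      add = (\<lambda>a b. u (s a \<oplus>\<^bsub>V\<^esub> s b)), smult = (\<lambda>c a. u (c \<odot>\<^bsub>V\<^esub> s a)),
      mnorm = (\<lambda>x. mnorm V (map_mat s x))\<rparr>)"

text \<open>Operations applied to representatives at distance 0 give results at distance 0, by
  \<open>vdist_add\<close> and \<open>vdist_smult\<close>, so they do not depend on the choice made
  by \<open>inv_into\<close>.\<close>

lemma image_os:
  fixes V :: "'a opspace" (structure)
  assumes V: "ruan V" and u: "\<And>x y. x \<in> carrier V \<Longrightarrow> y \<in> carrier V \<Longrightarrow> u x = u y \<longleftrightarrow> vdist V x y = 0"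
  defines "W \<equiv> image_os V u"
  shows "u \<in> lin V W" "u ` carrier V = carrier W"
    "\<And>n x. n \<ge> 1 \<Longrightarrow> x \<in> mats n V \<Longrightarrow> mnorm W (map_mat u x) = mnorm V x"
    "ruan W" "os_definite W" "os_complete V \<Longrightarrow> os_complete W"
proof -
  interpret V: ruan V by (rule V)
  let ?s = "inv_into (carrier V) u"
  have W: "carrier W = u ` carrier V" "\<zero>\<^bsub>W\<^esub> = u \<zero>" "add W = (\<lambda>a b. u (?s a \<oplus> ?s b))" 
    "smult W = (\<lambda>c a. u (c \<odot> ?s a))" "mnorm W = (\<lambda>x. mnorm V (map_mat ?s x))"
    by (simp_all add: W_def image_os_def Let_def)
  have s: "?s (u x) \<in> carrier V" "u (?s (u x)) = u x" "vdist V (?s (u x)) x = 0" if "x \<in> carrier V" for x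
    using that by (auto simp: inv_into_into f_inv_into_f u[symmetric])
  have add: "u x \<oplus>\<^bsub>W\<^esub> u y = u (x \<oplus> y)" if "x \<in> carrier V" "y \<in> carrier V" for x y
    using that s[of x] s[of y] V.vdist_add[of "?s (u x)" "?s (u y)" x y] 
      V.vdist_nonneg[of "?s (u x) \<oplus> ?s (u y)" "x \<oplus> y"] by (simp add: W u)
  have smult: "a \<odot>\<^bsub>W\<^esub> u x = u (a \<odot> x)" if "x \<in> carrier V" for a x
    using that s[of x] V.vdist_smult[of "?s (u x)" x a] by (simp add: W u)
  show lin: "u \<in> lin V W" using add smult by (auto simp: lin_iff W(1))
  show surj: "u ` carrier V = carrier W" by (simp add: W)
  have vW: "vsp W"
    by (rule vspI) (auto simp: W(1,2) add smult V.a_ac V.smult_add_left V.smult_add_right V.smult_smult)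
  show N: "mnorm W (map_mat u x) = mnorm V x" if n: "n \<ge> 1" and x: "x \<in> mats n V" for n x
  proof -
    have x': "map_mat (\<lambda>v. ?s (u v)) x \<in> mats n V"
      using s by (intro mats_map[OF x]) auto
    \<comment> \<open>The chosen representatives are at distance 0 from the original entries, so
      \<open>norm_le_add_eps\<close> with error 0 applies in both directions.\<close>
    have "vdist V (map_mat (\<lambda>v. ?s (u v)) x $$ (i, j)) (x $$ (i, j)) \<le> 0"
      "vdist V (x $$ (i, j)) (map_mat (\<lambda>v. ?s (u v)) x $$ (i, j)) \<le> 0" if "i < n" "j < n" for i j
      using that matsD[OF x] s by (auto simp: V.vdist_commute)
    then show ?thesis
      using V.norm_le_add_eps[OF x x' n, of 0] V.norm_le_add_eps[OF x' x n, of 0]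
      by (simp add: W map_mat_comp')
  qed
  show R: "ruan W" by (rule ruan_surj[OF V vW lin surj N])
  have N1: "vnorm W (u v) = vnorm V v" if "v \<in> carrier V" for v
    using N[OF _ V.mat1_in[OF that]] map_mat1[of u v] by (simp add: vnorm_def)
  show "os_definite W"
    unfolding os_definite_def W(1) using N1 u[of _ \<zero>] V.vdist_zero by (auto simp: W(2))
  show "os_complete W" if "os_complete V"
    by (rule complete_surj[OF V that vW lin surj N1])
qed

text \<open>Carrier and norm are parameters: \<open>linf\<close> takes the bounded families with the
  supremum of the norms, \<open>M\<close> below takes the eventually coherent families with the
  eventual norm. Restriction to \<open>K\<close> keeps the results extensional.\<close>

definition prod_os :: "'k set \<Rightarrow> ('k \<Rightarrow> 'b opspace) \<Rightarrow> ('k \<Rightarrow> 'b) set \<Rightarrow> (('k \<Rightarrow> 'b) mat \<Rightarrow> real) \<Rightarrow>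
    ('k \<Rightarrow> 'b) opspace" where
  "prod_os K V C N =
     \<lparr>carrier = C, mult = undefined, one = undefined, zero = (\<lambda>k\<in>K. \<zero>\<^bsub>V k\<^esub>),
      add = (\<lambda>f g. \<lambda>k\<in>K. f k \<oplus>\<^bsub>V k\<^esub> g k), smult = (\<lambda>c f. \<lambda>k\<in>K. c \<odot>\<^bsub>V k\<^esub> f k), mnorm = N\<rparr>"

lemma vsp_abelian_group: "vsp V \<Longrightarrow> abelian_group V"
  by (simp add: vsp_def Module.module_def)

lemma vsp_prod_os:
  assumes V: "\<And>k. k \<in> K \<Longrightarrow> vsp (V k)" and C: "C \<subseteq> (\<Pi>\<^sub>E k\<in>K. carrier (V k))"
    and cl: "(\<lambda>k\<in>K. \<zero>\<^bsub>V k\<^esub>) \<in> C" "\<And>f g. f \<in> C \<Longrightarrow> g \<in> C \<Longrightarrow> (\<lambda>k\<in>K. f k \<oplus>\<^bsub>V k\<^esub> g k) \<in> C"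
      "\<And>c f. f \<in> C \<Longrightarrow> (\<lambda>k\<in>K. c \<odot>\<^bsub>V k\<^esub> f k) \<in> C"
  shows "vsp (prod_os K V C N)"
proof -
  have D: "f k \<in> carrier (V k)" if "f \<in> C" "k \<in> K" for f k
    using C that by auto
  have eqI: "restrict h K = f" if "f \<in> C" "\<And>k. k \<in> K \<Longrightarrow> h k = f k" for f h
    using that C by (intro extensionalityI[of _ K]) (auto simp: PiE_def)
  have ag: "abelian_group (V k)" if "k \<in> K" for k
    using V[OF that] by (rule vsp_abelian_group)
  have am: "abelian_monoid (V k)" if "k \<in> K" for k
    using ag[OF that] by (rule abelian_group.axioms)
  show ?thesis
    by (rule vspI)
       (auto simp: prod_os_def cl D V vsp.smult_add_left vsp.smult_add_right vsp.smult_smult vsp.smult_1 vsp.smult_0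
          abelian_groupE(1,2,5)[OF ag] abelian_monoid.r_zero[OF am]
          abelian_monoid.a_ac[OF am]
          intro!: eqI restrict_ext)
qed

lemma prod_os_proj: "C \<subseteq> (\<Pi>\<^sub>E k\<in>K. carrier (V k)) \<Longrightarrow> k \<in> K \<Longrightarrow> (\<lambda>f. f k) \<in> lin (prod_os K V C N) (V k)"
  by (auto simp: lin_iff prod_os_def)

text \<open>Boundedness is required in the first norms only; \<open>linf_bdd\<close> derives it for
  matrices of every size. No size restriction is put on \<open>K\<close>, which is later the set of
  all cocones under a diagram.\<close>

definition linf :: "'k set \<Rightarrow> ('k \<Rightarrow> 'b opspace) \<Rightarrow> ('k \<Rightarrow> 'b) opspace" where
  "linf K V = prod_os K V {f \<in> \<Pi>\<^sub>E k\<in>K. carrier (V k). bdd_above ((\<lambda>k. vnorm (V k) (f k)) ` K)}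
     (\<lambda>X. Sup0 K (\<lambda>k. mnorm (V k) (map_mat (\<lambda>f. f k) X)))"

lemma carrier_linf:
  "carrier (linf K V) = {f \<in> \<Pi>\<^sub>E k\<in>K. carrier (V k). bdd_above ((\<lambda>k. vnorm (V k) (f k)) ` K)}"
  by (simp add: linf_def prod_os_def)

lemma linf_norm: "mnorm (linf K V) X = Sup0 K (\<lambda>k. mnorm (V k) (map_mat (\<lambda>f. f k) X))"
  by (simp add: linf_def prod_os_def)

context
  fixes K :: "'k set" and V :: "'k \<Rightarrow> 'b opspace"
  assumes V: "\<And>k. k \<in> K \<Longrightarrow> os (V k)"
begin

lemma linf_ruan: "k \<in> K \<Longrightarrow> ruan (V k)"
  using V by (simp add: os_def)

lemma linf_vsp: "k \<in> K \<Longrightarrow> vsp (V k)"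
  using linf_ruan by (simp add: ruan_def)

lemma linf_proj: "k \<in> K \<Longrightarrow> (\<lambda>f. f k) \<in> lin (linf K V) (V k)"
  unfolding linf_def by (rule prod_os_proj) auto

lemma vsp_linf: "vsp (linf K V)"
  unfolding linf_def
proof (rule vsp_prod_os[OF linf_vsp])
  let ?C = "{f \<in> \<Pi>\<^sub>E k\<in>K. carrier (V k). bdd_above ((\<lambda>k. vnorm (V k) (f k)) ` K)}"
  show "?C \<subseteq> (\<Pi>\<^sub>E k\<in>K. carrier (V k))" by blast
  fix f g assume "f \<in> ?C" "g \<in> ?C"
  then have f: "f \<in> (\<Pi>\<^sub>E k\<in>K. carrier (V k))" "bdd_above ((\<lambda>k. vnorm (V k) (f k)) ` K)"
    and g: "g \<in> (\<Pi>\<^sub>E k\<in>K. carrier (V k))" "bdd_above ((\<lambda>k. vnorm (V k) (g k)) ` K)"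
    by auto
  obtain b c where bc: "\<And>k. k \<in> K \<Longrightarrow> vnorm (V k) (f k) \<le> b" "\<And>k. k \<in> K \<Longrightarrow> vnorm (V k) (g k) \<le> c"
    using f(2) g(2) by (auto simp: bdd_above_def)
  have "vnorm (V k) (f k \<oplus>\<^bsub>V k\<^esub> g k) \<le> b + c" if "k \<in> K" for k
    using ruan.vnorm_add[OF linf_ruan[OF that] PiE_mem[OF f(1) that] PiE_mem[OF g(1) that]]
      bc[OF that] by linarith
  then have "bdd_above ((\<lambda>k. vnorm (V k) ((\<lambda>k\<in>K. f k \<oplus>\<^bsub>V k\<^esub> g k) k)) ` K)"
    by (intro bdd_aboveI2[of _ _ "b + c"]) simp
  moreover have "(\<lambda>k\<in>K. f k \<oplus>\<^bsub>V k\<^esub> g k) \<in> (\<Pi>\<^sub>E k\<in>K. carrier (V k))"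
    using f g by (auto simp: PiE_iff abelian_groupE(1)[OF vsp_abelian_group[OF linf_vsp]])
  ultimately show "(\<lambda>k\<in>K. f k \<oplus>\<^bsub>V k\<^esub> g k) \<in> ?C" by blast
next
  let ?C = "{f \<in> \<Pi>\<^sub>E k\<in>K. carrier (V k). bdd_above ((\<lambda>k. vnorm (V k) (f k)) ` K)}"
  fix f c assume "f \<in> ?C"
  then have f: "f \<in> (\<Pi>\<^sub>E k\<in>K. carrier (V k))" "bdd_above ((\<lambda>k. vnorm (V k) (f k)) ` K)"
    by auto
  obtain b where b: "\<And>k. k \<in> K \<Longrightarrow> vnorm (V k) (f k) \<le> b"
    using f(2) by (auto simp: bdd_above_def)
  have "vnorm (V k) (c \<odot>\<^bsub>V k\<^esub> f k) \<le> cmod c * b" if "k \<in> K" for k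
    using ruan.vnorm_smult[OF linf_ruan[OF that] PiE_mem[OF f(1) that]] b[OF that]
    by (simp add: mult_left_mono)
  then have "bdd_above ((\<lambda>k. vnorm (V k) ((\<lambda>k\<in>K. c \<odot>\<^bsub>V k\<^esub> f k) k)) ` K)"
    by (intro bdd_aboveI2[of _ _ "cmod c * b"]) simp
  moreover have "(\<lambda>k\<in>K. c \<odot>\<^bsub>V k\<^esub> f k) \<in> (\<Pi>\<^sub>E k\<in>K. carrier (V k))"
    using f by (auto simp: PiE_iff linf_vsp vsp.smult_in)
  ultimately show "(\<lambda>k\<in>K. c \<odot>\<^bsub>V k\<^esub> f k) \<in> ?C" by blast
next
  let ?C = "{f \<in> \<Pi>\<^sub>E k\<in>K. carrier (V k). bdd_above ((\<lambda>k. vnorm (V k) (f k)) ` K)}"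
  have "(\<lambda>k\<in>K. \<zero>\<^bsub>V k\<^esub>) \<in> (\<Pi>\<^sub>E k\<in>K. carrier (V k))"
    by (auto simp: abelian_groupE(2)[OF vsp_abelian_group[OF linf_vsp]])
  moreover have "bdd_above ((\<lambda>k. vnorm (V k) ((\<lambda>k\<in>K. \<zero>\<^bsub>V k\<^esub>) k)) ` K)"
    by (intro bdd_aboveI2[of _ _ 0]) (simp add: linf_ruan ruan.vnorm_zero)
  ultimately show "(\<lambda>k\<in>K. \<zero>\<^bsub>V k\<^esub>) \<in> ?C" by blast
qed

lemma linf_bdd:
  assumes "n \<ge> 1" and X: "X \<in> mats n (linf K V)"
  shows "bdd_above ((\<lambda>k. mnorm (V k) (map_mat (\<lambda>f. f k) X)) ` K)"
proof -
  have "\<exists>b. \<forall>k\<in>K. vnorm (V k) ((X $$ (i, j)) k) \<le> b" if "i < n" "j < n" for i j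
    using matsD(3)[OF X that] by (auto simp: carrier_linf bdd_above_def)
  then obtain b where b: "\<And>i j k. i < n \<Longrightarrow> j < n \<Longrightarrow> k \<in> K \<Longrightarrow> vnorm (V k) ((X $$ (i, j)) k) \<le> b i j"
    by metis
  have "mnorm (V k) (map_mat (\<lambda>f. f k) X) \<le> (\<Sum>(i, j)\<in>{..<n} \<times> {..<n}. b i j)" if k: "k \<in> K" for k
  proof -
    have "map_mat (\<lambda>f. f k) X \<in> mats n (V k)"
      using linD(1)[OF linf_proj[OF k]] by (intro mats_map[OF X])
    then have "mnorm (V k) (map_mat (\<lambda>f. f k) X) \<le>
        (\<Sum>(i, j)\<in>{..<n} \<times> {..<n}. vnorm (V k) (map_mat (\<lambda>f. f k) X $$ (i, j)))"
      using ruan.norm_le_sum_entries[OF linf_ruan[OF k]] assms(1) by blast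
    also have "\<dots> \<le> (\<Sum>(i, j)\<in>{..<n} \<times> {..<n}. b i j)"
      using b k matsD[OF X] by (intro sum_mono) auto
    finally show ?thesis .
  qed
  then show ?thesis by (rule bdd_aboveI2)
qed

lemma ruan_linf: "ruan (linf K V)"
  by (rule ruan_Sup0[OF vsp_linf _ linf_proj linf_bdd linf_norm])
     (simp_all add: linf_ruan)

lemma linf_norm_upper:
  "n \<ge> 1 \<Longrightarrow> X \<in> mats n (linf K V) \<Longrightarrow> k \<in> K \<Longrightarrow> mnorm (V k) (map_mat (\<lambda>f. f k) X) \<le> mnorm (linf K V) X"
  unfolding linf_norm by (rule Sup0_upper[OF linf_bdd])

lemma linf_vnorm: "vnorm (linf K V) f = Sup0 K (\<lambda>k. vnorm (V k) (f k))"
  unfolding vnorm_def linf_norm map_mat1 ..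

lemma linf_vdist:
  assumes f: "f \<in> carrier (linf K V)" and g: "g \<in> carrier (linf K V)"
  shows "vdist (linf K V) f g = Sup0 K (\<lambda>k. vdist (V k) (f k) (g k))"
    "bdd_above ((\<lambda>k. vdist (V k) (f k) (g k)) ` K)"
proof -
  interpret L: ruan "linf K V" by (rule ruan_linf)
  have d: "f \<ominus>\<^bsub>linf K V\<^esub> g \<in> carrier (linf K V)" using f g by simp
  have eq: "(f \<ominus>\<^bsub>linf K V\<^esub> g) k = f k \<ominus>\<^bsub>V k\<^esub> g k" if "k \<in> K" for k
    using vsp_hom.u_minus[OF _ f g, of "V k" "\<lambda>f. f k"] linf_proj that linf_vsp vsp_linf
    by (simp add: vsp_hom_def vsp_hom_axioms_def)
  then show "vdist (linf K V) f g = Sup0 K (\<lambda>k. vdist (V k) (f k) (g k))"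
    unfolding vdist_def linf_vnorm Sup0_def by simp
  show "bdd_above ((\<lambda>k. vdist (V k) (f k) (g k)) ` K)"
    using d eq by (simp add: carrier_linf vdist_def)
qed

lemma os_linf: "os (linf K V)"
proof -
  interpret L: ruan "linf K V" by (rule ruan_linf)
  note vd = linf_vdist
  have inV: "f k \<in> carrier (V k)" if "f \<in> carrier (linf K V)" "k \<in> K" for f k
    using that by (auto simp: carrier_linf)
  have "os_definite (linf K V)"
    unfolding os_definite_def
  proof (intro ballI impI)
    fix f assume f: "f \<in> carrier (linf K V)" and z: "vnorm (linf K V) f = 0"
    have "f k = \<zero>\<^bsub>V k\<^esub>" if k: "k \<in> K" for k
    proof -
      interpret os "V k" using V[OF k] .
      have "vnorm (V k) (f k) \<le> 0"
        using z Sup0_upper[of "\<lambda>k. vnorm (V k) (f k)" K k] f k by (simp add: linf_vnorm carrier_linf)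
      then show ?thesis
        using vnorm_nonneg[of "f k"] inV[OF f k] definite by (auto simp: os_definite_def)
    qed
    then show "f = \<zero>\<^bsub>linf K V\<^esub>"
      using f by (intro extensionalityI[of _ K]) (auto simp: carrier_linf PiE_def linf_def prod_os_def)
  qed
  moreover have "os_complete (linf K V)"
  proof (rule os_completeI)
    fix s :: "nat \<Rightarrow> _" assume s: "\<And>p. s p \<in> carrier (linf K V)"
      and C: "\<And>e. e > 0 \<Longrightarrow> \<exists>N. \<forall>p\<ge>N. \<forall>q\<ge>N. vdist (linf K V) (s p) (s q) < e"
    have le: "vdist (V k) (s p k) (s q k) \<le> vdist (linf K V) (s p) (s q)" if "k \<in> K" for k p q
      using Sup0_upper[OF vd(2)[OF s s] that] vd(1)[OF s s] by simp
    have "\<exists>l\<in>carrier (V k). \<forall>e>0. \<exists>N. \<forall>p\<ge>N. vdist (V k) (s p k) l < e" if k: "k \<in> K" for k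
    proof -
      have cau: "\<exists>N. \<forall>p\<ge>N. \<forall>q\<ge>N. vdist (V k) (s p k) (s q k) < e" if "e > 0" for e
        using C[OF that] le[OF k] by (meson le_less_trans)
      show ?thesis
        by (rule os_completeD[OF os.complete[OF V[OF k]]]) (use inV[OF s k] cau in auto)
    qed
    then obtain l where l: "\<And>k. k \<in> K \<Longrightarrow> l k \<in> carrier (V k)"
      and lim: "\<And>k e. k \<in> K \<Longrightarrow> e > 0 \<Longrightarrow> \<exists>N. \<forall>p\<ge>N. vdist (V k) (s p k) (l k) < e"
      by metis
    \<comment> \<open>The Cauchy estimate is uniform in the coordinate \<open>k\<close>. A late
      index, chosen separately for each \<open>k\<close>, transfers it to the pointwise
      limit.\<close>
    have unif: "vdist (V k) (s p k) (l k) \<le> e"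
      if k: "k \<in> K" and N: "\<And>q. q \<ge> N \<Longrightarrow> vdist (linf K V) (s p) (s q) < e" for k p N e
    proof (rule field_le_epsilon)
      interpret os "V k" using V[OF k] .
      fix d :: real assume "d > 0"
      then obtain M where M: "\<And>q. q \<ge> M \<Longrightarrow> vdist (V k) (s q k) (l k) < d" using lim[OF k] by blast
      have "vdist (V k) (s p k) (l k) \<le> vdist (V k) (s p k) (s (max M N) k) + vdist (V k) (s (max M N) k) (l k)"
        using inV[OF s k] l[OF k] by (intro vdist_triangle)
      also have "\<dots> \<le> e + d"
        using M[of "max M N"] N[of "max M N"] le[OF k, of p "max M N"] by simp
      finally show "vdist (V k) (s p k) (l k) \<le> e + d" .
    qed
    define L where "L = restrict l K"
    obtain N where N: "\<And>p q. p \<ge> N \<Longrightarrow> q \<ge> N \<Longrightarrow> vdist (linf K V) (s p) (s q) < 1"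
      using C[of 1] by auto
    obtain b where b: "\<And>k. k \<in> K \<Longrightarrow> vnorm (V k) (s N k) \<le> b"
      using s[of N] by (auto simp: carrier_linf bdd_above_def)
    \<comment> \<open>The pointwise limit is within 1 of \<open>s N\<close>, so it is again a
      bounded family.\<close>
    have "vnorm (V k) (L k) \<le> b + 1" if k: "k \<in> K" for k
    proof -
      interpret os "V k" using V[OF k] .
      have "vdist (V k) (l k) \<zero>\<^bsub>V k\<^esub> \<le> vdist (V k) (l k) (s N k) + vdist (V k) (s N k) \<zero>\<^bsub>V k\<^esub>"
        using l[OF k] inV[OF s k] by (intro vdist_triangle) auto
      also have "\<dots> \<le> 1 + b"
        using unif[OF k N, of N N] b[OF k] vdist_zero[OF inV[OF s k]] vdist_commute[OF l[OF k] inV[OF s k]]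
        by simp
      finally show ?thesis using k vdist_zero[OF l[OF k]] by (simp add: L_def)
    qed
    then have L: "L \<in> carrier (linf K V)"
      using l by (auto simp: carrier_linf L_def intro!: bdd_aboveI2[of _ _ "b + 1"])
    have "\<exists>N. \<forall>p\<ge>N. vdist (linf K V) (s p) L < e" if e: "e > 0" for e
    proof -
      obtain N where N: "\<And>p q. p \<ge> N \<Longrightarrow> q \<ge> N \<Longrightarrow> vdist (linf K V) (s p) (s q) < e / 2"
        using C[of "e / 2"] e by auto
      have "vdist (linf K V) (s p) L \<le> e / 2" if p: "p \<ge> N" for p
        unfolding vd(1)[OF s L] using unif[OF _ N[OF p]] e
        by (intro Sup0_least) (auto simp: L_def)
      then show ?thesis using e by (intro exI[of _ N]) fastforce
    qed
    then show "\<exists>l\<in>carrier (linf K V). \<forall>e>0. \<exists>N. \<forall>p\<ge>N. vdist (linf K V) (s p) l < e"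
      using L by blast
  qed
  ultimately show ?thesis by unfold_locales
qed

end

section \<open>Closed subspaces\<close>

abbreviation sub_os :: "'a opspace \<Rightarrow> 'a set \<Rightarrow> 'a opspace" where
  "sub_os V C \<equiv> V\<lparr>carrier := C\<rparr>"

lemma os_sub_os:
  fixes V :: "'a opspace" (structure)
  assumes V: "os V" and C: "C \<subseteq> carrier V"
    and cl: "\<zero> \<in> C" "\<And>x y. x \<in> C \<Longrightarrow> y \<in> C \<Longrightarrow> x \<oplus> y \<in> C" "\<And>a x. x \<in> C \<Longrightarrow> a \<odot> x \<in> C"
    and closed: "\<And>x. x \<in> carrier V \<Longrightarrow> (\<And>e. e > 0 \<Longrightarrow> \<exists>t\<in>C. vdist V x t < e) \<Longrightarrow> x \<in> C"
  shows "os (sub_os V C)" "(\<lambda>x. x) \<in> lin (sub_os V C) V"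
    "\<And>x y. x \<in> C \<Longrightarrow> y \<in> C \<Longrightarrow> vdist (sub_os V C) x y = vdist V x y"
proof -
  interpret V: os V by fact
  let ?W = "sub_os V C"
  have D: "x \<in> carrier V" if "x \<in> C" for x using C that by auto
  have W: "vsp ?W"
    by (rule vspI) (auto simp: cl D V.a_ac V.smult_add_left V.smult_add_right V.smult_smult)
  show lin: "(\<lambda>x. x) \<in> lin ?W V" by (auto simp: lin_iff D)
  have H: "vsp_hom ?W V (\<lambda>x. x)"
    using W lin by (simp add: vsp_hom_def vsp_hom_axioms_def V.vsp_axioms)
  have mats: "x \<in> mats n V" if "x \<in> mats n ?W" for x n
    using that D by (auto simp: in_mats)
  have R: "ruan ?W"
  \<comment> \<open>The supremum over a one-element index set is the norm of \<open>V\<close>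
    itself, because that norm is non-negative.\<close>
  proof (rule ruan_Sup0[where K = "{()}" and V = "\<lambda>_. V" and u = "\<lambda>_ x. x"])
    fix n x assume "n \<ge> 1" "x \<in> mats n ?W"
    then show "mnorm ?W x = Sup0 {()} (\<lambda>k. mnorm V (map_mat (\<lambda>x. x) x))"
      using V.norm_nonneg[of n x] map_mat_id'[of x n V "\<lambda>x. x"] mats by (simp add: Sup0_def cSup_eq_Max)
  qed (use W lin V.ruan_axioms in auto)
  have vn: "vnorm ?W = vnorm V" by (intro ext) (simp add: vnorm_def)
  show d: "vdist ?W x y = vdist V x y" if "x \<in> C" "y \<in> C" for x y
    using vsp_hom.u_minus[OF H, of x y] that by (simp add: vdist_def vn)
  have "os_definite ?W" using V.definite D by (auto simp: os_definite_def vn)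
  moreover have "os_complete ?W"
  proof (rule os_completeI)
    fix s :: "nat \<Rightarrow> _" assume s: "\<And>p. s p \<in> carrier ?W"
      and "\<And>e. e > 0 \<Longrightarrow> \<exists>N. \<forall>p\<ge>N. \<forall>q\<ge>N. vdist ?W (s p) (s q) < e"
    then obtain l where l: "l \<in> carrier V" and lim: "\<And>e. e > 0 \<Longrightarrow> \<exists>N. \<forall>p\<ge>N. vdist V (s p) l < e"
      using os_completeD[OF V.complete, of s] d D by auto
    have "\<exists>t\<in>C. vdist V l t < e" if "e > 0" for e
      using lim[OF that] s V.vdist_commute[OF l] D by fastforce
    then have "l \<in> C" by (rule closed[OF l])
    then show "\<exists>l\<in>carrier ?W. \<forall>e>0. \<exists>N. \<forall>p\<ge>N. vdist ?W (s p) l < e"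
      using lim d s by (intro bexI[of _ l]) auto
  qed
  ultimately show "os ?W"
    using R by (simp add: os_def os_axioms_def)
qed

section \<open>Closed linear spans and extension of maps\<close>

text \<open>Lists of coefficient-index pairs are formal linear combinations. Keeping them apart from
  their values lets one list be evaluated in two spaces along two families, which is how norms and
  maps are compared.\<close>

primrec lc :: "'a opspace \<Rightarrow> ('k \<Rightarrow> 'a) \<Rightarrow> (complex \<times> 'k) list \<Rightarrow> 'a" where
  "lc V d [] = \<zero>\<^bsub>V\<^esub>"
| "lc V d (ck # p) = (fst ck \<odot>\<^bsub>V\<^esub> d (snd ck)) \<oplus>\<^bsub>V\<^esub> lc V d p"

text \<open>The field of Gaussian rationals, countable and dense in the complex numbers.\<close>

definition qc :: "complex set" where
  "qc = range (\<lambda>(a, b). Complex (of_rat a) (of_rat b))"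

definition qlists :: "'k set \<Rightarrow> (complex \<times> 'k) list set" where
  "qlists K = lists (qc \<times> K)"

lemma countable_qc: "countable qc"
  by (simp add: qc_def)

lemma countable_qlists: "countable K \<Longrightarrow> countable (qlists K)"
  by (simp add: qlists_def countable_qc)

lemma qc_1: "1 \<in> qc"
  unfolding qc_def by (rule range_eqI[of _ _ "(1, 0)"]) (simp add: complex_eq_iff)

lemma qc_uminus: "c \<in> qc \<Longrightarrow> - c \<in> qc"
proof -
  assume "c \<in> qc"
  then obtain a b where "c = Complex (of_rat a) (of_rat b)" by (auto simp: qc_def)
  then show ?thesis
    unfolding qc_def by (intro range_eqI[of _ _ "(- a, - b)"]) (simp add: of_rat_minus complex_eq_iff)
qed

lemma qc_dense:
  assumes "e > 0"
  obtains q where "q \<in> qc" "cmod (z - q) < e"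
proof -
  obtain a where a: "Re z - e / 2 < of_rat a" "of_rat a < Re z"
    using of_rat_dense[of "Re z - e / 2" "Re z"] assms by auto
  obtain b where b: "Im z - e / 2 < of_rat b" "of_rat b < Im z"
    using of_rat_dense[of "Im z - e / 2" "Im z"] assms by auto
  have "cmod (z - Complex (of_rat a) (of_rat b)) < e"
    using cmod_le[of "z - Complex (of_rat a) (of_rat b)"] a b by simp
  then show thesis using that by (auto simp: qc_def)
qed

lemma qlists_append: "p \<in> qlists K \<Longrightarrow> q \<in> qlists K \<Longrightarrow> p @ q \<in> qlists K"
  by (auto simp: qlists_def)

lemma qlists_subset: "qlists K \<subseteq> lists (UNIV \<times> K)"
  by (auto simp: qlists_def in_lists_conv_set)

lemma qlists_mono: "K \<subseteq> K' \<Longrightarrow> qlists K \<subseteq> qlists K'"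
  by (auto simp: qlists_def in_lists_conv_set)

context vsp
begin

lemma lc_in: "d ` K \<subseteq> carrier V \<Longrightarrow> p \<in> lists (UNIV \<times> K) \<Longrightarrow> lc V d p \<in> carrier V"
  by (induction p) auto

lemma lc_append:
  "d ` K \<subseteq> carrier V \<Longrightarrow> p \<in> lists (UNIV \<times> K) \<Longrightarrow> q \<in> lists (UNIV \<times> K) \<Longrightarrow>
   lc V d (p @ q) = lc V d p \<oplus> lc V d q"
proof (induction p)
  case (Cons ck p)
  then have "d (snd ck) \<in> carrier V" "lc V d p \<in> carrier V" "lc V d q \<in> carrier V"
    by (auto intro: lc_in)
  then show ?case using Cons by (simp add: a_assoc)
qed (simp add: lc_in)

lemma lc_scale:
  "d ` K \<subseteq> carrier V \<Longrightarrow> p \<in> lists (UNIV \<times> K) \<Longrightarrow>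
   lc V d (map (\<lambda>(c, k). (a * c, k)) p) = a \<odot> lc V d p"
proof (induction p)
  case (Cons ck p)
  then have "d (snd ck) \<in> carrier V" "lc V d p \<in> carrier V"
    by (auto intro: lc_in)
  then show ?case using Cons by (simp add: smult_add_right smult_smult split_beta)
qed simp

end

lemma lc_cong: "(\<And>k. k \<in> K \<Longrightarrow> d k = d' k) \<Longrightarrow> p \<in> lists (UNIV \<times> K) \<Longrightarrow> lc V d p = lc V d' p"
  by (induction p) auto

lemma lc_reindex: "lc V d (map (\<lambda>(c, k). (c, h k)) p) = lc V (\<lambda>k. d (h k)) p"
  by (induction p) (auto simp: split_beta)

lemma (in vsp_hom) lc_hom:
  "d ` K \<subseteq> carrier V \<Longrightarrow> p \<in> lists (UNIV \<times> K) \<Longrightarrow> u (lc V d p) = lc W (\<lambda>k. u (d k)) p"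
proof (induction p)
  case (Cons ck p)
  then have "d (snd ck) \<in> carrier V" "lc V d p \<in> carrier V"
    by (auto intro: V.lc_in)
  then show ?case using Cons by (simp add: u_add u_smult)
qed (simp add: u_zero)

text \<open>One rational list has to serve both spaces at once, as the closure of a graph requires
  in \<open>hom_extension\<close>. Taking the two spaces equal gives plain density.\<close>

lemma lc_approx2:
  fixes A :: "'a opspace" and B :: "'b opspace" and a :: "'k \<Rightarrow> 'a"
  assumes A: "ruan A" and B: "ruan B" and a: "a ` K \<subseteq> carrier A" and b: "b ` K \<subseteq> carrier B"
    and "p \<in> lists (UNIV \<times> K)" "e > 0"
  shows "\<exists>q\<in>qlists K. vdist A (lc A a p) (lc A a q) < e \<and> vdist B (lc B b p) (lc B b q) < e"
  using assms(5,6)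
proof (induction p arbitrary: e)
  case Nil
  interpret A: ruan A by (rule A)
  interpret B: ruan B by (rule B)
  show ?case using Nil by (intro bexI[of _ "[]"]) (auto simp: qlists_def)
next
  case (Cons ck p)
  interpret A: ruan A by (rule A)
  interpret B: ruan B by (rule B)
  obtain c k where ck: "ck = (c, k)" by force
  have k: "k \<in> K" "p \<in> lists (UNIV \<times> K)"
    using Cons.hyps ck by auto
  have ak: "a k \<in> carrier A" and bk: "b k \<in> carrier B" using a b k by auto
  have "e / 2 > 0" using Cons.prems by simp
  then obtain q where q: "q \<in> qlists K" "vdist A (lc A a p) (lc A a q) < e / 2"
      "vdist B (lc B b p) (lc B b q) < e / 2"
    using Cons.IH k(2) by blast
  \<comment> \<open>A common bound for the generator in both spaces, increased by 1 to be positive.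
    An error below \<open>e / (2 * M)\<close> in the coefficient then costs less than
    \<open>e / 2\<close> in each space.\<close>
  define M where "M = vnorm A (a k) + vnorm B (b k) + 1"
  have M: "M > 0" "vnorm A (a k) \<le> M" "vnorm B (b k) \<le> M"
    using A.vnorm_nonneg[OF ak] B.vnorm_nonneg[OF bk] by (auto simp: M_def)
  obtain z where z: "z \<in> qc" "cmod (c - z) < e / (2 * M)"
    using qc_dense[of "e / (2 * M)" c] M(1) Cons.prems by auto
  have zM: "cmod (c - z) * M < e / 2"
    using z(2) M(1) by (simp add: field_simps)
  have q': "q \<in> lists (UNIV \<times> K)" using q(1) qlists_subset by blast
  have step: "vdist Z (lc Z d (ck # p)) (lc Z d ((z, k) # q)) < e"
    if Z: "ruan Z" and d: "d ` K \<subseteq> carrier Z" and dk: "vnorm Z (d k) \<le> M"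
      and pq: "vdist Z (lc Z d p) (lc Z d q) < e / 2" for Z :: "'c opspace" and d
  proof -
    interpret Z: ruan Z by (rule Z)
    have zk: "d k \<in> carrier Z" using d k(1) by auto
    have "vdist Z (lc Z d (ck # p)) (lc Z d ((z, k) # q)) \<le>
        vdist Z (c \<odot>\<^bsub>Z\<^esub> d k) (z \<odot>\<^bsub>Z\<^esub> d k) + vdist Z (lc Z d p) (lc Z d q)"
      using zk Z.lc_in[OF d] k(2) q' by (simp add: ck Z.vdist_add)
    moreover have "vdist Z (c \<odot>\<^bsub>Z\<^esub> d k) (z \<odot>\<^bsub>Z\<^esub> d k) \<le> cmod (c - z) * M"
      using Z.vdist_smult_left[OF zk] dk by (simp add: mult_left_mono)
    ultimately show ?thesis using pq zM by linarith
  qed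
  have "(z, k) # q \<in> qlists K" using q(1) z(1) k(1) by (simp add: qlists_def)
  then show ?case using step[OF A a M(2) q(2)] step[OF B b M(3) q(3)] by blast
qed

text \<open>Approximation is by coefficients in \<open>qc\<close> only; that the set is nevertheless
  closed under complex scalars is \<open>cspan_smult\<close>.\<close>

definition cspan :: "'a opspace \<Rightarrow> 'k set \<Rightarrow> ('k \<Rightarrow> 'a) \<Rightarrow> 'a set" where
  "cspan V K d = {x \<in> carrier V. \<forall>e>0. \<exists>p\<in>qlists K. vdist V x (lc V d p) < e}"

text \<open>A family rather than a set of generators, so that generators of different spaces can
  share one index set.\<close>

definition gens :: "'a opspace \<Rightarrow> 'k set \<Rightarrow> ('k \<Rightarrow> 'a) \<Rightarrow> bool" where
  "gens V K d \<longleftrightarrow> d ` K \<subseteq> carrier V \<and> carrier V \<subseteq> cspan V K d"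

context os
begin

context
  fixes K :: "'k set" and d :: "'k \<Rightarrow> 'a"
  assumes d: "d ` K \<subseteq> carrier V"
begin

lemma lc_mem: "p \<in> qlists K \<Longrightarrow> lc V d p \<in> carrier V"
  using lc_in[OF d] qlists_subset by blast

lemma lc_in_cspan: "p \<in> lists (UNIV \<times> K) \<Longrightarrow> lc V d p \<in> cspan V K d"
  using lc_approx2[OF ruan_axioms ruan_axioms d d] lc_in[OF d] by (fastforce simp: cspan_def)

lemma cspan_closed:
  assumes x: "x \<in> carrier V" and "\<And>e. e > 0 \<Longrightarrow> \<exists>t\<in>cspan V K d. vdist V x t < e"
  shows "x \<in> cspan V K d"
proof -
  have "\<exists>p\<in>qlists K. vdist V x (lc V d p) < e" if e: "e > 0" for e
  proof -
    obtain t where t: "t \<in> cspan V K d" "vdist V x t < e / 2" using assms(2)[of "e / 2"] e by auto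
    then obtain p where p: "p \<in> qlists K" "vdist V t (lc V d p) < e / 2"
      using e by (auto simp: cspan_def dest!: spec[of _ "e / 2"])
    then show ?thesis
      using vdist_triangle[OF x _ lc_mem[OF p(1)], of t] t
      by (intro bexI[of _ p]) (auto simp: cspan_def)
  qed
  then show ?thesis using x by (simp add: cspan_def)
qed

lemma cspan_add:
  assumes x: "x \<in> cspan V K d" and y: "y \<in> cspan V K d"
  shows "x \<oplus> y \<in> cspan V K d"
proof -
  have xy: "x \<in> carrier V" "y \<in> carrier V" using x y by (auto simp: cspan_def)
  have "\<exists>p\<in>qlists K. vdist V (x \<oplus> y) (lc V d p) < e" if e: "e > 0" for e
  proof -
    obtain p q where p: "p \<in> qlists K" "vdist V x (lc V d p) < e / 2"
      and q: "q \<in> qlists K" "vdist V y (lc V d q) < e / 2"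
      using x y e by (force simp: cspan_def dest!: spec[of _ "e / 2"])
    have "lc V d (p @ q) = lc V d p \<oplus> lc V d q"
      using p q qlists_subset by (intro lc_append[OF d]) auto
    then show ?thesis
      using vdist_add[OF xy lc_mem[OF p(1)] lc_mem[OF q(1)]] p q qlists_append
      by (intro bexI[of _ "p @ q"]) auto
  qed
  then show ?thesis using xy by (simp add: cspan_def)
qed

text \<open>A rational combination times \<open>a\<close> need not be rational, but it lies in the
  span by \<open>lc_in_cspan\<close>; such multiples approximate \<open>a \<odot> x\<close>, and the
  span is closed.\<close>

lemma cspan_smult:
  assumes x: "x \<in> cspan V K d"
  shows "a \<odot> x \<in> cspan V K d"
proof (rule cspan_closed)
  show "a \<odot> x \<in> carrier V" using x by (auto simp: cspan_def)
  fix e :: real assume "e > 0"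
  \<comment> \<open>The summand 1 keeps the divisor positive when \<open>a = 0\<close>.\<close>
  then have "e / (cmod a + 1) > 0" by (simp add: add_nonneg_pos)
  then obtain p where p: "p \<in> qlists K" "vdist V x (lc V d p) < e / (cmod a + 1)"
    using x unfolding cspan_def by blast
  have "vdist V x (lc V d p) * (cmod a + 1) < e"
    using p(2) by (simp add: pos_less_divide_eq add_nonneg_pos)
  moreover have "0 \<le> vdist V x (lc V d p)"
    using x lc_mem[OF p(1)] by (simp add: cspan_def vdist_nonneg)
  moreover have "vdist V (a \<odot> x) (a \<odot> lc V d p) = cmod a * vdist V x (lc V d p)"
    using x lc_mem[OF p(1)] by (simp add: cspan_def vdist_smult)
  ultimately have "vdist V (a \<odot> x) (a \<odot> lc V d p) < e"
    by (simp add: algebra_simps)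
  moreover have "a \<odot> lc V d p \<in> cspan V K d"
    using lc_scale[OF d, of p a] p(1) qlists_subset
      lc_in_cspan[of "map (\<lambda>(c, k). (a * c, k)) p"] by (fastforce simp: in_lists_conv_set)
  ultimately show "\<exists>t\<in>cspan V K d. vdist V (a \<odot> x) t < e" by blast
qed

lemma cspan_zero: "\<zero> \<in> cspan V K d"
  using lc_in_cspan[of "[]"] by simp

lemma cspan_gen: "k \<in> K \<Longrightarrow> d k \<in> cspan V K d"
  using lc_in_cspan[of "[(1, k)]"] d by (auto simp: image_subset_iff)

lemma cspan_subset: "cspan V K d \<subseteq> carrier V"
  by (auto simp: cspan_def)

lemma os_cspan:
  shows "os (sub_os V (cspan V K d))" "(\<lambda>x. x) \<in> lin (sub_os V (cspan V K d)) V"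
    "\<And>x y. x \<in> cspan V K d \<Longrightarrow> y \<in> cspan V K d \<Longrightarrow> vdist (sub_os V (cspan V K d)) x y = vdist V x y"
proof -
  note rules = cspan_add cspan_smult cspan_closed
  show "os (sub_os V (cspan V K d))" "(\<lambda>x. x) \<in> lin (sub_os V (cspan V K d)) V"
    by (rule os_sub_os[OF os_axioms cspan_subset cspan_zero]; fact rules)+
  fix x y assume xy: "x \<in> cspan V K d" "y \<in> cspan V K d"
  show "vdist (sub_os V (cspan V K d)) x y = vdist V x y"
    by (rule os_sub_os(3)[OF os_axioms cspan_subset cspan_zero _ _ _ xy]; fact rules)
qed

lemma lc_sub_os: "lc (sub_os V C) d p = lc V d p"
  by (induction p) auto

lemma gens_cspan: "gens (sub_os V (cspan V K d)) K d"
  unfolding gens_def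
proof
  show "d ` K \<subseteq> carrier (sub_os V (cspan V K d))"
    using cspan_gen by auto
  have "vdist (sub_os V (cspan V K d)) x (lc V d p) = vdist V x (lc V d p)"
    if "x \<in> cspan V K d" "p \<in> qlists K" for x p
    using os_cspan(3)[OF that(1) lc_in_cspan[of p]] that qlists_subset by blast
  then show "carrier (sub_os V (cspan V K d)) \<subseteq> cspan (sub_os V (cspan V K d)) K d"
    by (fastforce simp: cspan_def lc_sub_os)
qed

end

end

section \<open>Complete contractions and generating families\<close>

lemma vnorm_contraction:
  assumes "complete_contraction V W u" "vsp V" "v \<in> carrier V"
  shows "vnorm W (u v) \<le> vnorm V v"
proof -
  have "mat 1 1 (\<lambda>_. v) \<in> mats 1 V" using assms(3) by auto
  then show ?thesis
    using assms(1) map_mat1[of u v] unfolding complete_contraction_def vnorm_def by (metis le_refl)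
qed

lemma vdist_contraction:
  assumes "complete_contraction V W u" "vsp V" "vsp W" "u \<in> lin V W" "v \<in> carrier V" "w \<in> carrier V"
  shows "vdist W (u v) (u w) \<le> vdist V v w"
proof -
  interpret V: vsp V by fact
  have "u (v \<ominus>\<^bsub>V\<^esub> w) = u v \<ominus>\<^bsub>W\<^esub> u w"
    using assms by (intro vsp_hom.u_minus) (auto simp: vsp_hom_def vsp_hom_axioms_def)
  then show ?thesis
    using vnorm_contraction[OF assms(1,2), of "v \<ominus>\<^bsub>V\<^esub> w"] assms by (simp add: vdist_def)
qed

text \<open>Both maps send a combination of generators to the same combination of the images, and
  contractivity makes them continuous in the first norm.\<close>

lemma hom_eq_on_gens:
  assumes A: "os A" and B: "os B" and gens: "gens A K a"
    and f: "f \<in> lin A B" "complete_contraction A B f" and g: "g \<in> lin A B" "complete_contraction A B g"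
    and eq: "\<And>k. k \<in> K \<Longrightarrow> f (a k) = g (a k)" and x: "x \<in> carrier A"
  shows "f x = g x"
proof -
  interpret A: os A by fact
  interpret B: os B by fact
  have a: "a ` K \<subseteq> carrier A" using gens by (simp add: gens_def)
  have vv: "vsp A" "vsp B" by unfold_locales
  show ?thesis
  proof (rule B.vdist_le_0)
    fix e :: real assume "e > 0"
    then obtain p where p: "p \<in> qlists K" "vdist A x (lc A a p) < e / 2"
      using gens x unfolding gens_def cspan_def by (smt (verit) half_gt_zero mem_Collect_eq subset_iff)
    have p': "p \<in> lists (UNIV \<times> K)" using p(1) qlists_subset by blast
    note l = A.lc_in[OF a p']
    have "f (lc A a p) = lc B (\<lambda>k. f (a k)) p" "g (lc A a p) = lc B (\<lambda>k. g (a k)) p"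
      using f g vv by (auto intro!: vsp_hom.lc_hom[OF _ a p'] simp: vsp_hom_def vsp_hom_axioms_def)
    then have fg: "f (lc A a p) = g (lc A a p)"
      using lc_cong[OF eq p'] by simp
    have "vdist B (f x) (g x) \<le> vdist B (f x) (f (lc A a p)) + vdist B (g (lc A a p)) (g x)"
      using B.vdist_triangle[of "f x" "f (lc A a p)" "g x"] linD(1)[OF f(1)] linD(1)[OF g(1)] l x fg by simp
    also have "\<dots> \<le> vdist A x (lc A a p) + vdist A (lc A a p) x"
      using vdist_contraction[OF f(2) vv f(1) x l] vdist_contraction[OF g(2) vv g(1) l x] by simp
    also have "\<dots> \<le> e"
      using p(2) A.vdist_commute[OF x l] by simp
    finally show "vdist B (f x) (g x) \<le> e" .
  qed (use linD(1)[OF f(1)] linD(1)[OF g(1)] x in auto)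
qed

text \<open>The map is the closure of the assignment of \<open>lc B b p\<close> to
  \<open>lc A a p\<close>. The inequalities for 1 x 1 matrices make it well defined and continuous,
  those for larger ones make it completely contractive; for countable \<open>K\<close> there are
  only countably many of them.\<close>

lemma hom_extension:
  fixes A :: "'a opspace" and B :: "'b opspace" and a :: "'k \<Rightarrow> 'a"
  assumes "os A" "os B" and gens: "gens A K a" and b: "b ` K \<subseteq> carrier B"
    and le: "\<And>n P. n \<ge> 1 \<Longrightarrow> P \<in> carrier_mat n n \<Longrightarrow> elements_mat P \<subseteq> qlists K \<Longrightarrow>
      mnorm B (map_mat (lc B b) P) \<le> mnorm A (map_mat (lc A a) P)"
  obtains f where "f \<in> lin A B" "complete_contraction A B f" "\<And>k. k \<in> K \<Longrightarrow> f (a k) = b k"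
proof -
  interpret A: os A by fact
  interpret B: os B by fact
  have a: "a ` K \<subseteq> carrier A" using gens by (simp add: gens_def)
  have dense: "\<exists>p\<in>qlists K. vdist A x (lc A a p) < e" if "x \<in> carrier A" "e > 0" for x e
    using gens that unfolding gens_def cspan_def by blast
  note lcA = A.lc_mem[OF a] and lcB = B.lc_mem[OF b]
  have le1: "vnorm B (lc B b p) \<le> vnorm A (lc A a p)" if p: "p \<in> qlists K" for p
    using le[of 1 "mat 1 1 (\<lambda>_. p)"] p map_mat1[of "lc B b" p] map_mat1[of "lc A a" p]
    by (auto simp: vnorm_def elements_mat_def)
  have le_dist: "vdist B (lc B b p) (lc B b q) \<le> vdist A (lc A a p) (lc A a q)"
    if p: "p \<in> qlists K" and q: "q \<in> qlists K" for p q
  proof -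
    \<comment> \<open>A rational list for the difference of two combinations, so that the norm
      inequality becomes an inequality of distances.\<close>
    define r where "r = p @ map (\<lambda>(c, k). (- 1 * c, k)) q"
    have r': "map (\<lambda>(c, k). (- 1 * c, k)) q \<in> qlists K"
      using q qc_uminus by (fastforce simp: qlists_def in_lists_conv_set)
    have r: "r \<in> qlists K"
      unfolding r_def by (rule qlists_append[OF p r'])
    note sub = p[THEN subsetD[OF qlists_subset]] q[THEN subsetD[OF qlists_subset]]
      r'[THEN subsetD[OF qlists_subset]]
    have "lc A a r = lc A a p \<ominus>\<^bsub>A\<^esub> lc A a q" "lc B b r = lc B b p \<ominus>\<^bsub>B\<^esub> lc B b q"
      unfolding r_def using sub p q lcA lcB
      by (simp_all only: A.lc_append[OF a] A.lc_scale[OF a] A.minus_eq'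
        B.lc_append[OF b] B.lc_scale[OF b] B.minus_eq')
    then show ?thesis using le1[OF r] by (simp add: vdist_def)
  qed
  \<comment> \<open>The closure, in the product of \<open>A\<close> and \<open>B\<close>, of the
    graph on rational combinations. As a relation it postpones the choice of values until it is
    known to be total and single-valued.\<close>
  define R where "R x y \<longleftrightarrow> x \<in> carrier A \<and> y \<in> carrier B \<and>
    (\<forall>e>0. \<exists>p\<in>qlists K. vdist A x (lc A a p) < e \<and> vdist B y (lc B b p) < e)" for x y
  have Rcar: "x \<in> carrier A" "y \<in> carrier B" if "R x y" for x y
    using that by (auto simp: R_def)
  have RD: "\<exists>p\<in>qlists K. vdist A x (lc A a p) < e \<and> vdist B y (lc B b p) < e" if "R x y" "e > 0" for x y e
    using that by (auto simp: R_def)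
  \<comment> \<open>Combinations converging to \<open>x\<close> have a Cauchy sequence of
    evaluations in \<open>B\<close>, by \<open>le_dist\<close>; completeness of \<open>B\<close>
    supplies the value.\<close>
  have total: "\<exists>y. R x y" if x: "x \<in> carrier A" for x
  proof -
    have "\<exists>p\<in>qlists K. vdist A x (lc A a p) < 1 / real (Suc n)" for n
      using dense[OF x] by simp
    then obtain p where p: "\<And>n. p n \<in> qlists K" "\<And>n. vdist A x (lc A a (p n)) < 1 / real (Suc n)"
      by metis
    have small: "\<exists>N. \<forall>n\<ge>N. vdist A x (lc A a (p n)) < e" if e: "e > 0" for e
    proof -
      obtain N where N: "1 / real (Suc N) < e" using nat_approx_posE[OF e] by blast
      have "vdist A x (lc A a (p n)) < e" if "n \<ge> N" for n
        using p(2)[of n] N frac_le[of 1 1 "real (Suc N)" "real (Suc n)"] that by simp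
      then show ?thesis by blast
    qed
    have "\<exists>N. \<forall>m\<ge>N. \<forall>n\<ge>N. vdist B (lc B b (p m)) (lc B b (p n)) < e" if "e > 0" for e
    proof -
      obtain N where N: "\<And>n. n \<ge> N \<Longrightarrow> vdist A x (lc A a (p n)) < e / 2"
        using small[of "e / 2"] \<open>e > 0\<close> by auto
      have "vdist B (lc B b (p m)) (lc B b (p n)) < e" if mn: "m \<ge> N" "n \<ge> N" for m n
      proof -
        have "vdist B (lc B b (p m)) (lc B b (p n)) \<le> vdist A (lc A a (p m)) (lc A a (p n))"
          by (rule le_dist[OF p(1) p(1)])
        also have "\<dots> \<le> vdist A (lc A a (p m)) x + vdist A x (lc A a (p n))"
          by (rule A.vdist_triangle[OF lcA x lcA]; rule p)
        also have "\<dots> < e"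
          using N[OF mn(1)] N[OF mn(2)] A.vdist_commute[OF x lcA[OF p(1)]] by simp
        finally show ?thesis .
      qed
      then show ?thesis by blast
    qed
    then obtain y where y: "y \<in> carrier B" and
      lim: "\<And>e. e > 0 \<Longrightarrow> \<exists>N. \<forall>n\<ge>N. vdist B (lc B b (p n)) y < e"
      using os_completeD[OF B.complete, of "\<lambda>n. lc B b (p n)"] lcB p(1) by blast
    have "\<exists>q\<in>qlists K. vdist A x (lc A a q) < e \<and> vdist B y (lc B b q) < e" if e: "e > 0" for e
    proof -
      obtain N M where "\<And>n. n \<ge> N \<Longrightarrow> vdist A x (lc A a (p n)) < e"
        "\<And>n. n \<ge> M \<Longrightarrow> vdist B (lc B b (p n)) y < e"
        using small[OF e] lim[OF e] by blast
      then show ?thesis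
        using p(1) B.vdist_commute[OF y lcB[OF p(1)]] by (intro bexI[of _ "p (max M N)"]) auto
    qed
    then show ?thesis using x y by (auto simp: R_def)
  qed
  have func: "y = y'" if r: "R x y" "R x y'" for x y y'
  proof (rule B.vdist_le_0)
    note x = Rcar(1)[OF r(1)] and y = Rcar(2)[OF r(1)] and y' = Rcar(2)[OF r(2)]
    fix e :: real assume "e > 0"
    \<comment> \<open>Four distances occur between \<open>y\<close> and \<open>y'\<close>: from
      \<open>y\<close> to the value of \<open>p\<close> in \<open>B\<close>, from \<open>p\<close>
      through \<open>x\<close> to \<open>q\<close> in \<open>A\<close>, and from the value of
      \<open>q\<close> to \<open>y'\<close> in \<open>B\<close>.\<close>
    then have e4: "e / 4 > 0" by simp
    obtain p q where p: "p \<in> qlists K" "vdist A x (lc A a p) < e / 4" "vdist B y (lc B b p) < e / 4"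
      and q: "q \<in> qlists K" "vdist A x (lc A a q) < e / 4" "vdist B y' (lc B b q) < e / 4"
      using RD[OF r(1) e4] RD[OF r(2) e4] by blast
    have "vdist B y y' \<le> vdist B y (lc B b p) + vdist B (lc B b p) y'"
      by (rule B.vdist_triangle[OF y lcB[OF p(1)] y'])
    also have "vdist B (lc B b p) y' \<le> vdist B (lc B b p) (lc B b q) + vdist B (lc B b q) y'"
      by (rule B.vdist_triangle[OF lcB[OF p(1)] lcB[OF q(1)] y'])
    also have "vdist B (lc B b p) (lc B b q) \<le> vdist A (lc A a p) x + vdist A x (lc A a q)"
      using le_dist[OF p(1) q(1)] A.vdist_triangle[OF lcA[OF p(1)] x lcA[OF q(1)]] by simp
    finally show "vdist B y y' \<le> e"
      using p q A.vdist_commute[OF x lcA[OF p(1)]] B.vdist_commute[OF y' lcB[OF q(1)]] by simp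
  qed (use Rcar r in auto)
  have Radd: "R (x \<oplus>\<^bsub>A\<^esub> x') (y \<oplus>\<^bsub>B\<^esub> y')" if r: "R x y" "R x' y'" for x x' y y'
  proof -
    have "\<exists>p\<in>qlists K. vdist A (x \<oplus>\<^bsub>A\<^esub> x') (lc A a p) < e \<and> vdist B (y \<oplus>\<^bsub>B\<^esub> y') (lc B b p) < e"
      if "e > 0" for e
    proof -
      have e2: "e / 2 > 0" using that by simp
      obtain p q where p: "p \<in> qlists K" "vdist A x (lc A a p) < e / 2" "vdist B y (lc B b p) < e / 2"
        and q: "q \<in> qlists K" "vdist A x' (lc A a q) < e / 2" "vdist B y' (lc B b q) < e / 2"
        using RD[OF r(1) e2] RD[OF r(2) e2] by blast
      note sub = p(1)[THEN subsetD[OF qlists_subset]] q(1)[THEN subsetD[OF qlists_subset]]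
      show ?thesis
        using A.vdist_add[OF Rcar(1)[OF r(1)] Rcar(1)[OF r(2)] lcA[OF p(1)] lcA[OF q(1)]]
          B.vdist_add[OF Rcar(2)[OF r(1)] Rcar(2)[OF r(2)] lcB[OF p(1)] lcB[OF q(1)]] p q
          A.lc_append[OF a sub] B.lc_append[OF b sub] qlists_append[OF p(1) q(1)]
        by (intro bexI[of _ "p @ q"]) auto
    qed
    then show ?thesis using Rcar r by (simp add: R_def)
  qed
  have Rsmult: "R (c \<odot>\<^bsub>A\<^esub> x) (c \<odot>\<^bsub>B\<^esub> y)" if r: "R x y" for c x y
  proof -
    note x = Rcar(1)[OF r] and y = Rcar(2)[OF r]
    have "\<exists>p\<in>qlists K. vdist A (c \<odot>\<^bsub>A\<^esub> x) (lc A a p) < e \<and> vdist B (c \<odot>\<^bsub>B\<^esub> y) (lc B b p) < e"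
      if e: "e > 0" for e
    proof -
      \<comment> \<open>The factor 2 leaves room for a second approximation, as \<open>c\<close>
        times a rational combination need not be rational; the summand 1 excludes division by
        0.\<close>
      define M where "M = 2 * (cmod c + 1)"
      have M: "M > 0" by (simp add: M_def add_nonneg_pos)
      then obtain p where p: "p \<in> qlists K" "vdist A x (lc A a p) < e / M" "vdist B y (lc B b p) < e / M"
        using RD[OF r, of "e / M"] e by auto
      have bound: "cmod c * t < e / 2" if "t < e / M" "0 \<le> t" for t
      proof -
        have "t * M < e" using that M by (simp add: pos_less_divide_eq)
        then show ?thesis using that(2) by (simp add: M_def algebra_simps)
      qed
      note sub = p(1)[THEN subsetD[OF qlists_subset]]
      let ?q = "map (\<lambda>(d, k). (c * d, k)) p"
      have q: "?q \<in> lists (UNIV \<times> K)" using sub by (fastforce simp: in_lists_conv_set)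
      have qA: "lc A a ?q = c \<odot>\<^bsub>A\<^esub> lc A a p" and qB: "lc B b ?q = c \<odot>\<^bsub>B\<^esub> lc B b p"
        by (rule A.lc_scale[OF a sub] B.lc_scale[OF b sub])+
      obtain s where s: "s \<in> qlists K" "vdist A (lc A a ?q) (lc A a s) < e / 2" "vdist B (lc B b ?q) (lc B b s) < e / 2"
        using lc_approx2[OF A.ruan_axioms B.ruan_axioms a b q, of "e / 2"] e by auto
      have "vdist A (c \<odot>\<^bsub>A\<^esub> x) (lc A a s) \<le> vdist A (c \<odot>\<^bsub>A\<^esub> x) (lc A a ?q) + vdist A (lc A a ?q) (lc A a s)"
        using x lcA[OF s(1)] A.lc_in[OF a q] by (intro A.vdist_triangle) auto
      also have "\<dots> < e"
        using s(2) bound[OF p(2) A.vdist_nonneg[OF x lcA[OF p(1)]]] A.vdist_smult[OF x lcA[OF p(1)], of c] by (simp add: qA)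
      finally have 1: "vdist A (c \<odot>\<^bsub>A\<^esub> x) (lc A a s) < e" .
      have "vdist B (c \<odot>\<^bsub>B\<^esub> y) (lc B b s) \<le> vdist B (c \<odot>\<^bsub>B\<^esub> y) (lc B b ?q) + vdist B (lc B b ?q) (lc B b s)"
        using y lcB[OF s(1)] B.lc_in[OF b q] by (intro B.vdist_triangle) auto
      also have "\<dots> < e"
        using s(3) bound[OF p(3) B.vdist_nonneg[OF y lcB[OF p(1)]]] B.vdist_smult[OF y lcB[OF p(1)], of c] by (simp add: qB)
      finally show ?thesis using 1 s(1) by blast
    qed
    then show ?thesis using x y by (simp add: R_def)
  qed
  have Rnorm: "mnorm B Y \<le> mnorm A X"
    if n: "n \<ge> 1" and X: "X \<in> mats n A" and Y: "Y \<in> mats n B"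
      and r: "\<And>i j. i < n \<Longrightarrow> j < n \<Longrightarrow> R (X $$ (i, j)) (Y $$ (i, j))" for n X Y
  proof (rule field_le_epsilon)
    fix e :: real assume e: "e > 0"
    \<comment> \<open>Two approximations, one in \<open>B\<close> and one in \<open>A\<close>, each
      cost \<open>n * n\<close> times \<open>d\<close>, hence the factor 2.\<close>
    define d where "d = e / (2 * real (n * n))"
    have d: "d > 0" "real (n * n) * d + real (n * n) * d = e" using e n by (auto simp: d_def)
    have "\<exists>p\<in>qlists K. vdist A (X $$ (i, j)) (lc A a p) < d \<and> vdist B (Y $$ (i, j)) (lc B b p) < d"
      if "i < n" "j < n" for i j using RD[OF r[OF that] d(1)] .
    then obtain p where p: "\<And>i j. i < n \<Longrightarrow> j < n \<Longrightarrow> p i j \<in> qlists K"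
      "\<And>i j. i < n \<Longrightarrow> j < n \<Longrightarrow> vdist A (X $$ (i, j)) (lc A a (p i j)) < d"
      "\<And>i j. i < n \<Longrightarrow> j < n \<Longrightarrow> vdist B (Y $$ (i, j)) (lc B b (p i j)) < d"
      by metis
    define P where "P = mat n n (\<lambda>(i, j). p i j)"
    have P: "P \<in> carrier_mat n n" "elements_mat P \<subseteq> qlists K"
      using p(1) by (auto simp: P_def elements_mat_def)
    have PA: "map_mat (lc A a) P \<in> mats n A" and PB: "map_mat (lc B b) P \<in> mats n B"
      using p(1) lcA lcB by (auto simp: in_mats P_def)
    have "mnorm B Y \<le> mnorm B (map_mat (lc B b) P) + real (n * n) * d"
      using p(3) by (intro B.norm_le_add_eps[OF Y PB n]) (auto simp: P_def less_imp_le)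
    also have "mnorm B (map_mat (lc B b) P) \<le> mnorm A (map_mat (lc A a) P)"
      by (rule le[OF n P])
    also have "mnorm A (map_mat (lc A a) P) \<le> mnorm A X + real (n * n) * d"
      using p(2) A.vdist_commute[OF lcA matsD(3)[OF X]] p(1)
      by (intro A.norm_le_add_eps[OF PA X n]) (auto simp: P_def less_imp_le)
    finally show "mnorm B Y \<le> mnorm A X + e" using d(2) by linarith
  qed
  define f where "f x = (SOME y. R x y)" for x
  have Rf: "R x (f x)" if "x \<in> carrier A" for x
    unfolding f_def by (rule someI_ex[OF total[OF that]])
  have f: "f x = y" if "R x y" for x y
    using func[OF Rf[OF Rcar(1)[OF that]] that] .
  show thesis
  proof
    show "f \<in> lin A B"
      unfolding lin_iff using Rcar(2)[OF Rf] f[OF Radd[OF Rf Rf]] f[OF Rsmult[OF Rf]] by simp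
    show "complete_contraction A B f"
      unfolding complete_contraction_def
    proof (intro allI impI ballI)
      fix n x assume n: "1 \<le> n" and x: "x \<in> mats n A"
      have "map_mat f x \<in> mats n B" by (rule mats_map[OF x Rcar(2)[OF Rf]])
      then show "mnorm B (map_mat f x) \<le> mnorm A x"
        using Rf matsD[OF x] by (intro Rnorm[OF n x]) auto
    qed
    show "f (a k) = b k" if k: "k \<in> K" for k
    proof (rule f)
      have ab: "a k \<in> carrier A" "b k \<in> carrier B" using a b k by auto
      have "[(1, k)] \<in> qlists K" using k qc_1 by (simp add: qlists_def)
      then show "R (a k) (b k)"
        using ab unfolding R_def by (intro conjI allI impI bexI[of _ "[(1, k)]"]) auto
    qed
  qed
qed

section \<open>Small sets and the category of operator spaces\<close>

locale univ =
  fixes U :: "'u itself"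
  assumes universe: "universe U"
begin

lemma infinite_univ: "infinite (UNIV :: 'u set)"
  using universe by (simp add: universe_def)

lemma small_le: "|A| \<le>o |B| \<Longrightarrow> small U B \<Longrightarrow> small U A"
  unfolding small_def by (rule ordLeq_ordLess_trans)

lemma small_subset: "A \<subseteq> B \<Longrightarrow> small U B \<Longrightarrow> small U A"
  by (rule small_le[OF card_of_mono1])

lemma small_image: "small U A \<Longrightarrow> small U (f ` A)"
  by (rule small_le[OF card_of_image])

lemma small_inj_on: "inj_on f A \<Longrightarrow> f ` A \<subseteq> B \<Longrightarrow> small U B \<Longrightarrow> small U A"
  by (rule small_le) (use card_of_ordLeq in blast)+

lemma small_obtain_inj:
  assumes "small U A"
  obtains f :: "'a \<Rightarrow> 'u" where "inj_on f A"
  using ordLess_imp_ordLeq[OF assms[unfolded small_def]] card_of_ordLeq[of A "UNIV :: 'u set"] by blast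

text \<open>Regularity of the cardinal of \<open>'u\<close> enters here, in the form of stability
  under unions.\<close>

lemma small_UN: "small U I \<Longrightarrow> (\<And>i. i \<in> I \<Longrightarrow> small U (A i)) \<Longrightarrow> small U (\<Union>i\<in>I. A i)"
proof -
  have "stable |UNIV :: 'u set|"
    using universe infinite_univ by (intro regularCard_stable) (auto simp: universe_def card_of_card_order_on Field_card_of)
  then show "small U I \<Longrightarrow> (\<And>i. i \<in> I \<Longrightarrow> small U (A i)) \<Longrightarrow> small U (\<Union>i\<in>I. A i)"
    unfolding small_def by (rule stable_UNION)
qed

lemma small_Sigma: 
  assumes "small U I" "\<And>i. i \<in> I \<Longrightarrow> small U (A i)"
  shows "small U (SIGMA i : I. A i)"
proof -
  have "(SIGMA i : I. A i) = (\<Union>i\<in>I. Pair i ` A i)" by auto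
  then show ?thesis using assms by (simp add: small_UN small_image)
qed

lemma small_finite: "finite A \<Longrightarrow> small U A"
  unfolding small_def using infinite_univ
  by (intro finite_ordLess_infinite) (auto simp: card_of_well_order_on Field_card_of)

text \<open>Subsets are coded by sequences in a two-element set, to which the sequence condition of
  \<open>universe\<close> applies.\<close>

lemma small_Pow_countable:
  assumes "countable C"
  shows "small U (Pow C)"
proof -
  obtain x y :: 'u where xy: "x \<noteq> y"
    using infinite_univ by (metis (full_types) UNIV_eq_I finite.simps insertI1 ex_new_if_finite)
  show ?thesis
  proof (rule small_inj_on)
    show "small U {s :: nat \<Rightarrow> 'u. range s \<subseteq> {x, y}}"
      using universe small_finite[of "{x, y}"] by (simp add: universe_def)
    let ?f = "\<lambda>X n. if n \<in> to_nat_on C ` X then x else y"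
    show "inj_on ?f (Pow C)"
    proof (rule inj_onI)
      fix X Y assume X: "X \<in> Pow C" and Y: "Y \<in> Pow C" and eq: "?f X = ?f Y"
      have "to_nat_on C ` X = to_nat_on C ` Y"
      proof (rule Set.set_eqI)
        fix n
        show "n \<in> to_nat_on C ` X \<longleftrightarrow> n \<in> to_nat_on C ` Y"
          using fun_cong[OF eq, of n] xy by (simp split: if_splits)
      qed
      then show "X = Y"
        using inj_on_image_eq_iff[OF inj_on_to_nat_on[OF assms]] X Y by blast
    qed
    show "?f ` Pow C \<subseteq> {s. range s \<subseteq> {x, y}}" by auto
  qed
qed

lemma small_countable: 
  assumes "countable C"
  shows "small U C"
  by (rule small_inj_on[OF _ _ small_Pow_countable[OF assms], of "\<lambda>c. {c}"]) auto

lemma small_seqs: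
  assumes "small U A"
  shows "small U {s :: nat \<Rightarrow> 'a. range s \<subseteq> A}"
proof -
  obtain f :: "'a \<Rightarrow> 'u" where f: "inj_on f A" using small_obtain_inj[OF assms] .
  show ?thesis
  proof (rule small_inj_on)
    show "small U {s :: nat \<Rightarrow> 'u. range s \<subseteq> f ` A}"
      using universe small_image[OF assms, of f] by (simp add: universe_def)
    show "inj_on (\<lambda>s. f \<circ> s) {s :: nat \<Rightarrow> 'a. range s \<subseteq> A}"
    proof (rule inj_onI)
      fix s t :: "nat \<Rightarrow> 'a"
      assume s: "s \<in> {s. range s \<subseteq> A}" and t: "t \<in> {s. range s \<subseteq> A}" and eq: "f \<circ> s = f \<circ> t"
      have "s n = t n" for n
        using inj_onD[OF f, of "s n" "t n"] fun_cong[OF eq, of n] s t by auto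
      then show "s = t" by blast
    qed
  qed auto
qed

lemma small_countable_subsets:
  assumes "small U A"
  shows "small U {D. D \<subseteq> A \<and> D \<noteq> {} \<and> countable D}"
proof (rule small_subset)
  show "small U (range ` {s :: nat \<Rightarrow> 'a. range s \<subseteq> A})"
    by (rule small_image[OF small_seqs[OF assms]])
  show "{D. D \<subseteq> A \<and> D \<noteq> {} \<and> countable D} \<subseteq> range ` {s :: nat \<Rightarrow> 'a. range s \<subseteq> A}"
  proof
    fix D assume "D \<in> {D. D \<subseteq> A \<and> D \<noteq> {} \<and> countable D}"
    then have "range (from_nat_into D) = D" "D \<subseteq> A" by simp_all
    then show "D \<in> range ` {s :: nat \<Rightarrow> 'a. range s \<subseteq> A}"
      by (intro image_eqI[of _ _ "from_nat_into D"]) auto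
  qed
qed

text \<open>Lists of one fixed length become sequences by padding with an element \<open>a\<close>,
  and the fixed length makes this injective. The union over all lengths is a countable one.\<close>

lemma small_lists:
  assumes "small U A"
  shows "small U (lists A)"
proof (cases "A = {}")
  case True
  then show ?thesis by (simp add: small_finite)
next
  case False
  then obtain a where a: "a \<in> A" by blast
  have "small U {xs \<in> lists A. length xs = n}" for n
  proof (rule small_inj_on)
    show "small U {s :: nat \<Rightarrow> 'a. range s \<subseteq> A}" by (rule small_seqs[OF assms])
    show "inj_on (\<lambda>xs k. if k < n then xs ! k else a) {xs \<in> lists A. length xs = n}"
    proof (intro inj_onI nth_equalityI)
      fix xs ys :: "'a list" and i
      assume "xs \<in> {xs \<in> lists A. length xs = n}" "i < length xs"
        and eq: "(\<lambda>k. if k < n then xs ! k else a) = (\<lambda>k. if k < n then ys ! k else a)"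
      then show "xs ! i = ys ! i"
        using fun_cong[OF eq, of i] by simp
    qed simp
    show "(\<lambda>xs k. if k < n then xs ! k else a) ` {xs \<in> lists A. length xs = n} \<subseteq> {s. range s \<subseteq> A}"
      using a by (auto simp: in_lists_conv_set)
  qed
  then have "small U (\<Union>n. {xs \<in> lists A. length xs = n})"
    by (intro small_UN) (simp_all add: small_countable)
  moreover have "lists A = (\<Union>n. {xs \<in> lists A. length xs = n})" by auto
  ultimately show ?thesis by simp
qed

lemma small_qlists: "small U K \<Longrightarrow> small U (qlists K)"
  unfolding qlists_def
  by (intro small_lists small_Sigma small_countable[OF countable_qc])

text \<open>A point is recovered from a sequence of rational combinations at distance below
  \<open>1 / (n + 1)\<close>, so the closed span injects into sequences of lists, however large the
  ambient space is.\<close>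

lemma small_cspan:
  fixes V :: "'a opspace"
  assumes "os V" and d: "d ` K \<subseteq> carrier V" and K: "small U K"
  shows "small U (cspan V K d)"
proof -
  interpret os V by fact
  have "\<exists>p\<in>qlists K. vdist V x (lc V d p) < 1 / real (Suc n)" if "x \<in> cspan V K d" for x n
    using that by (simp add: cspan_def)
  then obtain p where p: "\<And>x n. x \<in> cspan V K d \<Longrightarrow> p x n \<in> qlists K"
    "\<And>x n. x \<in> cspan V K d \<Longrightarrow> vdist V x (lc V d (p x n)) < 1 / real (Suc n)"
    by metis
  show ?thesis
  proof (rule small_inj_on)
    show "small U {s :: nat \<Rightarrow> _. range s \<subseteq> qlists K}"
      by (rule small_seqs[OF small_qlists[OF K]])
    show "p ` cspan V K d \<subseteq> {s :: nat \<Rightarrow> _. range s \<subseteq> qlists K}"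
      using p(1) by auto
    show "inj_on p (cspan V K d)"
    proof (rule inj_onI)
      fix x y assume x: "x \<in> cspan V K d" and y: "y \<in> cspan V K d" and eq: "p x = p y"
      have xy: "x \<in> carrier V" "y \<in> carrier V" using x y by (auto simp: cspan_def)
      show "x = y"
      proof (rule vdist_le_0[OF xy])
        fix e :: real assume e: "e > 0"
        obtain N where N: "1 / real (Suc N) < e / 2" using nat_approx_posE[of "e / 2"] e by auto
        have l: "lc V d (p x N) \<in> carrier V" by (rule lc_mem[OF d p(1)[OF x]])
        have "vdist V x y \<le> vdist V x (lc V d (p x N)) + vdist V (lc V d (p x N)) y"
          by (rule vdist_triangle[OF xy(1) l xy(2)])
        then show "vdist V x y \<le> e"
          using p(2)[OF x, of N] p(2)[OF y, of N] N eq vdist_commute[OF l xy(2)] by simp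
      qed
    qed
  qed
qed

text \<open>\<open>\<kappa>\<close> is any labelling with few values that separates points up to
  distance 0. There are then at most as many classes of points at distance 0 as labels, so the
  classes can be named by elements of \<open>'u\<close>, and \<open>image_os\<close> performs
  quotient and transport at once.\<close>

lemma realize:
  fixes V :: "'a opspace" and \<kappa> :: "'a \<Rightarrow> 'c"
  assumes V: "ruan V" "os_complete V" and \<kappa>: "small U (\<kappa> ` carrier V)"
    and sep: "\<And>x y. x \<in> carrier V \<Longrightarrow> y \<in> carrier V \<Longrightarrow> \<kappa> x = \<kappa> y \<Longrightarrow> vdist V x y = 0"
  obtains W :: "'u opspace" and u where "os W" "small U (carrier W)" "u \<in> lin V W" "u ` carrier V = carrier W"
    "\<And>n x. n \<ge> 1 \<Longrightarrow> x \<in> mats n V \<Longrightarrow> mnorm W (map_mat u x) = mnorm V x"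
proof -
  interpret ruan V by (rule V(1))
  define cls where "cls x = {y \<in> carrier V. vdist V x y = 0}" for x
  have cls: "cls x = cls y \<longleftrightarrow> vdist V x y = 0" if xy: "x \<in> carrier V" "y \<in> carrier V" for x y
  proof
    assume "cls x = cls y"
    then have "y \<in> cls x" using xy by (simp add: cls_def)
    then show "vdist V x y = 0" by (simp add: cls_def)
  next
    assume z: "vdist V x y = 0"
    have "vdist V x w = 0 \<longleftrightarrow> vdist V y w = 0" if w: "w \<in> carrier V" for w
      using z vdist_triangle[OF xy(1,2) w] vdist_triangle[OF xy(2,1) w] vdist_commute[OF xy]
        vdist_nonneg[OF xy(1) w] vdist_nonneg[OF xy(2) w] by linarith
    then show "cls x = cls y" by (auto simp: cls_def)
  qed
  have "cls ` carrier V = (\<lambda>l. cls (inv_into (carrier V) \<kappa> l)) ` (\<kappa> ` carrier V)"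
    unfolding image_image
  proof (rule image_cong)
    fix x assume x: "x \<in> carrier V"
    have "inv_into (carrier V) \<kappa> (\<kappa> x) \<in> carrier V" "\<kappa> (inv_into (carrier V) \<kappa> (\<kappa> x)) = \<kappa> x"
      using x by (auto simp: inv_into_into f_inv_into_f)
    then show "cls x = cls (inv_into (carrier V) \<kappa> (\<kappa> x))"
      using sep x cls by metis
  qed simp
  then have sc: "small U (cls ` carrier V)" using small_image[OF \<kappa>] by metis
  then obtain g :: "'a set \<Rightarrow> 'u" where g: "inj_on g (cls ` carrier V)" by (rule small_obtain_inj)
  define u where "u x = g (cls x)" for x
  have u: "u x = u y \<longleftrightarrow> vdist V x y = 0" if "x \<in> carrier V" "y \<in> carrier V" for x y
    using cls[OF that] inj_on_eq_iff[OF g, of "cls x" "cls y"] that by (auto simp: u_def)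
  note W = image_os[where u = u, OF V(1) u]
  have "small U (carrier (image_os V u))"
    using small_image[OF sc, of g] by (simp add: image_os_def Let_def u_def image_image)
  moreover have "os (image_os V u)"
    using W(4,5,6) V(2) by (simp add: os_iff operator_space_iff)
  ultimately show thesis using that W(1,2,3) by blast
qed

end

section \<open>Morphisms and composition in \<open>OS\<close>\<close>

lemma OS_simps:
  "Obj (OS :: ('u opspace, 'u \<Rightarrow> 'u) category) = {V. operator_space V \<and> small TYPE('u) (carrier V)}"
  "Hom OS V W = {u \<in> extensional (carrier V). u \<in> lin V W \<and> complete_contraction V W u}"
  "Ident OS V = (\<lambda>v\<in>carrier V. v)"
  "Comp OS V W Z g f = compose (carrier V) g f"
  for V W Z :: "'u opspace"
  by (simp_all add: OS_def)

text \<open>Cutting a function down to the carrier changes the image of no matrix over it, hence no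
  norm estimate, and makes the function extensional as \<open>OS\<close> demands.\<close>

lemma Hom_restrict:
  assumes "u \<in> lin V W" "complete_contraction V W u" "vsp V"
  shows "restrict u (carrier V) \<in> Hom OS V W"
proof -
  interpret vsp V by fact
  have "map_mat (restrict u (carrier V)) x = map_mat u x" if "x \<in> mats n V" for x n
    using that by (rule map_mat_cong') simp
  then show ?thesis
    using assms by (auto simp: OS_simps lin_iff complete_contraction_def)
qed

lemma HomD:
  assumes "u \<in> Hom OS V W"
  shows "u \<in> extensional (carrier V)" "u \<in> lin V W" "complete_contraction V W u"
  using assms by (auto simp: OS_simps)

lemma Obj_os: "V \<in> Obj OS \<Longrightarrow> os V"
  by (simp add: OS_simps os_iff)

lemma Obj_vsp: "V \<in> Obj OS \<Longrightarrow> vsp V"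
  using Obj_os by (auto simp: os_def ruan_def)

lemma lin_compose:
  assumes "u \<in> lin V W" "w \<in> lin W Z"
  shows "(\<lambda>x. w (u x)) \<in> lin V Z"
  using assms by (auto simp: lin_iff)

lemma contraction_compose:
  assumes "u \<in> lin V W" "complete_contraction V W u" "complete_contraction W Z w"
  shows "complete_contraction V Z (\<lambda>x. w (u x))"
  unfolding complete_contraction_def
proof (intro allI impI ballI)
  fix n x assume n: "1 \<le> n" and x: "x \<in> mats n V"
  have "map_mat u x \<in> mats n W" using x linD(1)[OF assms(1)] by (rule mats_map)
  then have "mnorm Z (map_mat w (map_mat u x)) \<le> mnorm V x"
    using assms n x unfolding complete_contraction_def by (meson order_trans)
  then show "mnorm Z (map_mat (\<lambda>x. w (u x)) x) \<le> mnorm V x" by (simp add: map_mat_comp')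
qed

lemma Hom_compose:
  assumes "f \<in> Hom OS V W" "g \<in> Hom OS W Z" "vsp V"
  shows "compose (carrier V) g f \<in> Hom OS V Z"
proof -
  have "(\<lambda>x. g (f x)) \<in> lin V Z" "complete_contraction V Z (\<lambda>x. g (f x))"
    using HomD[OF assms(1)] HomD[OF assms(2)] lin_compose contraction_compose by blast+
  then show ?thesis
    using Hom_restrict[OF _ _ assms(3), of "\<lambda>x. g (f x)" Z] unfolding compose_def by blast
qed

lemma contraction_id: "complete_contraction V V (\<lambda>x. x)"
  unfolding complete_contraction_def using map_mat_id'[of _ _ V "\<lambda>x. x"] by fastforce

lemma is_category_OS: "is_category (OS :: ('u opspace, 'u \<Rightarrow> 'u) category)"
  unfolding is_category_def
proof (intro conjI ballI)
  fix A :: "'u opspace" assume A: "A \<in> Obj OS"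
  have "(\<lambda>x. x) \<in> lin A A" by (simp add: lin_iff)
  from Hom_restrict[OF this contraction_id Obj_vsp[OF A]]
  show "Ident OS A \<in> Hom OS A A" by (simp add: OS_simps(3))
next
  fix A B D :: "'u opspace" and f g
  assume A: "A \<in> Obj OS" and f: "f \<in> Hom OS A B" and g: "g \<in> Hom OS B D"
  show "Comp OS A B D g f \<in> Hom OS A D"
    using Hom_compose[OF f g Obj_vsp[OF A]] by (simp add: OS_simps(4))
next
  fix A B :: "'u opspace" and f
  assume f: "f \<in> Hom OS A B"
  note F = HomD(1)[OF f] linD(1)[OF HomD(2)[OF f]]
  show "Comp OS A A B f (Ident OS A) = f"
    using F by (intro extensionalityI[of _ "carrier A"]) (auto simp: OS_simps compose_def)
  show "Comp OS A B B (Ident OS B) f = f"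
    using F by (intro extensionalityI[of _ "carrier A"]) (auto simp: OS_simps compose_def)
next
  fix A B D E :: "'u opspace" and f g h
  assume f: "f \<in> Hom OS A B"
  show "Comp OS A B E (Comp OS B D E h g) f = Comp OS A D E h (Comp OS A B D g f)"
    using linD(1)[OF HomD(2)[OF f]] by (auto simp: OS_simps compose_def intro!: restrict_ext)
qed

section \<open>Cocompleteness\<close>

text \<open>The situation produced by \<open>realize\<close>: \<open>V\<close> may be merely
  seminormed, and \<open>u\<close> is its quotient map onto an operator space.\<close>

locale isometric_surj = V: ruan V + W: os W
  for V :: "'a opspace" and W :: "'b opspace" +
  fixes u
  assumes lin: "u \<in> lin V W" and surj: "u ` carrier V = carrier W"
    and isometric: "\<And>n x. n \<ge> 1 \<Longrightarrow> x \<in> mats n V \<Longrightarrow> mnorm W (map_mat u x) = mnorm V x"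
begin

lemma hom: "vsp_hom V W u"
  by (simp add: vsp_hom_def vsp_hom_axioms_def V.vsp_axioms W.vsp_axioms lin)

lemma contraction: "complete_contraction V W u"
  by (simp add: complete_contraction_def isometric)

lemma vdist_eq:
  assumes "x \<in> carrier V" "y \<in> carrier V"
  shows "vdist W (u x) (u y) = vdist V x y"
proof -
  have "x \<ominus>\<^bsub>V\<^esub> y \<in> carrier V" using assms by simp
  then show ?thesis
    using isometric[OF _ V.mat1_in, of "x \<ominus>\<^bsub>V\<^esub> y"] map_mat1[of u "x \<ominus>\<^bsub>V\<^esub> y"] vsp_hom.u_minus[OF hom assms]
    by (simp add: vdist_def vnorm_def)
qed

lemma gens_image:
  assumes "gens V K d"
  shows "gens W K (\<lambda>k. u (d k))"
  unfolding gens_def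
proof
  have d: "d ` K \<subseteq> carrier V" using assms by (simp add: gens_def)
  show "(\<lambda>k. u (d k)) ` K \<subseteq> carrier W" using d linD(1)[OF lin] by auto
  show "carrier W \<subseteq> cspan W K (\<lambda>k. u (d k))"
  proof
    fix w assume w: "w \<in> carrier W"
    then obtain x where x: "x \<in> carrier V" "w = u x" using surj by auto
    have "\<exists>p\<in>qlists K. vdist W w (lc W (\<lambda>k. u (d k)) p) < e" if "e > 0" for e
    proof -
      obtain p where p: "p \<in> qlists K" "vdist V x (lc V d p) < e"
        using assms x(1) \<open>e > 0\<close> unfolding gens_def cspan_def by blast
      have p': "p \<in> lists (UNIV \<times> K)" using p(1) qlists_subset by blast
      have "lc W (\<lambda>k. u (d k)) p = u (lc V d p)"
        using vsp_hom.lc_hom[OF hom d p'] by simp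
      then have "vdist W w (lc W (\<lambda>k. u (d k)) p) < e"
        using vdist_eq[OF x(1) V.lc_in[OF d p']] p(2) x(2) by simp
      then show ?thesis using p(1) by blast
    qed
    then show "w \<in> cspan W K (\<lambda>k. u (d k))" using w by (simp add: cspan_def)
  qed
qed

text \<open>Points with the same image under \<open>u\<close> are at distance 0, and a complete
  contraction into a definite space identifies such points. Norm bounds descend because
  \<open>u\<close> is isometric on matrices.\<close>

lemma factor:
  assumes Z: "os Z" and g: "g \<in> lin V Z" "complete_contraction V Z g"
  obtains h where "h \<in> lin W Z" "complete_contraction W Z h" "\<And>x. x \<in> carrier V \<Longrightarrow> h (u x) = g x"
proof -
  interpret Z: os Z by fact
  let ?s = "inv_into (carrier V) u"
  have s: "?s w \<in> carrier V" "u (?s w) = w" if "w \<in> carrier W" for w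
    using that surj by (auto simp: inv_into_into f_inv_into_f)
  have g_eq: "g x = g y" if xy: "x \<in> carrier V" "y \<in> carrier V" and "u x = u y" for x y
  proof (rule Z.vdist_0)
    have "vdist V x y = 0"
      using vdist_eq[OF xy] that W.vdist_self[of "u y"] linD(1)[OF lin] by simp
    then show "vdist Z (g x) (g y) = 0"
      using vdist_contraction[OF g(2) V.vsp_axioms Z.vsp_axioms g(1) xy]
        Z.vdist_nonneg[of "g x" "g y"] linD(1)[OF g(1)] xy by simp
  qed (use linD(1)[OF g(1)] xy in auto)
  define h where "h w = g (?s w)" for w
  have hu: "h (u x) = g x" if "x \<in> carrier V" for x
    unfolding h_def using that s linD(1)[OF lin] by (intro g_eq) auto
  show thesis
  proof
    show "h \<in> lin W Z"
      unfolding lin_iff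
    proof (intro conjI ballI allI)
      fix w assume w: "w \<in> carrier W"
      show "h w \<in> carrier Z" unfolding h_def using s[OF w] linD(1)[OF g(1)] by simp
    next
      fix w w' assume w: "w \<in> carrier W" and w': "w' \<in> carrier W"
      have "h (w \<oplus>\<^bsub>W\<^esub> w') = h (u (?s w \<oplus>\<^bsub>V\<^esub> ?s w'))"
        using s[OF w] s[OF w'] by (simp add: linD(2)[OF lin])
      then show "h (w \<oplus>\<^bsub>W\<^esub> w') = h w \<oplus>\<^bsub>Z\<^esub> h w'"
        using s[OF w] s[OF w'] hu[of "?s w \<oplus>\<^bsub>V\<^esub> ?s w'"] by (simp add: linD(2)[OF g(1)] h_def)
    next
      fix a w assume w: "w \<in> carrier W"
      have "h (a \<odot>\<^bsub>W\<^esub> w) = h (u (a \<odot>\<^bsub>V\<^esub> ?s w))"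
        using s[OF w] by (simp add: linD(3)[OF lin])
      then show "h (a \<odot>\<^bsub>W\<^esub> w) = a \<odot>\<^bsub>Z\<^esub> h w"
        using s[OF w] hu[of "a \<odot>\<^bsub>V\<^esub> ?s w"] by (simp add: linD(3)[OF g(1)] h_def)
    qed
    show "complete_contraction W Z h"
      unfolding complete_contraction_def
    proof (intro allI impI ballI)
      fix n x assume n: "1 \<le> n" and x: "x \<in> mats n W"
      have sx: "map_mat ?s x \<in> mats n V" using s(1) by (rule mats_map[OF x])
      have "map_mat u (map_mat ?s x) = x"
        unfolding map_mat_comp' by (rule map_mat_id'[OF x s(2)])
      then have "mnorm V (map_mat ?s x) = mnorm W x"
        using isometric[OF n sx] by simp
      moreover have "map_mat h x = map_mat g (map_mat ?s x)"
        by (simp add: map_mat_comp' h_def[abs_def])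
      ultimately show "mnorm Z (map_mat h x) \<le> mnorm W x"
        using g(2) n sx unfolding complete_contraction_def by metis
    qed
  qed (rule hu)
qed

end

lemma Comp_OS_D: "Comp OS V W Z g f = h \<Longrightarrow> x \<in> carrier V \<Longrightarrow> g (f x) = h x"
  by (auto simp: OS_simps compose_def)

lemma coconeD:
  assumes "is_cocone J OS F L c"
  shows "L \<in> Obj OS" "\<And>i. i \<in> Obj J \<Longrightarrow> c i \<in> Hom OS (fobj F i) L"
    "\<And>i j a x. i \<in> Obj J \<Longrightarrow> j \<in> Obj J \<Longrightarrow> a \<in> Hom J i j \<Longrightarrow> x \<in> carrier (fobj F i) \<Longrightarrow>
      c j (farr F i j a x) = c i x"
proof -
  show "L \<in> Obj OS" "\<And>i. i \<in> Obj J \<Longrightarrow> c i \<in> Hom OS (fobj F i) L"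
    using assms by (auto simp: is_cocone_def)
  fix i j a x assume *: "i \<in> Obj J" "j \<in> Obj J" "a \<in> Hom J i j" "x \<in> carrier (fobj F i)"
  then have "Comp OS (fobj F i) (fobj F j) L (c j) (farr F i j a) = c i"
    using assms by (simp add: is_cocone_def)
  then show "c j (farr F i j a x) = c i x"
    using *(4) by (rule Comp_OS_D)
qed

lemma coconeI:
  assumes "L \<in> Obj OS" "\<And>i. i \<in> Obj J \<Longrightarrow> c i \<in> Hom OS (fobj F i) L"
    "\<And>i j a x. i \<in> Obj J \<Longrightarrow> j \<in> Obj J \<Longrightarrow> a \<in> Hom J i j \<Longrightarrow> x \<in> carrier (fobj F i) \<Longrightarrow>
      c j (farr F i j a x) = c i x"
  shows "is_cocone J OS F L c"
  unfolding is_cocone_def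
proof (intro conjI ballI)
  fix i j a assume *: "i \<in> Obj J" "j \<in> Obj J" "a \<in> Hom J i j"
  show "Comp OS (fobj F i) (fobj F j) L (c j) (farr F i j a) = c i"
    using assms(3)[OF *] HomD(1)[OF assms(2)[OF *(1)]]
    by (intro extensionalityI[of _ "carrier (fobj F i)"]) (auto simp: OS_simps compose_def)
qed (use assms in auto)

lemma functorD:
  assumes "is_functor J OS F"
  shows "i \<in> Obj J \<Longrightarrow> fobj F i \<in> Obj OS"
    "i \<in> Obj J \<Longrightarrow> j \<in> Obj J \<Longrightarrow> a \<in> Hom J i j \<Longrightarrow> farr F i j a \<in> Hom OS (fobj F i) (fobj F j)"
  using assms by (auto simp: is_functor_def)

context univ
begin

lemma small_type: "small TYPE('u) A \<longleftrightarrow> small U A"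
  by (simp add: small_def)

theorem cocomplete_OS: "cocomplete TYPE('u) (OS :: ('u opspace, 'u \<Rightarrow> 'u) category)"
  unfolding cocomplete_def
proof (intro allI impI)
  fix J :: "('u, 'u) category" and F :: "('u, 'u, 'u opspace, 'u \<Rightarrow> 'u) functor_data"
  assume "small_category TYPE('u) J \<and> is_functor J OS F"
  then have J: "small U (Obj J)" and F: "is_functor J OS F"
    by (auto simp: small_category_def small_type)
  \<comment> \<open>All cocones with vertex an object of \<open>OS\<close>. This index set need not
    be small; smallness is recovered for the closed span in the product.\<close>
  define K where "K = {(L, c). is_cocone J OS F L c}"
  define P where "P = linf K fst"
  define G where "G = (SIGMA i : Obj J. carrier (fobj F i))"
  \<comment> \<open>The value of \<open>x\<close> under every cocone at once. Contractivity of the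
    legs bounds this family by the norm of \<open>x\<close>, so it lies in the bounded
    product.\<close>
  define e where "e i x = (\<lambda>k\<in>K. snd k i x)" for i x
  define d where "d = (\<lambda>(i, x). e i x)"
  have Kcone: "is_cocone J OS F (fst k) (snd k)" if "k \<in> K" for k
    using that by (auto simp: K_def)
  have Kos: "os (fst k)" if "k \<in> K" for k
    using coconeD(1)[OF Kcone[OF that]] by (rule Obj_os)
  interpret P: os P unfolding P_def by (rule os_linf[OF Kos])
  have vF: "vsp (fobj F i)" if "i \<in> Obj J" for i
    using functorD(1)[OF F that] by (rule Obj_vsp)
  note Khom = HomD[OF coconeD(2)[OF Kcone]]
  have eP: "e i x \<in> carrier P" if i: "i \<in> Obj J" and x: "x \<in> carrier (fobj F i)" for i x
  proof -
    have "vnorm (fst k) (snd k i x) \<le> vnorm (fobj F i) x" if "k \<in> K" for k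
      by (rule vnorm_contraction[OF Khom(3)[OF that i] vF[OF i] x])
    then have "bdd_above ((\<lambda>k. vnorm (fst k) (e i x k)) ` K)"
      by (intro bdd_aboveI2[of _ _ "vnorm (fobj F i) x"]) (simp add: e_def)
    then show ?thesis
      using linD(1)[OF Khom(2)] i x by (simp add: P_def carrier_linf e_def)
  qed
  have dG: "d ` G \<subseteq> carrier P" using eP by (auto simp: d_def G_def)
  define L0 where "L0 = sub_os P (cspan P G d)"
  interpret L0: os L0 unfolding L0_def by (rule P.os_cspan(1)[OF dG])
  have gens0: "gens L0 G d" unfolding L0_def by (rule P.gens_cspan[OF dG])
  have "small U G"
    unfolding G_def using functorD(1)[OF F] by (intro small_Sigma J) (simp add: OS_simps small_type)
  \<comment> \<open>The labelling is the identity: the closed span is already definite and small,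
    and only its type has to change.\<close>
  then have sm: "small U ((\<lambda>x. x) ` carrier L0)"
    unfolding L0_def using small_cspan[OF P.os_axioms dG] by simp
  obtain W :: "'u opspace" and u where W: "os W" "small U (carrier W)"
    and u: "u \<in> lin L0 W" "u ` carrier L0 = carrier W"
      "\<And>n x. n \<ge> 1 \<Longrightarrow> x \<in> mats n L0 \<Longrightarrow> mnorm W (map_mat u x) = mnorm L0 x"
    by (rule realize[OF L0.ruan_axioms L0.complete sm]) auto
  interpret Q: isometric_surj L0 W u
    using W(1) u by (simp add: isometric_surj_def isometric_surj_axioms_def L0.ruan_axioms)
  have WO: "W \<in> Obj OS" using W by (simp add: OS_simps os_iff small_type)
  have L0simps: "carrier L0 = cspan P G d" "add L0 = add P" "smult L0 = smult P" "mnorm L0 = mnorm P"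
    by (simp_all add: L0_def)
  have matsP: "x \<in> mats n P" if "x \<in> mats n L0" for x n
    using that P.cspan_subset[OF dG] by (auto simp: in_mats L0simps)
  have e_in: "e i x \<in> carrier L0" if "i \<in> Obj J" "x \<in> carrier (fobj F i)" for i x
    using P.cspan_gen[OF dG, of "(i, x)"] that by (auto simp: L0simps G_def d_def)
  have e_lin: "e i \<in> lin (fobj F i) L0" if i: "i \<in> Obj J" for i
    using e_in[OF i] linD(2,3)[OF Khom(2)[OF _ i]]
    by (auto simp: lin_iff L0simps P_def linf_def prod_os_def e_def intro!: restrict_ext)
  have e_contr: "complete_contraction (fobj F i) L0 (e i)" if i: "i \<in> Obj J" for i
    unfolding complete_contraction_def
  proof (intro allI impI ballI)
    fix n x assume n: "1 \<le> n" and x: "x \<in> mats n (fobj F i)"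
    have "mnorm (fst k) (map_mat (\<lambda>f. f k) (map_mat (e i) x)) \<le> mnorm (fobj F i) x" if k: "k \<in> K" for k
    proof -
      have "map_mat (\<lambda>f. f k) (map_mat (e i) x) = map_mat (snd k i) x"
        unfolding map_mat_comp' using k by (simp add: e_def)
      then show ?thesis
        using Khom(3)[OF k i] n x by (simp add: complete_contraction_def)
    qed
    moreover have "mnorm L0 (map_mat (e i) x) =
        Sup0 K (\<lambda>k. mnorm (fst k) (map_mat (\<lambda>f. f k) (map_mat (e i) x)))"
      by (simp add: L0simps P_def linf_norm)
    ultimately show "mnorm L0 (map_mat (e i) x) \<le> mnorm (fobj F i) x"
      using ruan.norm_nonneg[OF _ n x] functorD(1)[OF F i, THEN Obj_os]
      by (auto simp: os_def intro!: Sup0_least)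
  qed
  define c where "c i = (\<lambda>x\<in>carrier (fobj F i). u (e i x))" for i
  have c_Hom: "c i \<in> Hom OS (fobj F i) W" if i: "i \<in> Obj J" for i
    unfolding c_def
    by (intro Hom_restrict lin_compose[OF e_lin[OF i] u(1)] vF[OF i]
        contraction_compose[OF e_lin[OF i] e_contr[OF i] Q.contraction])
  have cocone: "is_cocone J OS F W c"
  proof (rule coconeI[OF WO c_Hom])
    fix i j a x assume *: "i \<in> Obj J" "j \<in> Obj J" "a \<in> Hom J i j" "x \<in> carrier (fobj F i)"
    have "e j (farr F i j a x) = e i x"
      unfolding e_def using coconeD(3)[OF Kcone *] by (intro restrict_ext) simp
    then show "c j (farr F i j a x) = c i x"
      using *(4) linD(1)[OF HomD(2)[OF functorD(2)[OF F *(1-3)]] *(4)] by (simp add: c_def)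
  qed
  have gensW: "gens W G (\<lambda>g. u (d g))" by (rule Q.gens_image[OF gens0])
  have "\<exists>!h. h \<in> Hom OS W L' \<and> (\<forall>i\<in>Obj J. Comp OS (fobj F i) W L' h (c i) = c' i)"
    if cone': "is_cocone J OS F L' c'" for L' c'
  proof -
    let ?k = "(L', c')"
    have k: "?k \<in> K" using cone' by (simp add: K_def)
    have L': "os L'" using Kos[OF k] by simp
    \<comment> \<open>The given cocone is itself one of the indices, so the comparison map comes
      from the projection to that coordinate.\<close>
    have "(\<lambda>f. f ?k) \<in> lin P (fst ?k)"
      unfolding P_def by (rule linf_proj[OF Kos k])
    then have prl: "(\<lambda>f. f ?k) \<in> lin L0 L'"
      unfolding lin_iff L0simps using subsetD[OF P.cspan_subset[OF dG]] by simp
    have prc: "complete_contraction L0 L' (\<lambda>f. f ?k)"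
      unfolding complete_contraction_def
    proof (intro allI impI ballI)
      fix n x assume "1 \<le> n" "x \<in> mats n L0"
      then have "mnorm (fst ?k) (map_mat (\<lambda>f. f ?k) x) \<le> mnorm (linf K fst) x"
        using matsP[of x n] by (intro linf_norm_upper[OF Kos _ _ k]) (auto simp: P_def)
      then show "mnorm L' (map_mat (\<lambda>f. f ?k) x) \<le> mnorm L0 x"
        by (simp add: L0simps P_def)
    qed
    obtain h where h: "h \<in> lin W L'" "complete_contraction W L' h" "\<And>x. x \<in> carrier L0 \<Longrightarrow> h (u x) = x ?k"
      by (rule Q.factor[OF L' prl prc]) auto
    have hc: "h (c i x) = c' i x" if "i \<in> Obj J" "x \<in> carrier (fobj F i)" for i x
      using h(3)[OF e_in[OF that]] that k by (simp add: c_def e_def)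
    show ?thesis
    proof (rule ex1I[of _ "restrict h (carrier W)"], intro conjI ballI)
      show "restrict h (carrier W) \<in> Hom OS W L'"
        by (rule Hom_restrict[OF h(1,2) Obj_vsp[OF WO]])
      fix i assume i: "i \<in> Obj J"
      show "Comp OS (fobj F i) W L' (restrict h (carrier W)) (c i) = c' i"
        using hc[OF i] HomD(1)[OF coconeD(2)[OF cone' i]] linD(1)[OF HomD(2)[OF c_Hom[OF i]]]
        by (intro extensionalityI[of _ "carrier (fobj F i)"]) (auto simp: OS_simps compose_def)
    next
      fix g assume g: "g \<in> Hom OS W L' \<and> (\<forall>i\<in>Obj J. Comp OS (fobj F i) W L' g (c i) = c' i)"
      have gc: "g (c i x) = c' i x" if "i \<in> Obj J" "x \<in> carrier (fobj F i)" for i x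
        using g that Comp_OS_D[of "fobj F i" W L' g "c i" "c' i" x] by blast
      show "g = restrict h (carrier W)"
      proof (rule extensionalityI[of _ "carrier W"])
        fix w assume w: "w \<in> carrier W"
        \<comment> \<open>The images of the legs generate \<open>W\<close>, and both maps are
          prescribed there by the cocone.\<close>
        have "g w = h w"
        proof (rule hom_eq_on_gens[OF W(1) L' gensW _ _ h(1,2) _ w])
          show "g \<in> lin W L'" "complete_contraction W L' g" using g HomD by blast+
          fix ix assume ix: "ix \<in> G"
          obtain i x where "ix = (i, x)" "i \<in> Obj J" "x \<in> carrier (fobj F i)"
            using ix by (auto simp: G_def)
          then show "g (u (d ix)) = h (u (d ix))"
            using gc[of i x] hc[of i x] by (simp add: c_def d_def)
        qed
        then show "g w = restrict h (carrier W) w" using w by simp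
      qed (use g HomD(1) in auto)
    qed
  qed
  then show "\<exists>L c. is_colimit J OS F L c"
    using cocone unfolding is_colimit_def by blast
qed

end

section \<open>Countably directed colimits\<close>

locale directed_system = univ U for U :: "'u itself" +
  fixes I :: "'u set" and r :: "'u rel" and F :: "('u, 'u \<times> 'u, 'u opspace, 'u \<Rightarrow> 'u) functor_data"
  assumes small_I: "small U I" and directed: "countably_directed I r"
    and F: "is_functor (poset_category I r) OS F"
begin

abbreviation X where "X i \<equiv> fobj F i"
abbreviation T where "T i j \<equiv> farr F i j (i, j)"

lemma r_refl: "i \<in> I \<Longrightarrow> (i, i) \<in> r"
  and r_trans: "(i, j) \<in> r \<Longrightarrow> (j, k) \<in> r \<Longrightarrow> (i, k) \<in> r"
  and r_I: "(i, j) \<in> r \<Longrightarrow> i \<in> I \<and> j \<in> I"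
  using directed partial_order_onD[of I r]
  by (auto simp: countably_directed_def refl_on_def dest: transD)

lemma upper: "countable S \<Longrightarrow> S \<subseteq> I \<Longrightarrow> \<exists>u\<in>I. \<forall>s\<in>S. (s, u) \<in> r"
  using directed by (simp add: countably_directed_def)

lemma poset_simps:
  "Obj (poset_category I r) = I" "Hom (poset_category I r) i j = {(i, j)} \<inter> r"
  "Ident (poset_category I r) i = (i, i)" "Comp (poset_category I r) i j k b a = (i, k)"
  by (simp_all add: poset_category_def)

lemma X_Obj: "i \<in> I \<Longrightarrow> X i \<in> Obj OS"
  using functorD(1)[OF F] by (simp add: poset_simps)

lemma X_os: "i \<in> I \<Longrightarrow> os (X i)" and X_vsp: "i \<in> I \<Longrightarrow> vsp (X i)"
  and X_ruan: "i \<in> I \<Longrightarrow> ruan (X i)"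
  using X_Obj[of i] Obj_os Obj_vsp by (auto simp: os_def)

lemma T_Hom: "(i, j) \<in> r \<Longrightarrow> T i j \<in> Hom OS (X i) (X j)"
  using functorD(2)[OF F] r_I by (simp add: poset_simps)

lemmas T_lin = HomD(2)[OF T_Hom] and T_contr = HomD(3)[OF T_Hom]
lemmas T_in = linD(1)[OF T_lin]

lemma T_hom: "(i, j) \<in> r \<Longrightarrow> vsp_hom (X i) (X j) (T i j)"
  using T_lin r_I X_vsp by (simp add: vsp_hom_def vsp_hom_axioms_def)

lemma T_trans:
  assumes "(i, j) \<in> r" "(j, k) \<in> r" "x \<in> carrier (X i)"
  shows "T j k (T i j x) = T i k x"
proof -
  have *: "i \<in> I" "j \<in> I" "k \<in> I" using assms r_I by auto
  have "farr F i k (Comp (poset_category I r) i j k (j, k) (i, j)) =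
      Comp OS (X i) (X j) (X k) (T j k) (T i j)"
    using F * assms(1,2) unfolding is_functor_def poset_simps by blast
  then have "Comp OS (X i) (X j) (X k) (T j k) (T i j) = T i k" by (simp add: poset_simps)
  then show ?thesis using assms(3) by (rule Comp_OS_D)
qed

text \<open>Truth at all sufficiently late stages. The sets of such stages form a proper filter,
  closed under countable intersections by countable directedness.\<close>

definition ev :: "('u \<Rightarrow> bool) \<Rightarrow> bool" where
  "ev P \<longleftrightarrow> (\<exists>i\<in>I. \<forall>j. (i, j) \<in> r \<longrightarrow> P j)"

lemma evI: "i \<in> I \<Longrightarrow> (\<And>j. (i, j) \<in> r \<Longrightarrow> P j) \<Longrightarrow> ev P"
  by (auto simp: ev_def)

text \<open>A witness stage is chosen for each condition; these countably many stages have an upper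
  bound.\<close>

lemma ev_all_countable:
  assumes "countable S" "\<And>s. s \<in> S \<Longrightarrow> ev (P s)"
  shows "ev (\<lambda>j. \<forall>s\<in>S. P s j)"
proof -
  obtain i where i: "\<And>s. s \<in> S \<Longrightarrow> i s \<in> I" "\<And>s j. s \<in> S \<Longrightarrow> (i s, j) \<in> r \<Longrightarrow> P s j"
    using assms(2) unfolding ev_def by metis
  obtain u where "u \<in> I" "\<And>s. s \<in> S \<Longrightarrow> (i s, u) \<in> r"
    using upper[of "i ` S"] assms(1) i(1) by auto
  then show ?thesis using i(2) r_trans by (intro evI) blast+
qed

lemma ev_conj: "ev P \<Longrightarrow> ev Q \<Longrightarrow> ev (\<lambda>j. P j \<and> Q j)"
proof -
  assume "ev P" "ev Q"
  then have "ev (\<lambda>j. \<forall>R\<in>{P, Q}. R j)"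
    by (intro ev_all_countable) auto
  then show ?thesis by simp
qed

lemma ev_mono: "ev P \<Longrightarrow> (\<And>j. j \<in> I \<Longrightarrow> P j \<Longrightarrow> Q j) \<Longrightarrow> ev Q"
  using r_I unfolding ev_def by blast

lemma ev_ge: "i \<in> I \<Longrightarrow> ev (\<lambda>j. (i, j) \<in> r)"
  by (rule evI)

lemma ev_ex: "ev P \<Longrightarrow> \<exists>j\<in>I. P j"
  unfolding ev_def using r_refl by blast

lemma ev_ex_ge: "ev P \<Longrightarrow> i \<in> I \<Longrightarrow> \<exists>j. (i, j) \<in> r \<and> P j"
  using ev_ex[OF ev_conj[OF ev_ge[of i], of P]] by blast

lemma ev_unique: "ev (\<lambda>j. g j = a) \<Longrightarrow> ev (\<lambda>j. g j = b) \<Longrightarrow> a = b"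
  using ev_ex[OF ev_conj, of "\<lambda>j. g j = a" "\<lambda>j. g j = b"] by blast

text \<open>Countably many stages with values below the infimum plus \<open>1 / (n + 1)\<close> have
  a common upper bound, from which on the infimum is attained. Over a merely directed poset the net
  would only converge.\<close>

lemma ev_antimono_const:
  fixes g :: "'u \<Rightarrow> real"
  assumes "ev (\<lambda>j. \<forall>k. (j, k) \<in> r \<longrightarrow> g k \<le> g j)" and nn: "\<And>j. j \<in> I \<Longrightarrow> 0 \<le> g j"
  shows "\<exists>v. ev (\<lambda>j. g j = v)"
proof -
  obtain i where i: "i \<in> I" and anti: "\<And>j k. (i, j) \<in> r \<Longrightarrow> (j, k) \<in> r \<Longrightarrow> g k \<le> g j"
    using assms(1) by (auto simp: ev_def)
  define A where "A = {j. (i, j) \<in> r}"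
  define v where "v = Inf (g ` A)"
  have bdd: "bdd_below (g ` A)"
    using nn r_I by (intro bdd_belowI2[of _ 0]) (auto simp: A_def)
  have ne: "A \<noteq> {}" using r_refl[OF i] by (auto simp: A_def)
  have "\<exists>j\<in>A. g j < v + 1 / real (Suc n)" for n
    using cInf_lessD[of "g ` A" "v + 1 / real (Suc n)"] ne by (auto simp: v_def)
  then obtain j where j: "\<And>n. j n \<in> A" "\<And>n. g (j n) < v + 1 / real (Suc n)" by metis
  obtain u where u: "u \<in> I" "\<And>n. (j n, u) \<in> r"
    using upper[of "range j"] j(1) r_I by (auto simp: A_def)
  have "g k = v" if k: "(u, k) \<in> r" for k
  proof (rule antisym)
    show "g k \<le> v"
    proof (rule field_le_epsilon)
      fix e :: real assume "e > 0"
      then obtain n where "1 / real (Suc n) < e" by (rule nat_approx_posE)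
      moreover have "g k \<le> g (j n)"
        using anti[of "j n" k] j(1)[of n] r_trans[OF u(2) k, of n] by (simp add: A_def)
      ultimately show "g k \<le> v + e" using j(2)[of n] by simp
    qed
    have "k \<in> A" using j(1)[of 0] u(2)[of 0] k r_trans unfolding A_def by blast
    then show "v \<le> g k" unfolding v_def using bdd by (intro cInf_lower) auto
  qed
  then show ?thesis using u(1) by (intro exI evI)
qed

definition coh :: "('u \<Rightarrow> 'u) \<Rightarrow> 'u \<Rightarrow> bool" where
  "coh f i \<longleftrightarrow> (\<forall>j. (i, j) \<in> r \<longrightarrow> f j = T i j (f i))"

text \<open>Coherence is asked for only from some stage on, which leaves room for extending an
  element of one stage by 0 at the indices not above it.\<close>

definition S :: "('u \<Rightarrow> 'u) set" where
  "S = {f \<in> \<Pi>\<^sub>E i\<in>I. carrier (X i). ev (coh f)}"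

text \<open>Well defined on square matrices over \<open>S\<close> of positive size, by
  \<open>ev_limnorm\<close>. It ignores early stages, so it is only a seminorm.\<close>

definition limnorm :: "('u \<Rightarrow> 'u) mat \<Rightarrow> real" where
  "limnorm x = (THE v. ev (\<lambda>j. mnorm (X j) (map_mat (\<lambda>f. f j) x) = v))"

definition M where "M = prod_os I X S limnorm"

lemma S_in: "f \<in> S \<Longrightarrow> i \<in> I \<Longrightarrow> f i \<in> carrier (X i)"
  by (auto simp: S_def)

lemma S_coh: "f \<in> S \<Longrightarrow> ev (coh f)"
  by (simp add: S_def)

lemma M_simps:
  "carrier M = S" "mnorm M = limnorm" "zero M = (\<lambda>k\<in>I. \<zero>\<^bsub>X k\<^esub>)"
  "add M = (\<lambda>f g. \<lambda>k\<in>I. f k \<oplus>\<^bsub>X k\<^esub> g k)" "smult M = (\<lambda>c f. \<lambda>k\<in>I. c \<odot>\<^bsub>X k\<^esub> f k)"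
  by (simp_all add: M_def prod_os_def)

lemma vsp_M: "vsp M"
  unfolding M_def
proof (rule vsp_prod_os[OF X_vsp])
  show "S \<subseteq> (\<Pi>\<^sub>E i\<in>I. carrier (X i))" by (auto simp: S_def)
  \<comment> \<open>An upper bound of the empty set: the index set is not empty.\<close>
  obtain i where "i \<in> I" using upper[of "{}"] by auto
  then have "ev (coh (\<lambda>k\<in>I. \<zero>\<^bsub>X k\<^esub>))"
    using r_I vsp_hom.u_zero[OF T_hom] by (intro evI) (auto simp: coh_def)
  then show "(\<lambda>k\<in>I. \<zero>\<^bsub>X k\<^esub>) \<in> S"
    using abelian_groupE(2)[OF vsp_abelian_group[OF X_vsp]] by (auto simp: S_def)
next
  fix f g assume f: "f \<in> S" and g: "g \<in> S"
  have "ev (coh (\<lambda>k\<in>I. f k \<oplus>\<^bsub>X k\<^esub> g k))"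
    using ev_conj[OF S_coh[OF f] S_coh[OF g]]
  proof (rule ev_mono)
    fix j assume "j \<in> I" "coh f j \<and> coh g j"
    then show "coh (\<lambda>k\<in>I. f k \<oplus>\<^bsub>X k\<^esub> g k) j"
      using r_I linD(2)[OF T_lin] S_in[OF f] S_in[OF g] by (auto simp: coh_def)
  qed
  then show "(\<lambda>k\<in>I. f k \<oplus>\<^bsub>X k\<^esub> g k) \<in> S"
    using abelian_groupE(1)[OF vsp_abelian_group[OF X_vsp]] S_in f g by (auto simp: S_def)
next
  fix c f assume f: "f \<in> S"
  have "ev (coh (\<lambda>k\<in>I. c \<odot>\<^bsub>X k\<^esub> f k))"
    using S_coh[OF f]
  proof (rule ev_mono)
    fix j assume "j \<in> I" "coh f j"
    then show "coh (\<lambda>k\<in>I. c \<odot>\<^bsub>X k\<^esub> f k) j"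
      using r_I linD(3)[OF T_lin] S_in[OF f] by (auto simp: coh_def)
  qed
  then show "(\<lambda>k\<in>I. c \<odot>\<^bsub>X k\<^esub> f k) \<in> S"
    using vsp.smult_in[OF X_vsp] S_in f by (auto simp: S_def)
qed

lemma M_proj: "j \<in> I \<Longrightarrow> (\<lambda>f. f j) \<in> lin M (X j)"
  unfolding M_def by (rule prod_os_proj) (auto simp: S_def)

lemma M_proj_hom: "j \<in> I \<Longrightarrow> vsp_hom M (X j) (\<lambda>f. f j)"
  using M_proj vsp_M X_vsp by (simp add: vsp_hom_def vsp_hom_axioms_def)

lemma ev_coh_mat:
  assumes "x \<in> mats n M"
  shows "ev (\<lambda>i. \<forall>k<n. \<forall>l<n. coh (x $$ (k, l)) i)"
proof -
  have "ev (\<lambda>i. \<forall>kl\<in>{..<n} \<times> {..<n}. coh (x $$ kl) i)"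
    using matsD(3)[OF assms] S_coh by (intro ev_all_countable) (auto simp: M_simps)
  then show ?thesis by (rule ev_mono) auto
qed

text \<open>Once the finitely many entries are coherent, later matrices are images of earlier ones
  under completely contractive transition maps, so the norms decrease and
  \<open>ev_antimono_const\<close> applies.\<close>

lemma ev_limnorm:
  assumes n: "n \<ge> 1" and x: "x \<in> mats n M"
  shows "ev (\<lambda>j. mnorm (X j) (map_mat (\<lambda>f. f j) x) = limnorm x)"
proof -
  note xj = vsp_hom.map_in[OF M_proj_hom x]
  have "\<exists>v. ev (\<lambda>j. mnorm (X j) (map_mat (\<lambda>f. f j) x) = v)"
  proof (rule ev_antimono_const)
    show "ev (\<lambda>j. \<forall>k. (j, k) \<in> r \<longrightarrow> mnorm (X k) (map_mat (\<lambda>f. f k) x) \<le> mnorm (X j) (map_mat (\<lambda>f. f j) x))"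
      using ev_coh_mat[OF x]
    proof (rule ev_mono, intro allI impI)
      fix j k assume c: "\<forall>p<n. \<forall>l<n. coh (x $$ (p, l)) j" and jk: "(j, k) \<in> r"
      have "map_mat (\<lambda>f. f k) x = map_mat (T j k) (map_mat (\<lambda>f. f j) x)"
        using c jk matsD[OF x] by (intro eq_matI) (auto simp: coh_def)
      then show "mnorm (X k) (map_mat (\<lambda>f. f k) x) \<le> mnorm (X j) (map_mat (\<lambda>f. f j) x)"
        using T_contr[OF jk] n xj r_I[OF jk] by (simp add: complete_contraction_def)
    qed
    show "0 \<le> mnorm (X j) (map_mat (\<lambda>f. f j) x)" if "j \<in> I" for j
      using ruan.norm_nonneg[OF X_ruan[OF that] n xj[OF that]] .
  qed
  then obtain v where v: "ev (\<lambda>j. mnorm (X j) (map_mat (\<lambda>f. f j) x) = v)" ..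
  then have "limnorm x = v" unfolding limnorm_def using ev_unique by (intro the_equality) blast+
  then show ?thesis using v by simp
qed

text \<open>Each axiom involves finitely many values of \<open>limnorm\<close>, all attained at a
  common stage \<open>j\<close>, where the axiom for \<open>X j\<close> is read off.\<close>

lemma ruan_M: "ruan M"
proof -
  interpret M: vsp M by (rule vsp_M)
  note hom = M_proj_hom
  note xj = vsp_hom.map_in[OF M_proj_hom]
  show ?thesis
  proof (rule ruanI[OF vsp_M]; unfold M_simps)
    fix n x assume n: "1 \<le> n" and x: "x \<in> mats n M"
    obtain j where "j \<in> I" "mnorm (X j) (map_mat (\<lambda>f. f j) x) = limnorm x"
      using ev_ex[OF ev_limnorm[OF n x]] by blast
    then show "0 \<le> limnorm x" using ruan.norm_nonneg[OF X_ruan n xj[OF _ x], of j] by simp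
  next
    fix n x a assume n: "1 \<le> n" and x: "x \<in> mats n M"
    obtain j where j: "j \<in> I" "mnorm (X j) (map_mat (\<lambda>f. f j) x) = limnorm x"
      "mnorm (X j) (map_mat (\<lambda>f. f j) (mats_smult M a x)) = limnorm (mats_smult M a x)"
      using ev_ex[OF ev_conj[OF ev_limnorm[OF n x] ev_limnorm[OF n M.mats_smult_in[OF x, of a]]]] by blast
    then show "limnorm (mats_smult M a x) = cmod a * limnorm x"
      using ruan.norm_smult[OF X_ruan[OF j(1)] n xj[OF j(1) x], of a] vsp_hom.map_smult[OF hom[OF j(1)] x, of a] by simp
  next
    fix n x y assume n: "1 \<le> n" and x: "x \<in> mats n M" and y: "y \<in> mats n M"
    obtain j where j: "j \<in> I" "mnorm (X j) (map_mat (\<lambda>f. f j) x) = limnorm x"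
      "mnorm (X j) (map_mat (\<lambda>f. f j) y) = limnorm y"
      "mnorm (X j) (map_mat (\<lambda>f. f j) (mats_add M x y)) = limnorm (mats_add M x y)"
      using ev_ex[OF ev_conj[OF ev_limnorm[OF n x] ev_conj[OF ev_limnorm[OF n y]
        ev_limnorm[OF n M.mats_add_in[OF x y]]]]] by blast
    then show "limnorm (mats_add M x y) \<le> limnorm x + limnorm y"
      using ruan.norm_add[OF X_ruan[OF j(1)] n xj[OF j(1) x] xj[OF j(1) y]] vsp_hom.map_add[OF hom[OF j(1)] x y] by simp
  next
    fix m n x y assume m: "1 \<le> m" and n: "1 \<le> n" and x: "x \<in> mats m M" and y: "y \<in> mats n M"
    have mn: "1 \<le> m + n" using m by simp
    obtain j where j: "j \<in> I" "mnorm (X j) (map_mat (\<lambda>f. f j) x) = limnorm x"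
      "mnorm (X j) (map_mat (\<lambda>f. f j) y) = limnorm y"
      "mnorm (X j) (map_mat (\<lambda>f. f j) (mats_dsum M x y)) = limnorm (mats_dsum M x y)"
      using ev_ex[OF ev_conj[OF ev_limnorm[OF m x] ev_conj[OF ev_limnorm[OF n y]
        ev_limnorm[OF mn M.mats_dsum_in[OF x y]]]]] by blast
    then show "limnorm (mats_dsum M x y) = max (limnorm x) (limnorm y)"
      using ruan.norm_dsum[OF X_ruan[OF j(1)] m n xj[OF j(1) x] xj[OF j(1) y]] vsp_hom.map_dsum[OF hom[OF j(1)] x y] by simp
  next
    fix m x and \<alpha> \<beta> :: "complex mat" assume m: "1 \<le> m" and x: "x \<in> mats m M"
      and ab: "\<alpha> \<in> carrier_mat m m" "\<beta> \<in> carrier_mat m m"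
    obtain j where j: "j \<in> I" "mnorm (X j) (map_mat (\<lambda>f. f j) x) = limnorm x"
      "mnorm (X j) (map_mat (\<lambda>f. f j) (mats_sandwich M \<alpha> x \<beta>)) = limnorm (mats_sandwich M \<alpha> x \<beta>)"
      using ev_ex[OF ev_conj[OF ev_limnorm[OF m x] ev_limnorm[OF m M.mats_sandwich_in[OF x ab]]]] by blast
    then show "limnorm (mats_sandwich M \<alpha> x \<beta>) \<le> op_norm \<alpha> * limnorm x * op_norm \<beta>"
      using ruan.norm_sandwich[OF X_ruan[OF j(1)] m xj[OF j(1) x] ab] vsp_hom.map_sandwich[OF hom[OF j(1)] x ab] by simp
  qed
qed

lemma ev_vdist:
  assumes f: "f \<in> S" and g: "g \<in> S"
  shows "ev (\<lambda>j. vdist (X j) (f j) (g j) = vdist M f g)"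
proof -
  interpret M: vsp M by (rule vsp_M)
  have d: "f \<ominus>\<^bsub>M\<^esub> g \<in> carrier M"
    using f g by (intro M.minus_closed) (simp_all add: M_simps(1))
  then have "ev (\<lambda>j. mnorm (X j) (map_mat (\<lambda>f. f j) (mat 1 1 (\<lambda>_. f \<ominus>\<^bsub>M\<^esub> g))) =
      limnorm (mat 1 1 (\<lambda>_. f \<ominus>\<^bsub>M\<^esub> g)))"
    by (intro ev_limnorm mats_mat) auto
  then show ?thesis
  proof (rule ev_mono)
    fix j assume j: "j \<in> I" and *: "mnorm (X j) (map_mat (\<lambda>f. f j) (mat 1 1 (\<lambda>_. f \<ominus>\<^bsub>M\<^esub> g))) =
      limnorm (mat 1 1 (\<lambda>_. f \<ominus>\<^bsub>M\<^esub> g))"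
    have "(f \<ominus>\<^bsub>M\<^esub> g) j = f j \<ominus>\<^bsub>X j\<^esub> g j"
      using vsp_hom.u_minus[OF M_proj_hom[OF j], of f g] f g by (simp add: M_simps(1))
    then show "vdist (X j) (f j) (g j) = vdist M f g"
      using * unfolding map_mat1 by (simp add: vdist_def vnorm_def M_simps(2))
  qed
qed

lemma vdist_M_eq_0:
  assumes "f \<in> S" "g \<in> S" "ev (\<lambda>j. f j = g j)"
  shows "vdist M f g = 0"
proof -
  obtain j where j: "j \<in> I" "vdist (X j) (f j) (g j) = vdist M f g" "f j = g j"
    using ev_ex[OF ev_conj[OF ev_vdist[OF assms(1,2)] assms(3)]] by blast
  then show ?thesis
    using ruan.vdist_self[OF X_ruan[OF j(1)] S_in[OF assms(2) j(1)]] by simp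
qed

text \<open>The map from stage \<open>i\<close> into \<open>M\<close>. The value 0 at indices not
  above \<open>i\<close> is a filler: distances in \<open>M\<close> depend on late stages
  alone.\<close>

definition e where "e i x = (\<lambda>j\<in>I. if (i, j) \<in> r then T i j x else \<zero>\<^bsub>X j\<^esub>)"

lemma e_in: "i \<in> I \<Longrightarrow> x \<in> carrier (X i) \<Longrightarrow> e i x \<in> S"
proof -
  assume i: "i \<in> I" and x: "x \<in> carrier (X i)"
  have "ev (coh (e i x))"
    using i
  proof (rule evI)
    fix j assume ij: "(i, j) \<in> r"
    then show "coh (e i x) j"
      using r_I r_trans[OF ij] T_trans[OF ij _ x] by (auto simp: coh_def e_def)
  qed
  then show ?thesis
    using T_in x abelian_groupE(2)[OF vsp_abelian_group[OF X_vsp]] by (auto simp: S_def e_def)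
qed

lemma e_apply: "(i, j) \<in> r \<Longrightarrow> e i x j = T i j x"
  using r_I by (auto simp: e_def)

lemma e_lin: "i \<in> I \<Longrightarrow> e i \<in> lin (X i) M"
proof -
  assume i: "i \<in> I"
  have z: "\<zero>\<^bsub>X j\<^esub> \<oplus>\<^bsub>X j\<^esub> \<zero>\<^bsub>X j\<^esub> = \<zero>\<^bsub>X j\<^esub>" if "j \<in> I" for j
    using abelian_groupE(2,5)[OF vsp_abelian_group[OF X_vsp[OF that]]] by simp
  show ?thesis
    unfolding lin_iff M_simps
  proof (intro conjI ballI allI)
    show "e i x \<in> S" if "x \<in> carrier (X i)" for x by (rule e_in[OF i that])
    show "e i (x \<oplus>\<^bsub>X i\<^esub> y) = (\<lambda>k\<in>I. e i x k \<oplus>\<^bsub>X k\<^esub> e i y k)"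
      if "x \<in> carrier (X i)" "y \<in> carrier (X i)" for x y
      unfolding e_def using linD(2)[OF T_lin] that z by (intro restrict_ext) auto
    show "e i (a \<odot>\<^bsub>X i\<^esub> x) = (\<lambda>k\<in>I. a \<odot>\<^bsub>X k\<^esub> e i x k)" if "x \<in> carrier (X i)" for a x
      unfolding e_def using linD(3)[OF T_lin] that vsp.smult_zero[OF X_vsp] by (intro restrict_ext) auto
  qed
qed

lemma limnorm_e:
  assumes i: "i \<in> I" and n: "n \<ge> 1" and x: "x \<in> mats n (X i)"
  shows "ev (\<lambda>j. (i, j) \<in> r \<and> mnorm (X j) (map_mat (T i j) x) = limnorm (map_mat (e i) x))"
proof -
  have "map_mat (e i) x \<in> mats n M"
    using e_in[OF i] by (intro mats_map[OF x]) (simp add: M_simps)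
  from ev_conj[OF ev_ge[OF i] ev_limnorm[OF n this]] show ?thesis
  proof (rule ev_mono)
    fix j assume *: "(i, j) \<in> r \<and> mnorm (X j) (map_mat (\<lambda>f. f j) (map_mat (e i) x)) = limnorm (map_mat (e i) x)"
    have "map_mat (\<lambda>f. f j) (map_mat (e i) x) = map_mat (T i j) x"
      unfolding map_mat_comp' using * by (intro map_mat_cong'[OF x]) (simp add: e_apply)
    then show "(i, j) \<in> r \<and> mnorm (X j) (map_mat (T i j) x) = limnorm (map_mat (e i) x)" using * by simp
  qed
qed

lemma e_contr: "i \<in> I \<Longrightarrow> complete_contraction (X i) M (e i)"
  unfolding complete_contraction_def M_simps
proof (intro allI impI ballI)
  fix n x assume i: "i \<in> I" and n: "1 \<le> n" and x: "x \<in> mats n (X i)"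
  obtain j where "(i, j) \<in> r" "mnorm (X j) (map_mat (T i j) x) = limnorm (map_mat (e i) x)"
    using ev_ex[OF limnorm_e[OF i n x]] by blast
  then show "limnorm (map_mat (e i) x) \<le> mnorm (X i) x"
    using T_contr n x by (metis complete_contraction_def)
qed

text \<open>Coherence of all terms and all their mutual distances are countably many conditions, so
  one stage \<open>i\<close> displays them all. The sequence is Cauchy in \<open>X i\<close>, and
  its limit there is carried to \<open>M\<close> by \<open>e i\<close>.\<close>

lemma complete_M: "os_complete M"
proof (rule os_completeI)
  fix s :: "nat \<Rightarrow> _" assume s: "\<And>p. s p \<in> carrier M"
    and C: "\<And>e. e > 0 \<Longrightarrow> \<exists>N. \<forall>p\<ge>N. \<forall>q\<ge>N. vdist M (s p) (s q) < e"
  have sS: "s p \<in> S" for p using s by (simp add: M_simps)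
  have "ev (\<lambda>j. \<forall>p\<in>UNIV. coh (s p) j)"
    by (intro ev_all_countable S_coh sS) simp
  moreover have "ev (\<lambda>j. \<forall>pq\<in>UNIV. vdist (X j) (s (fst pq) j) (s (snd pq) j) = vdist M (s (fst pq)) (s (snd pq)))"
    by (intro ev_all_countable ev_vdist sS) simp
  ultimately obtain i where i: "i \<in> I" and coh: "\<And>p. coh (s p) i"
    and d: "\<And>p q. vdist (X i) (s p i) (s q i) = vdist M (s p) (s q)"
    using ev_ex[OF ev_conj] by fastforce
  interpret Xi: os "X i" by (rule X_os[OF i])
  have "\<exists>y\<in>carrier (X i). \<forall>e>0. \<exists>N. \<forall>p\<ge>N. vdist (X i) (s p i) y < e"
    by (rule os_completeD[OF Xi.complete S_in[OF sS i]]) (use C d in simp)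
  then obtain y where y: "y \<in> carrier (X i)" and lim: "\<And>e. e > 0 \<Longrightarrow> \<exists>N. \<forall>p\<ge>N. vdist (X i) (s p i) y < e"
    by blast
  \<comment> \<open>Transition maps from stage \<open>i\<close> do not increase distances, and at a
    late stage the distance is the one in \<open>M\<close>.\<close>
  have "vdist M (s p) (e i y) \<le> vdist (X i) (s p i) y" for p
  proof -
    obtain j where ij: "(i, j) \<in> r" and dj: "vdist (X j) (s p j) (e i y j) = vdist M (s p) (e i y)"
      using ev_ex_ge[OF ev_vdist[OF sS e_in[OF i y]] i] by blast
    have "vdist (X j) (T i j (s p i)) (T i j y) \<le> vdist (X i) (s p i) y"
      using r_I[OF ij] by (intro vdist_contraction[OF T_contr[OF ij] _ _ T_lin[OF ij] S_in[OF sS i] y] X_vsp) auto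
    then show ?thesis
      using coh[of p] ij dj by (simp add: coh_def e_apply)
  qed
  then show "\<exists>l\<in>carrier M. \<forall>e>0. \<exists>N. \<forall>p\<ge>N. vdist M (s p) l < e"
    using lim e_in[OF i y] by (intro bexI[of _ "e i y"]) (auto simp: M_simps, meson le_less_trans)
qed

abbreviation J where "J \<equiv> poset_category I r"

lemma cocone_apply:
  assumes "is_cocone J OS F L c" "(i, j) \<in> r" "x \<in> carrier (X i)"
  shows "c j (T i j x) = c i x"
  using coconeD(3)[OF assms(1), of i j "(i, j)" x] assms r_I by (simp add: poset_simps)

lemma cocone_Hom: "is_cocone J OS F L c \<Longrightarrow> i \<in> I \<Longrightarrow> c i \<in> Hom OS (X i) L"
  using coconeD(2)[of J F L c i] by (simp add: poset_simps)

text \<open>Along an eventually coherent family the values \<open>c j (f j)\<close> are eventually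
  constant, by compatibility of the cocone; this constant is \<open>g f\<close>.\<close>

lemma M_factor:
  assumes L: "is_cocone J OS F L c"
  obtains g where "g \<in> lin M L" "complete_contraction M L g"
    "\<And>i x. i \<in> I \<Longrightarrow> x \<in> carrier (X i) \<Longrightarrow> g (e i x) = c i x"
proof -
  note c = HomD[OF cocone_Hom[OF L]]
  define g where "g f = (THE v. ev (\<lambda>j. c j (f j) = v))" for f
  have g_eq: "g f = v" if "ev (\<lambda>j. c j (f j) = v)" for f v
    unfolding g_def using that ev_unique by (intro the_equality) blast+
  have g: "ev (\<lambda>j. c j (f j) = g f)" if f: "f \<in> S" for f
  proof -
    obtain i where i: "i \<in> I" "coh f i" using ev_ex[OF S_coh[OF f]] by blast
    have "ev (\<lambda>j. c j (f j) = c i (f i))"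
      using i(1)
    proof (rule evI)
      fix j assume "(i, j) \<in> r"
      then show "c j (f j) = c i (f i)"
        using i(2) cocone_apply[OF L _ S_in[OF f i(1)]] by (simp add: coh_def)
    qed
    then show ?thesis using g_eq by simp
  qed
  interpret M: vsp M by (rule vsp_M)
  have ge: "g (e i x) = c i x" if i: "i \<in> I" and x: "x \<in> carrier (X i)" for i x
    using i
  proof (intro g_eq, rule evI)
    fix j assume "(i, j) \<in> r"
    then show "c j (e i x j) = c i x" using cocone_apply[OF L _ x] by (simp add: e_apply)
  qed
  show thesis
  proof (rule that[OF _ _ ge])
    show "g \<in> lin M L"
      unfolding lin_iff M_simps(1)
    proof (intro conjI ballI allI)
      fix f assume f: "f \<in> S"
      obtain j where "j \<in> I" "c j (f j) = g f" using ev_ex[OF g[OF f]] by blast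
      then show "g f \<in> carrier L" using linD(1)[OF c(2) S_in[OF f]] by metis
    next
      fix f h assume f: "f \<in> S" and h: "h \<in> S"
      show "g (f \<oplus>\<^bsub>M\<^esub> h) = g f \<oplus>\<^bsub>L\<^esub> g h"
        using ev_conj[OF g[OF f] g[OF h]]
      proof (intro g_eq, elim ev_mono)
        fix j assume j: "j \<in> I" "c j (f j) = g f \<and> c j (h j) = g h"
        then show "c j ((f \<oplus>\<^bsub>M\<^esub> h) j) = g f \<oplus>\<^bsub>L\<^esub> g h"
          using linD(2)[OF c(2)[OF j(1)] S_in[OF f j(1)] S_in[OF h j(1)]] by (simp add: M_simps)
      qed
    next
      fix a f assume f: "f \<in> S"
      show "g (a \<odot>\<^bsub>M\<^esub> f) = a \<odot>\<^bsub>L\<^esub> g f"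
        using g[OF f]
      proof (intro g_eq, elim ev_mono)
        fix j assume j: "j \<in> I" "c j (f j) = g f"
        then show "c j ((a \<odot>\<^bsub>M\<^esub> f) j) = a \<odot>\<^bsub>L\<^esub> g f"
          using linD(3)[OF c(2)[OF j(1)] S_in[OF f j(1)]] by (simp add: M_simps)
      qed
    qed
    show "complete_contraction M L g"
      unfolding complete_contraction_def
    proof (intro allI impI ballI)
      fix n x assume n: "1 \<le> n" and x: "x \<in> mats n M"
      have "ev (\<lambda>j. \<forall>kl\<in>{..<n} \<times> {..<n}. c j ((x $$ kl) j) = g (x $$ kl))"
        using matsD(3)[OF x] g by (intro ev_all_countable) (auto simp: M_simps)
      then obtain j where j: "j \<in> I" and eq: "\<And>k l. k < n \<Longrightarrow> l < n \<Longrightarrow> c j ((x $$ (k, l)) j) = g (x $$ (k, l))"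
        and norm: "mnorm (X j) (map_mat (\<lambda>f. f j) x) = limnorm x"
        using ev_ex[OF ev_conj[OF _ ev_limnorm[OF n x]]] by fastforce
      have "map_mat g x = map_mat (c j) (map_mat (\<lambda>f. f j) x)"
        using matsD[OF x] eq by (intro eq_matI) auto
      moreover have "mnorm L (map_mat (c j) (map_mat (\<lambda>f. f j) x)) \<le> mnorm (X j) (map_mat (\<lambda>f. f j) x)"
        using c(3)[OF j] n vsp_hom.map_in[OF M_proj_hom[OF j] x]
        unfolding complete_contraction_def by blast
      ultimately show "mnorm L (map_mat g x) \<le> mnorm M x"
        using norm by (simp add: M_simps)
    qed
  qed
qed

text \<open>The model is the quotient of \<open>M\<close> by the kernel of its seminorm, moved to
  \<open>'u\<close>. Comparison maps out of it are recorded with their existence; in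
  \<open>colimitD\<close>, uniqueness comes from the given colimit.\<close>

lemma colimit_model:
  obtains W m where "is_cocone J OS F W m"
    "\<And>w. w \<in> carrier W \<Longrightarrow> \<exists>i\<in>I. \<exists>x\<in>carrier (X i). w = m i x"
    "\<And>i n x. i \<in> I \<Longrightarrow> n \<ge> 1 \<Longrightarrow> x \<in> mats n (X i) \<Longrightarrow>
      ev (\<lambda>j. (i, j) \<in> r \<and> mnorm (X j) (map_mat (T i j) x) \<le> mnorm W (map_mat (m i) x))"
    "\<And>L c. is_cocone J OS F L c \<Longrightarrow>
      \<exists>k\<in>Hom OS W L. \<forall>i\<in>I. \<forall>x\<in>carrier (X i). k (m i x) = c i x"
proof -
  interpret M: ruan M by (rule ruan_M)
  have "\<exists>i\<in>I. coh f i" if "f \<in> S" for f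
    using ev_ex[OF S_coh[OF that]] by blast
  then obtain i0 where i0: "\<And>f. f \<in> S \<Longrightarrow> i0 f \<in> I" "\<And>f. f \<in> S \<Longrightarrow> coh f (i0 f)" by metis
  \<comment> \<open>A stage from which \<open>f\<close> is coherent, together with the value of
    \<open>f\<close> there, determines all later values. Such pairs form a small set, although
    \<open>S\<close> consists of functions on \<open>I\<close>.\<close>
  define \<kappa> where "\<kappa> f = (i0 f, f (i0 f))" for f
  have "\<kappa> ` carrier M \<subseteq> (SIGMA i : I. carrier (X i))"
    using i0(1) S_in by (auto simp: \<kappa>_def M_simps)
  moreover have "small U (SIGMA i : I. carrier (X i))"
    using X_Obj by (intro small_Sigma small_I) (simp add: OS_simps small_type)
  ultimately have sm: "small U (\<kappa> ` carrier M)" by (rule small_subset)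
  have sep: "vdist M f g = 0" if f: "f \<in> carrier M" and g: "g \<in> carrier M" and eq: "\<kappa> f = \<kappa> g" for f g
  proof (rule vdist_M_eq_0)
    show fS: "f \<in> S" and gS: "g \<in> S" using f g by (auto simp: M_simps)
    show "ev (\<lambda>j. f j = g j)"
    proof (rule evI[OF i0(1)[OF fS]])
      fix j assume j: "(i0 f, j) \<in> r"
      have "i0 f = i0 g" "f (i0 g) = g (i0 g)" using eq by (auto simp: \<kappa>_def)
      then show "f j = g j"
        using i0(2)[OF fS] i0(2)[OF gS] j by (simp add: coh_def)
    qed
  qed
  obtain W :: "'u opspace" and u where W: "os W" "small U (carrier W)"
    and u: "u \<in> lin M W" "u ` carrier M = carrier W"
      "\<And>n x. n \<ge> 1 \<Longrightarrow> x \<in> mats n M \<Longrightarrow> mnorm W (map_mat u x) = mnorm M x"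
    using realize[OF ruan_M complete_M sm sep] by blast
  interpret Q: isometric_surj M W u
    using W(1) u by (simp add: isometric_surj_def isometric_surj_axioms_def M.ruan_axioms)
  have WO: "W \<in> Obj OS" using W by (simp add: OS_simps os_iff small_type)
  define m where "m i = (\<lambda>x\<in>carrier (X i). u (e i x))" for i
  have u_eq: "u f = u g" if "f \<in> S" "g \<in> S" "ev (\<lambda>j. f j = g j)" for f g
    using Q.vdist_eq[of f g] vdist_M_eq_0[OF that] that linD(1)[OF u(1)]
    by (intro Q.W.vdist_0) (simp_all add: M_simps)
  have cocone: "is_cocone J OS F W m"
  proof (rule coconeI[OF WO]; unfold poset_simps)
    show "m i \<in> Hom OS (X i) W" if "i \<in> I" for i
      unfolding m_def using that
      by (intro Hom_restrict lin_compose[OF e_lin u(1)] X_vsp contraction_compose[OF e_lin e_contr Q.contraction])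
  next
    fix i j a x assume i: "i \<in> I" and j: "j \<in> I" and a: "a \<in> {(i, j)} \<inter> r" and x: "x \<in> carrier (X i)"
    have ij: "(i, j) \<in> r" and a': "a = (i, j)" using a by auto
    note Tx = T_in[OF ij x]
    have "u (e j (T i j x)) = u (e i x)"
    proof (rule u_eq)
      show "ev (\<lambda>k. e j (T i j x) k = e i x k)"
        using j by (rule evI) (simp add: e_apply r_trans[OF ij] T_trans[OF ij _ x])
    qed (use e_in i j x Tx in auto)
    then show "m j (farr F i j a x) = m i x"
      using x Tx by (simp add: m_def a')
  qed
  show thesis
  proof (rule that[OF cocone])
    fix w assume "w \<in> carrier W"
    then obtain f where f: "f \<in> S" "w = u f" using u(2) by (auto simp: M_simps)
    obtain i where i: "i \<in> I" "coh f i" using ev_ex[OF S_coh[OF f(1)]] by blast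
    note fi = S_in[OF f(1) i(1)]
    have "u f = u (e i (f i))"
    proof (rule u_eq[OF f(1) e_in[OF i(1) fi]])
      show "ev (\<lambda>j. f j = e i (f i) j)"
        using i(1) by (rule evI) (use i(2) in \<open>simp add: e_apply coh_def\<close>)
    qed
    then show "\<exists>i\<in>I. \<exists>x\<in>carrier (X i). w = m i x"
      using i(1) fi f(2) by (intro bexI[of _ i] bexI[of _ "f i"]) (simp_all add: m_def)
  next
    fix i n x assume i: "i \<in> I" and n: "1 \<le> n" and x: "x \<in> mats n (X i)"
    have ex: "map_mat (e i) x \<in> mats n M"
      using e_in[OF i] by (intro mats_map[OF x]) (simp add: M_simps)
    have "map_mat (m i) x = map_mat u (map_mat (e i) x)"
      unfolding map_mat_comp' by (intro map_mat_cong'[OF x]) (simp add: m_def)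
    then have "mnorm W (map_mat (m i) x) = limnorm (map_mat (e i) x)"
      using u(3)[OF n ex] by (simp add: M_simps)
    then show "ev (\<lambda>j. (i, j) \<in> r \<and> mnorm (X j) (map_mat (T i j) x) \<le> mnorm W (map_mat (m i) x))"
      using ev_mono[OF limnorm_e[OF i n x]] by simp
  next
    fix L c assume L: "is_cocone J OS F L c"
    obtain g where g: "g \<in> lin M L" "complete_contraction M L g"
      "\<And>i x. i \<in> I \<Longrightarrow> x \<in> carrier (X i) \<Longrightarrow> g (e i x) = c i x"
      by (rule M_factor[OF L]) blast
    obtain h where h: "h \<in> lin W L" "complete_contraction W L h" "\<And>x. x \<in> carrier M \<Longrightarrow> h (u x) = g x"
      by (rule Q.factor[OF Obj_os[OF coconeD(1)[OF L]] g(1,2)]) blast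
    show "\<exists>k\<in>Hom OS W L. \<forall>i\<in>I. \<forall>x\<in>carrier (X i). k (m i x) = c i x"
    proof (intro bexI ballI)
      show "restrict h (carrier W) \<in> Hom OS W L"
        by (rule Hom_restrict[OF h(1,2) Obj_vsp[OF WO]])
      fix i x assume ix: "i \<in> I" "x \<in> carrier (X i)"
      then have "e i x \<in> carrier M" using e_in by (simp add: M_simps)
      then show "restrict h (carrier W) (m i x) = c i x"
        using ix h(3) g(3) linD(1)[OF u(1)] by (simp add: m_def)
    qed
  qed
qed

text \<open>Comparison maps exist in both directions, and uniqueness for \<open>L\<close> makes the
  composite from \<open>L\<close> through \<open>W\<close> back to \<open>L\<close> the identity. So
  elements of \<open>L\<close> inherit representatives from \<open>W\<close>, and the contraction
  \<open>h\<close> from \<open>L\<close> to \<open>W\<close> carries over the norm bound.\<close>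

lemma colimitD:
  assumes colim: "is_colimit J OS F L c"
  shows "\<And>y. y \<in> carrier L \<Longrightarrow> \<exists>i\<in>I. \<exists>x\<in>carrier (X i). y = c i x"
    "\<And>i n x. i \<in> I \<Longrightarrow> n \<ge> 1 \<Longrightarrow> x \<in> mats n (X i) \<Longrightarrow>
      ev (\<lambda>j. (i, j) \<in> r \<and> mnorm (X j) (map_mat (T i j) x) \<le> mnorm L (map_mat (c i) x))"
proof -
  have L: "is_cocone J OS F L c" using colim by (simp add: is_colimit_def)
  have ex1: "\<exists>!h. h \<in> Hom OS L L' \<and> (\<forall>i\<in>I. Comp OS (X i) L L' h (c i) = c' i)"
    if "is_cocone J OS F L' c'" for L' c'
    using colim that unfolding is_colimit_def poset_simps by blast
  obtain W m where W: "is_cocone J OS F W m"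
    and surj: "\<And>w. w \<in> carrier W \<Longrightarrow> \<exists>i\<in>I. \<exists>x\<in>carrier (X i). w = m i x"
    and norm: "\<And>i n x. i \<in> I \<Longrightarrow> n \<ge> 1 \<Longrightarrow> x \<in> mats n (X i) \<Longrightarrow>
      ev (\<lambda>j. (i, j) \<in> r \<and> mnorm (X j) (map_mat (T i j) x) \<le> mnorm W (map_mat (m i) x))"
    and univ: "\<And>L c. is_cocone J OS F L c \<Longrightarrow>
      \<exists>k\<in>Hom OS W L. \<forall>i\<in>I. \<forall>x\<in>carrier (X i). k (m i x) = c i x"
    by (rule colimit_model) blast
  obtain h where h: "h \<in> Hom OS L W" and hc: "\<And>i. i \<in> I \<Longrightarrow> Comp OS (X i) L W h (c i) = m i"
    using ex1[OF W] by blast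
  have hc': "h (c i x) = m i x" if "i \<in> I" "x \<in> carrier (X i)" for i x
    by (rule Comp_OS_D[OF hc[OF that(1)] that(2)])
  obtain k where k: "k \<in> Hom OS W L" and km: "\<And>i x. i \<in> I \<Longrightarrow> x \<in> carrier (X i) \<Longrightarrow> k (m i x) = c i x"
    using univ[OF L] by blast
  have LO: "L \<in> Obj OS" by (rule coconeD(1)[OF L])
  note cH = cocone_Hom[OF L]
  have comp_c: "Comp OS (X i) L L g (c i) = c i"
    if "i \<in> I" "\<And>x. x \<in> carrier (X i) \<Longrightarrow> g (c i x) = c i x" for g i
    using that HomD(1)[OF cH[OF that(1)]]
    by (intro extensionalityI[of _ "carrier (X i)"]) (auto simp: OS_simps compose_def)
  let ?kh = "compose (carrier L) k h" and ?id = "\<lambda>x\<in>carrier L. x"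
  have "?kh \<in> Hom OS L L" by (rule Hom_compose[OF h k Obj_vsp[OF LO]])
  moreover have "?id \<in> Hom OS L L"
    using is_category_OS LO by (auto simp: is_category_def OS_simps(3))
  moreover have "Comp OS (X i) L L ?kh (c i) = c i" if i: "i \<in> I" for i
    using i
  proof (rule comp_c)
    fix x assume x: "x \<in> carrier (X i)"
    then show "?kh (c i x) = c i x"
      using linD(1)[OF HomD(2)[OF cH[OF i]]] hc'[OF i x] km[OF i x] by (simp add: compose_def)
  qed
  moreover have "Comp OS (X i) L L ?id (c i) = c i" if i: "i \<in> I" for i
    using i linD(1)[OF HomD(2)[OF cH[OF i]]] by (intro comp_c) simp_all
  ultimately have eq: "?kh = ?id" using ex1[OF L] by blast
  show "\<exists>i\<in>I. \<exists>x\<in>carrier (X i). y = c i x" if y: "y \<in> carrier L" for y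
  proof -
    have "k (h y) = y" using fun_cong[OF eq, of y] y by (simp add: compose_def)
    moreover obtain i x where "i \<in> I" "x \<in> carrier (X i)" "h y = m i x"
      using surj[OF linD(1)[OF HomD(2)[OF h] y]] by blast
    ultimately show ?thesis using km by metis
  qed
  show "ev (\<lambda>j. (i, j) \<in> r \<and> mnorm (X j) (map_mat (T i j) x) \<le> mnorm L (map_mat (c i) x))"
    if i: "i \<in> I" and n: "n \<ge> 1" and x: "x \<in> mats n (X i)" for i n x
  proof -
    have "map_mat (m i) x = map_mat h (map_mat (c i) x)"
      unfolding map_mat_comp' using hc'[OF i] by (intro map_mat_cong'[OF x]) simp
    moreover have "map_mat (c i) x \<in> mats n L"
      using linD(1)[OF HomD(2)[OF cH[OF i]]] by (intro mats_map[OF x])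
    ultimately have "mnorm W (map_mat (m i) x) \<le> mnorm L (map_mat (c i) x)"
      using HomD(3)[OF h] n by (simp add: complete_contraction_def)
    then show ?thesis by (intro ev_mono[OF norm[OF i n x]]) auto
  qed
qed

end

section \<open>Countably generated operator spaces are countably presentable\<close>

text \<open>A square matrix is recovered from its size and the list of its rows.\<close>

lemma countable_square_mats:
  assumes "countable C"
  shows "countable {P. \<exists>n. P \<in> carrier_mat n n \<and> elements_mat P \<subseteq> C}"
proof (rule countable_subset)
  let ?f = "\<lambda>(n, l). mat n n (\<lambda>(i, j). l ! i ! j)"
  show "countable (?f ` (UNIV \<times> lists (lists C)))"
    using assms by (intro countable_image countable_SIGMA countable_lists) auto
  show "{P. \<exists>n. P \<in> carrier_mat n n \<and> elements_mat P \<subseteq> C} \<subseteq> ?f ` (UNIV \<times> lists (lists C))"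
  proof clarify
    fix P n assume P: "P \<in> carrier_mat n n" "elements_mat P \<subseteq> C"
    let ?l = "map (\<lambda>i. map (\<lambda>j. P $$ (i, j)) [0..<n]) [0..<n]"
    have "?l \<in> lists (lists C)"
      using P by (auto simp: in_lists_conv_set elements_mat_def)
    moreover have "P = ?f (n, ?l)" using P(1) by (intro eq_matI) auto
    ultimately show "P \<in> ?f ` (UNIV \<times> lists (lists C))"
      by (intro image_eqI[of _ _ "(n, ?l)"]) simp_all
  qed
qed

section \<open>Directed colimits of sets\<close>

lemma set_category_simps:
  "Obj set_category = UNIV" "Hom set_category A B = (A \<rightarrow>\<^sub>E B)"
  "Comp set_category A B D g f = compose A g f"
  by (simp_all add: set_category_def)

lemma set_coconeD:
  assumes "is_cocone J set_category D L c"
  shows "i \<in> Obj J \<Longrightarrow> x \<in> fobj D i \<Longrightarrow> c i x \<in> L"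
    "i \<in> Obj J \<Longrightarrow> c i \<in> extensional (fobj D i)"
    "i \<in> Obj J \<Longrightarrow> j \<in> Obj J \<Longrightarrow> a \<in> Hom J i j \<Longrightarrow> x \<in> fobj D i \<Longrightarrow> c j (farr D i j a x) = c i x"
proof -
  have c: "c i \<in> fobj D i \<rightarrow>\<^sub>E L" if "i \<in> Obj J" for i
    using assms that by (simp add: is_cocone_def set_category_simps)
  show "i \<in> Obj J \<Longrightarrow> x \<in> fobj D i \<Longrightarrow> c i x \<in> L" "i \<in> Obj J \<Longrightarrow> c i \<in> extensional (fobj D i)"
    using c by (auto simp: PiE_def)
  assume "i \<in> Obj J" "j \<in> Obj J" "a \<in> Hom J i j" and x: "x \<in> fobj D i"
  then have "compose (fobj D i) (c j) (farr D i j a) = c i"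
    using assms by (auto simp: is_cocone_def set_category_simps)
  from fun_cong[OF this, of x] show "c j (farr D i j a x) = c i x"
    using x by (simp add: compose_def)
qed

text \<open>The usual criterion: the legs are jointly surjective, and equalities in the vertex
  already hold at a later stage. The second condition is stated for one stage, because two elements
  can first be moved to a common one.\<close>

lemma set_directed_colimitI:
  assumes dir: "countably_directed I r"
    and t: "\<And>i j x. (i, j) \<in> r \<Longrightarrow> x \<in> fobj D i \<Longrightarrow> farr D i j (i, j) x \<in> fobj D j"
    and L: "is_cocone (poset_category I r) set_category D L c"
    and surj: "\<And>y. y \<in> L \<Longrightarrow> \<exists>i\<in>I. \<exists>x\<in>fobj D i. y = c i x"
    and inj: "\<And>i x y. i \<in> I \<Longrightarrow> x \<in> fobj D i \<Longrightarrow> y \<in> fobj D i \<Longrightarrow> c i x = c i y \<Longrightarrow>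
      \<exists>j. (i, j) \<in> r \<and> farr D i j (i, j) x = farr D i j (i, j) y"
  shows "is_colimit (poset_category I r) set_category D L c"
  unfolding is_colimit_def
proof (intro conjI allI impI L)
  let ?J = "poset_category I r"
  have J: "Obj ?J = I" "\<And>i j. Hom ?J i j = {(i, j)} \<inter> r" by (simp_all add: poset_category_def)
  have rI: "i \<in> I" "j \<in> I" if "(i, j) \<in> r" for i j
    using dir partial_order_onD(4)[of I r] that by (auto simp: countably_directed_def)
  fix L' c' assume L': "is_cocone ?J set_category D L' c'"
  have move: "d j (farr D i j (i, j) x) = d i x"
    if "is_cocone ?J set_category D N d" "(i, j) \<in> r" "x \<in> fobj D i" for N d i j x
    using set_coconeD(3)[OF that(1), of i j "(i, j)" x] that rI by (simp add: J)
  have wd: "c' i x = c' j y" if i: "i \<in> I" "x \<in> fobj D i" and j: "j \<in> I" "y \<in> fobj D j" and eq: "c i x = c j y"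
    for i j x y
  proof -
    obtain k where "\<forall>s\<in>{i, j}. (s, k) \<in> r"
      using dir i j unfolding countably_directed_def by (metis countable_insert countable_empty empty_subsetI insert_subset)
    then have k: "(i, k) \<in> r" "(j, k) \<in> r" by auto
    let ?x = "farr D i k (i, k) x" and ?y = "farr D j k (j, k) y"
    have xy: "?x \<in> fobj D k" "?y \<in> fobj D k" using t k i j by auto
    moreover have "c k ?x = c k ?y" using move[OF L k(1) i(2)] move[OF L k(2) j(2)] eq by simp
    ultimately obtain l where l: "(k, l) \<in> r" "farr D k l (k, l) ?x = farr D k l (k, l) ?y"
      using inj[of k ?x ?y] rI[OF k(1)] by blast
    have "c' i x = c' l (farr D k l (k, l) ?x)"
      using move[OF L' l(1) xy(1)] move[OF L' k(1) i(2)] by simp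
    also have "\<dots> = c' j y"
      using move[OF L' l(1) xy(2)] move[OF L' k(2) j(2)] l(2) by simp
    finally show ?thesis .
  qed
  obtain i x where ix: "\<And>y. y \<in> L \<Longrightarrow> i y \<in> I" "\<And>y. y \<in> L \<Longrightarrow> x y \<in> fobj D (i y)"
    "\<And>y. y \<in> L \<Longrightarrow> c (i y) (x y) = y"
    using surj by metis
  define h where "h = (\<lambda>y\<in>L. c' (i y) (x y))"
  note cL = set_coconeD(1)[OF L, unfolded J]
  have hc: "h (c j z) = c' j z" if "j \<in> I" "z \<in> fobj D j" for j z
    using wd[OF ix(1,2) that ix(3)] cL[OF that] by (simp add: h_def)
  show "\<exists>!h. h \<in> Hom set_category L L' \<and>
      (\<forall>i\<in>Obj ?J. Comp set_category (fobj D i) L L' h (c i) = c' i)"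
  proof (rule ex1I[of _ h])
    have "compose (fobj D j) h (c j) = c' j" if j: "j \<in> I" for j
      using hc[OF j] set_coconeD(2)[OF L', of j] j
      by (intro extensionalityI[of _ "fobj D j"]) (auto simp: compose_def J)
    moreover have "h \<in> L \<rightarrow>\<^sub>E L'"
      using set_coconeD(1)[OF L'] ix(1,2) by (auto simp: h_def J)
    ultimately show "h \<in> Hom set_category L L' \<and>
        (\<forall>i\<in>Obj ?J. Comp set_category (fobj D i) L L' h (c i) = c' i)"
      by (simp add: set_category_simps J)
  next
    fix g assume "g \<in> Hom set_category L L' \<and>
        (\<forall>i\<in>Obj ?J. Comp set_category (fobj D i) L L' g (c i) = c' i)"
    then have g: "g \<in> L \<rightarrow>\<^sub>E L'" and gc: "\<And>i. i \<in> I \<Longrightarrow> compose (fobj D i) g (c i) = c' i"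
      by (simp_all add: set_category_simps J)
    show "g = h"
    proof (rule extensionalityI[of _ L])
      fix y assume y: "y \<in> L"
      then obtain j z where jz: "j \<in> I" "z \<in> fobj D j" "y = c j z" using surj by blast
      have "g (c j z) = c' j z"
        using fun_cong[OF gc[OF jz(1)], of z] jz(2) by (simp add: compose_def)
      then show "g y = h y" using hc jz by simp
    qed (use g in \<open>auto simp: h_def PiE_def\<close>)
  qed
qed

text \<open>If all legs missed \<open>y\<close>, a constant map and the map changed only at
  \<open>y\<close> would agree on all legs, against uniqueness. The target is the two-element set
  \<open>{p, q}\<close>.\<close>

lemma set_colimit_surj:
  fixes L :: "'a set" and p q :: 'a
  assumes colim: "is_colimit J set_category D L c"
    and t: "\<And>i j a x. i \<in> Obj J \<Longrightarrow> j \<in> Obj J \<Longrightarrow> a \<in> Hom J i j \<Longrightarrow> x \<in> fobj D i \<Longrightarrow> farr D i j a x \<in> fobj D j"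
    and y: "y \<in> L" and pq: "p \<noteq> q"
  shows "\<exists>i\<in>Obj J. \<exists>x\<in>fobj D i. y = c i x"
proof (rule ccontr)
  assume neg: "\<not> ?thesis"
  have L: "is_cocone J set_category D L c" using colim by (simp add: is_colimit_def)
  have ny: "c i x \<noteq> y" if "i \<in> Obj J" "x \<in> fobj D i" for i x
    using neg that by blast
  let ?c = "\<lambda>i. \<lambda>x\<in>fobj D i. p"
  let ?u = "\<lambda>x\<in>L. p" and ?v = "\<lambda>x\<in>L. if x = y then q else p"
  have "is_cocone J set_category D {p, q} ?c"
    unfolding is_cocone_def set_category_simps using t by (auto simp: compose_def intro!: restrict_ext)
  then have ex1: "\<exists>!h. h \<in> L \<rightarrow>\<^sub>E {p, q} \<and> (\<forall>i\<in>Obj J. compose (fobj D i) h (c i) = ?c i)"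
    using colim unfolding is_colimit_def set_category_simps by blast
  have "?u \<in> L \<rightarrow>\<^sub>E {p, q} \<and> (\<forall>i\<in>Obj J. compose (fobj D i) ?u (c i) = ?c i)"
    using set_coconeD(1)[OF L] by (auto simp: compose_def intro!: restrict_ext)
  moreover have "?v \<in> L \<rightarrow>\<^sub>E {p, q} \<and> (\<forall>i\<in>Obj J. compose (fobj D i) ?v (c i) = ?c i)"
    using set_coconeD(1)[OF L] ny by (auto simp: compose_def intro!: restrict_ext)
  ultimately have "?u = ?v" using ex1 by blast
  from fun_cong[OF this, of y] show False using y pq by simp
qed

lemma hom_functor_simps:
  "fobj (functor_comp (hom_functor OS A) F) i = Hom OS A (fobj F i)"
  "farr (functor_comp (hom_functor OS A) F) i j a =
    (\<lambda>g\<in>Hom OS A (fobj F i). compose (carrier A) (farr F i j a) g)"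
  "fobj (hom_functor OS A) B = Hom OS A B"
  "farr (hom_functor OS A) B B' f = (\<lambda>g\<in>Hom OS A B. compose (carrier A) f g)"
  by (simp_all add: functor_comp_def hom_functor_def OS_simps(4))

section \<open>Hom functors applied to directed systems\<close>

context directed_system
begin

lemma hom_functor_cocone:
  assumes A: "A \<in> Obj OS" and L: "is_cocone J OS F L c"
  shows "is_cocone J set_category (functor_comp (hom_functor OS A) F) (fobj (hom_functor OS A) L)
    (\<lambda>i. farr (hom_functor OS A) (X i) L (c i))"
  unfolding is_cocone_def set_category_simps hom_functor_simps poset_simps
proof (intro conjI ballI UNIV_I)
  note cH = cocone_Hom[OF L]
  show "(\<lambda>g\<in>Hom OS A (X i). compose (carrier A) (c i) g) \<in> Hom OS A (X i) \<rightarrow>\<^sub>E Hom OS A L" if "i \<in> I" for i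
    using Hom_compose[OF _ cH[OF that] Obj_vsp[OF A]] by auto
  fix i j a assume "a \<in> {(i, j)} \<inter> r"
  then have a: "a = (i, j)" "(i, j) \<in> r" by auto
  have "compose (carrier A) (T i j) g \<in> Hom OS A (X j)" if "g \<in> Hom OS A (X i)" for g
    by (rule Hom_compose[OF that T_Hom[OF a(2)] Obj_vsp[OF A]])
  moreover have "compose (carrier A) (c j) (compose (carrier A) (T i j) g) = compose (carrier A) (c i) g"
    if "g \<in> Hom OS A (X i)" for g
    unfolding compose_def using cocone_apply[OF L a(2)] linD(1)[OF HomD(2)[OF that]]
    by (intro restrict_ext) simp
  ultimately show "compose (Hom OS A (X i)) (\<lambda>g\<in>Hom OS A (X j). compose (carrier A) (c j) g)
      (\<lambda>g\<in>Hom OS A (X i). compose (carrier A) (farr F i j a) g) =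
      (\<lambda>g\<in>Hom OS A (X i). compose (carrier A) (c i) g)"
    unfolding a(1) by (subst compose_def) (intro restrict_ext, simp)
qed

text \<open>The norm bound of \<open>colimitD\<close> is applied to the 1 x 1 matrix with entry the
  difference: its image in the colimit is 0, so its norm vanishes at late stages.\<close>

lemma colimit_eq:
  assumes colim: "is_colimit J OS F L c" and i: "i \<in> I" and x: "x \<in> carrier (X i)" and y: "y \<in> carrier (X i)"
    and eq: "c i x = c i y"
  shows "ev (\<lambda>j. (i, j) \<in> r \<and> T i j x = T i j y)"
proof -
  have L: "is_cocone J OS F L c" using colim by (simp add: is_colimit_def)
  interpret Xi: os "X i" by (rule X_os[OF i])
  interpret L: os L by (rule Obj_os[OF coconeD(1)[OF L]])
  let ?d = "x \<ominus>\<^bsub>X i\<^esub> y"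
  have d: "?d \<in> carrier (X i)" using x y by simp
  have c: "c i \<in> lin (X i) L" by (rule HomD(2)[OF cocone_Hom[OF L i]])
  have "vsp_hom (X i) L (c i)"
    using c by (simp add: vsp_hom_def vsp_hom_axioms_def Xi.vsp_axioms L.vsp_axioms)
  from vsp_hom.u_minus[OF this x y] have "c i ?d = \<zero>\<^bsub>L\<^esub>"
    using eq linD(1)[OF c y] by (simp add: L.minus_eq L.r_neg)
  then have "mnorm L (map_mat (c i) (mat 1 1 (\<lambda>_. ?d))) = 0"
    unfolding map_mat1 using L.vnorm_zero by (simp add: vnorm_def)
  then have "ev (\<lambda>j. (i, j) \<in> r \<and> mnorm (X j) (map_mat (T i j) (mat 1 1 (\<lambda>_. ?d))) \<le> 0)"
    using colimitD(2)[OF colim i _ Xi.mat1_in[OF d]] by simp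
  then show ?thesis
  proof (rule ev_mono)
    fix j assume *: "(i, j) \<in> r \<and> mnorm (X j) (map_mat (T i j) (mat 1 1 (\<lambda>_. ?d))) \<le> 0"
    then have ij: "(i, j) \<in> r" by simp
    interpret Xj: os "X j" using r_I[OF ij] X_os by blast
    have "T i j ?d = T i j x \<ominus>\<^bsub>X j\<^esub> T i j y" by (rule vsp_hom.u_minus[OF T_hom[OF ij] x y])
    then have "vdist (X j) (T i j x) (T i j y) \<le> 0"
      using * unfolding map_mat1 by (simp add: vdist_def vnorm_def)
    then have "T i j x = T i j y"
      using T_in[OF ij] x y Xj.vdist_nonneg[of "T i j x" "T i j y"] by (intro Xj.vdist_0) auto
    then show "(i, j) \<in> r \<and> T i j x = T i j y" using ij by simp
  qed
qed

text \<open>The generators are lifted to one stage first, where the lift need not extend to a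
  complete contraction. Moving further along bounds the norms of all rational matrices in the lifts
  by those in \<open>A\<close>, and then \<open>hom_extension\<close> produces the map.\<close>

lemma hom_lift:
  fixes a :: "'k \<Rightarrow> 'u"
  assumes colim: "is_colimit J OS F L c" and A: "A \<in> Obj OS" and gens: "gens A K a" and K: "countable K"
    and g: "g \<in> Hom OS A L"
  shows "\<exists>i\<in>I. \<exists>f\<in>Hom OS A (X i). g = compose (carrier A) (c i) f"
proof -
  have L: "is_cocone J OS F L c" using colim by (simp add: is_colimit_def)
  note cH = cocone_Hom[OF L]
  have LO: "L \<in> Obj OS" by (rule coconeD(1)[OF L])
  interpret A: os A by (rule Obj_os[OF A])
  interpret L: os L by (rule Obj_os[OF LO])
  have a: "a ` K \<subseteq> carrier A" using gens by (simp add: gens_def)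
  have ga: "g (a k) \<in> carrier L" if "k \<in> K" for k using a that linD(1)[OF HomD(2)[OF g]] by auto
  have "\<exists>i\<in>I. \<exists>x\<in>carrier (X i). g (a k) = c i x" if "k \<in> K" for k
    by (rule colimitD(1)[OF colim ga[OF that]])
  then obtain i0 x0 where i0: "\<And>k. k \<in> K \<Longrightarrow> i0 k \<in> I" and x0: "\<And>k. k \<in> K \<Longrightarrow> x0 k \<in> carrier (X (i0 k))"
    and cx0: "\<And>k. k \<in> K \<Longrightarrow> c (i0 k) (x0 k) = g (a k)"
    by metis
  \<comment> \<open>Countably many generators have representatives at one common stage.\<close>
  obtain i where i: "i \<in> I" "\<And>k. k \<in> K \<Longrightarrow> (i0 k, i) \<in> r"
    using upper[of "i0 ` K"] K i0 by auto
  interpret Xi: os "X i" by (rule X_os[OF i(1)])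
  define b0 where "b0 k = T (i0 k) i (x0 k)" for k
  have b0: "b0 ` K \<subseteq> carrier (X i)" using T_in[OF i(2) x0] by (auto simp: b0_def)
  have cb0: "c i (b0 k) = g (a k)" if "k \<in> K" for k
    using cocone_apply[OF L i(2)[OF that] x0[OF that]] cx0[OF that] by (simp add: b0_def)
  have homs: "vsp_hom (X i) L (c i)" "vsp_hom A L g"
    using HomD(2)[OF cH[OF i(1)]] HomD(2)[OF g]
    by (simp_all add: vsp_hom_def vsp_hom_axioms_def Xi.vsp_axioms L.vsp_axioms A.vsp_axioms)
  have lc_eq: "c i (lc (X i) b0 p) = g (lc A a p)" if "p \<in> qlists K" for p
  proof -
    have p: "p \<in> lists (UNIV \<times> K)" using that qlists_subset by blast
    show ?thesis
      unfolding vsp_hom.lc_hom[OF homs(1) b0 p] vsp_hom.lc_hom[OF homs(2) a p]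
      by (rule lc_cong[OF cb0 p])
  qed
  define Ps where "Ps = {P. \<exists>n. P \<in> carrier_mat n n \<and> elements_mat P \<subseteq> qlists K}"
  \<comment> \<open>Since \<open>g\<close> is a complete contraction, the norm in the colimit is at
    most the norm in \<open>A\<close>, and each such bound holds at late stages. There are countably
    many, so one stage meets them all. Matrices of size 0 carry no norm condition.\<close>
  have "ev (\<lambda>j. \<forall>P\<in>Ps. (i, j) \<in> r \<and> (dim_row P \<ge> 1 \<longrightarrow>
      mnorm (X j) (map_mat (T i j) (map_mat (lc (X i) b0) P)) \<le> mnorm A (map_mat (lc A a) P)))"
  proof (rule ev_all_countable)
    show "countable Ps" unfolding Ps_def by (rule countable_square_mats[OF countable_qlists[OF K]])
    fix P assume "P \<in> Ps"
    then obtain n where P: "P \<in> carrier_mat n n" "elements_mat P \<subseteq> qlists K" by (auto simp: Ps_def)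
    show "ev (\<lambda>j. (i, j) \<in> r \<and> (dim_row P \<ge> 1 \<longrightarrow>
      mnorm (X j) (map_mat (T i j) (map_mat (lc (X i) b0) P)) \<le> mnorm A (map_mat (lc A a) P)))"
    proof (cases "n \<ge> 1")
      case False
      then show ?thesis using P(1) ev_mono[OF ev_ge[OF i(1)]] by auto
    next
      case n: True
      have Pij: "P $$ (k, l) \<in> qlists K" if "k < n" "l < n" for k l
        using P elements_matI[OF P(1) that refl] by auto
      have PX: "map_mat (lc (X i) b0) P \<in> mats n (X i)" and PA: "map_mat (lc A a) P \<in> mats n A"
        using P(1) Pij Xi.lc_mem[OF b0] A.lc_mem[OF a] by (auto simp: in_mats)
      have "map_mat (c i) (map_mat (lc (X i) b0) P) = map_mat g (map_mat (lc A a) P)"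
        using P(1) Pij lc_eq by (intro eq_matI) auto
      moreover have "mnorm L (map_mat g (map_mat (lc A a) P)) \<le> mnorm A (map_mat (lc A a) P)"
        using HomD(3)[OF g] n PA by (simp add: complete_contraction_def)
      ultimately have "mnorm L (map_mat (c i) (map_mat (lc (X i) b0) P)) \<le> mnorm A (map_mat (lc A a) P)"
        by simp
      then show ?thesis
        by (intro ev_mono[OF colimitD(2)[OF colim i(1) n PX]]) auto
    qed
  qed
  from ev_ex[OF ev_conj[OF ev_ge[OF i(1)] this]] obtain j where ij: "(i, j) \<in> r"
    and norm: "\<And>P. P \<in> Ps \<Longrightarrow> dim_row P \<ge> 1 \<Longrightarrow>
      mnorm (X j) (map_mat (T i j) (map_mat (lc (X i) b0) P)) \<le> mnorm A (map_mat (lc A a) P)"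
    by blast
  have j: "j \<in> I" using r_I[OF ij] by simp
  define b where "b k = T i j (b0 k)" for k
  have b: "b ` K \<subseteq> carrier (X j)" using b0 T_in[OF ij] by (auto simp: b_def)
  have "mnorm (X j) (map_mat (lc (X j) b) P) \<le> mnorm A (map_mat (lc A a) P)"
    if n: "n \<ge> 1" and P: "P \<in> carrier_mat n n" "elements_mat P \<subseteq> qlists K" for n P
  proof -
    have lc: "lc (X j) b p = T i j (lc (X i) b0 p)" if "p \<in> qlists K" for p
      using vsp_hom.lc_hom[OF T_hom[OF ij] b0 subsetD[OF qlists_subset that]] by (simp add: b_def[abs_def])
    have "map_mat (lc (X j) b) P = map_mat (T i j) (map_mat (lc (X i) b0) P)"
      using P(1) lc[OF subsetD[OF P(2) elements_matI[OF P(1) _ _ refl]]] by (intro eq_matI) auto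
    then show ?thesis using norm[of P] n P by (auto simp: Ps_def)
  qed
  then obtain f where f: "f \<in> lin A (X j)" "complete_contraction A (X j) f" "\<And>k. k \<in> K \<Longrightarrow> f (a k) = b k"
    by (rule hom_extension[OF A.os_axioms X_os[OF j] gens b]) blast+
  note cj = HomD[OF cH[OF j]]
  have eq: "c j (f x) = g x" if x: "x \<in> carrier A" for x
  proof (rule hom_eq_on_gens[OF A.os_axioms L.os_axioms gens _ _ HomD(2,3)[OF g] _ x])
    show "(\<lambda>x. c j (f x)) \<in> lin A L" by (rule lin_compose[OF f(1) cj(2)])
    show "complete_contraction A L (\<lambda>x. c j (f x))" by (rule contraction_compose[OF f(1,2) cj(3)])
    show "c j (f (a k)) = g (a k)" if "k \<in> K" for k
      using f(3)[OF that] cocone_apply[OF L ij, of "b0 k"] b0 that cb0[OF that] by (auto simp: b_def)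
  qed
  have "g = compose (carrier A) (c j) (restrict f (carrier A))"
    using eq HomD(1)[OF g] by (intro extensionalityI[of _ "carrier A"]) (auto simp: compose_def)
  then show ?thesis using Hom_restrict[OF f(1,2) A.vsp_axioms] j by blast
qed

text \<open>Agreement on each of the countably many generators is reached at one stage, and
  \<open>hom_eq_on_gens\<close> extends it to all of \<open>A\<close>.\<close>

lemma hom_eventually_eq:
  fixes a :: "'k \<Rightarrow> 'u"
  assumes colim: "is_colimit J OS F L c" and A: "A \<in> Obj OS" and gens: "gens A K a" and K: "countable K"
    and i: "i \<in> I" and f: "f \<in> Hom OS A (X i)" and g: "g \<in> Hom OS A (X i)"
    and eq: "compose (carrier A) (c i) f = compose (carrier A) (c i) g"
  shows "\<exists>j. (i, j) \<in> r \<and> compose (carrier A) (T i j) f = compose (carrier A) (T i j) g"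
proof -
  have a: "a ` K \<subseteq> carrier A" using gens by (simp add: gens_def)
  note f' = HomD[OF f] and g' = HomD[OF g]
  have "ev (\<lambda>j. \<forall>k\<in>K. (i, j) \<in> r \<and> T i j (f (a k)) = T i j (g (a k)))"
    using K
  proof (rule ev_all_countable)
    fix k assume k: "k \<in> K"
    then have ak: "a k \<in> carrier A" using a by auto
    show "ev (\<lambda>j. (i, j) \<in> r \<and> T i j (f (a k)) = T i j (g (a k)))"
      using fun_cong[OF eq, of "a k"] ak
      by (intro colimit_eq[OF colim i linD(1)[OF f'(2) ak] linD(1)[OF g'(2) ak]]) (simp add: compose_def)
  qed
  from ev_ex_ge[OF this i] obtain j where ij: "(i, j) \<in> r" and T: "\<And>k. k \<in> K \<Longrightarrow> T i j (f (a k)) = T i j (g (a k))"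
    by blast
  note t = HomD[OF T_Hom[OF ij]]
  have Xj: "os (X j)" using r_I[OF ij] X_os by blast
  have "T i j (f x) = T i j (g x)" if x: "x \<in> carrier A" for x
    by (rule hom_eq_on_gens[OF Obj_os[OF A] Xj gens lin_compose[OF f'(2) t(2)] contraction_compose[OF f'(2,3) t(3)]
        lin_compose[OF g'(2) t(2)] contraction_compose[OF g'(2,3) t(3)] T x])
  then show ?thesis using ij by (auto simp: compose_def intro!: restrict_ext)
qed

end

text \<open>\<open>hom_lift\<close> and \<open>hom_eventually_eq\<close> are exactly the two
  conditions of \<open>set_directed_colimitI\<close> for the hom-sets.\<close>

lemma (in univ) countably_generated_presentable:
  fixes A :: "'u opspace" and a :: "'k \<Rightarrow> 'u"
  assumes A: "A \<in> Obj OS" and gens: "gens A K a" and K: "countable K"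
  shows "countably_presentable TYPE('u) OS A"
  unfolding countably_presentable_def preserves_countably_directed_colimits_def
proof (intro conjI allI impI A)
  fix I :: "'u set" and r F c and L :: "'u opspace"
  assume "small TYPE('u) I \<and> countably_directed I r \<and>
    is_functor (poset_category I r) (OS :: ('u opspace, 'u \<Rightarrow> 'u) category) F \<and>
    is_colimit (poset_category I r) OS F L c"
  then have I: "small U I" "countably_directed I r" "is_functor (poset_category I r) OS F"
    and colim: "is_colimit (poset_category I r) OS F L c"
    by (auto simp: small_type)
  interpret directed_system U I r F by unfold_locales fact+
  have L: "is_cocone J OS F L c" using colim by (simp add: is_colimit_def)
  show "is_colimit J set_category (functor_comp (hom_functor OS A) F) (fobj (hom_functor OS A) L)
      (\<lambda>i. farr (hom_functor OS A) (X i) L (c i))"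
  proof (rule set_directed_colimitI[OF I(2) _ hom_functor_cocone[OF A L]]; unfold hom_functor_simps)
    fix i j x assume "(i, j) \<in> r" "x \<in> Hom OS A (X i)"
    then show "(\<lambda>g\<in>Hom OS A (X i). compose (carrier A) (T i j) g) x \<in> Hom OS A (X j)"
      using Hom_compose[OF _ T_Hom Obj_vsp[OF A]] by simp
  next
    fix y assume "y \<in> Hom OS A L"
    from hom_lift[OF colim A gens K this]
    show "\<exists>i\<in>I. \<exists>x\<in>Hom OS A (X i). y = (\<lambda>g\<in>Hom OS A (X i). compose (carrier A) (c i) g) x"
      by auto
  next
    fix i x y assume i: "i \<in> I" and x: "x \<in> Hom OS A (X i)" and y: "y \<in> Hom OS A (X i)"
      and eq: "(\<lambda>g\<in>Hom OS A (X i). compose (carrier A) (c i) g) x = (\<lambda>g\<in>Hom OS A (X i). compose (carrier A) (c i) g) y"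
    from hom_eventually_eq[OF colim A gens K i x y] eq x y
    show "\<exists>j. (i, j) \<in> r \<and> (\<lambda>g\<in>Hom OS A (X i). compose (carrier A) (T i j) g) x =
        (\<lambda>g\<in>Hom OS A (X i). compose (carrier A) (T i j) g) y"
      by simp
  qed
qed

section \<open>Separable subspaces\<close>

lemma cspan_mono: "K \<subseteq> K' \<Longrightarrow> cspan V K d \<subseteq> cspan V K' d"
  using qlists_mono[of K K'] by (fastforce simp: cspan_def)

text \<open>\<open>from_nat_into\<close> enumerates \<open>D\<close>, with repetitions if it is
  finite. With the common index set \<open>nat\<close>, norm data of different spaces become
  comparable.\<close>

lemma gens_reindex:
  assumes "gens V D (\<lambda>x. x)" "countable D" "D \<noteq> {}"
  shows "gens V (UNIV :: nat set) (from_nat_into D)"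
  unfolding gens_def
proof
  show "range (from_nat_into D) \<subseteq> carrier V"
    using assms by (auto simp: gens_def)
  have "lc V (from_nat_into D) (map (\<lambda>(c, x). (c, to_nat_on D x)) p) = lc V (\<lambda>x. x) p"
    and "map (\<lambda>(c, x). (c, to_nat_on D x)) p \<in> qlists UNIV" if p: "p \<in> qlists D" for p
  proof -
    show "lc V (from_nat_into D) (map (\<lambda>(c, x). (c, to_nat_on D x)) p) = lc V (\<lambda>x. x) p"
      unfolding lc_reindex using assms(2) subsetD[OF qlists_subset p] by (intro lc_cong[of D]) simp
    show "map (\<lambda>(c, x). (c, to_nat_on D x)) p \<in> qlists UNIV"
      using p by (fastforce simp: qlists_def in_lists_conv_set)
  qed
  then show "carrier V \<subseteq> cspan V UNIV (from_nat_into D)"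
    using assms(1) unfolding gens_def cspan_def by (smt (verit, ccfv_threshold) mem_Collect_eq subset_iff)
qed

locale separable_subspaces = univ U for U :: "'u itself" +
  fixes V :: "'u opspace"
  assumes V: "V \<in> Obj OS"
begin

sublocale os V by (rule Obj_os[OF V])

text \<open>Every member, being non-empty, is the range of a sequence, which is used for smallness
  and in \<open>gens_reindex\<close>.\<close>

definition \<D> :: "'u set set" where
  "\<D> = {D. D \<subseteq> carrier V \<and> D \<noteq> {} \<and> countable D}"

text \<open>Local presentability asks for index posets on \<open>'u\<close>, so the countable
  subsets are named by elements of \<open>'u\<close>.\<close>

definition label :: "'u set \<Rightarrow> 'u" where
  "label = (SOME f. inj_on f \<D>)"

abbreviation unlabel :: "'u \<Rightarrow> 'u set" where
  "unlabel \<equiv> inv_into \<D> label"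

definition I :: "'u set" where
  "I = label ` \<D>"

text \<open>Inclusion of the generating sets, not of their closed spans: different sets may span the
  same subspace, which would break antisymmetry.\<close>

definition r :: "'u rel" where
  "r = {(i, j). i \<in> I \<and> j \<in> I \<and> unlabel i \<subseteq> unlabel j}"

definition sub :: "'u set \<Rightarrow> 'u opspace" where
  "sub D = sub_os V (cspan V D (\<lambda>x. x))"

definition F :: "('u, 'u \<times> 'u, 'u opspace, 'u \<Rightarrow> 'u) functor_data" where
  "F = \<lparr>fobj = (\<lambda>i. sub (unlabel i)), farr = (\<lambda>i j _. \<lambda>x\<in>carrier (sub (unlabel i)). x)\<rparr>"

definition c :: "'u \<Rightarrow> 'u \<Rightarrow> 'u" where
  "c i = (\<lambda>x\<in>carrier (sub (unlabel i)). x)"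

lemma small_\<D>: "small U \<D>"
  unfolding \<D>_def using V by (intro small_countable_subsets) (simp add: OS_simps small_type)

lemma inj_label: "inj_on label \<D>"
proof -
  obtain f :: "'u set \<Rightarrow> 'u" where "inj_on f \<D>" by (rule small_obtain_inj[OF small_\<D>])
  then show ?thesis unfolding label_def by (rule someI[of "\<lambda>f. inj_on f \<D>"])
qed

lemma unlabel_label [simp]: "D \<in> \<D> \<Longrightarrow> unlabel (label D) = D"
  by (simp add: inj_label)

lemma label_unlabel [simp]: "i \<in> I \<Longrightarrow> label (unlabel i) = i"
  by (auto simp: I_def f_inv_into_f)

lemma unlabel_in: "i \<in> I \<Longrightarrow> unlabel i \<in> \<D>"
  by (auto simp: I_def inv_into_into)

lemma label_in: "D \<in> \<D> \<Longrightarrow> label D \<in> I"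
  by (simp add: I_def)

lemma small_I: "small U I"
  unfolding I_def by (rule small_image[OF small_\<D>])

lemma directed: "countably_directed I r"
  unfolding countably_directed_def
proof (intro conjI allI impI)
  have "antisym r"
    by (rule antisymI) (auto simp: r_def, metis label_unlabel subset_antisym)
  then show "partial_order_on I r"
    by (auto simp: partial_order_on_def preorder_on_def refl_on_def r_def intro!: transI)
  fix S assume S: "S \<subseteq> I \<and> countable S"
  \<comment> \<open>Inserting 0 covers the empty \<open>S\<close>, since members of
    \<open>\<D>\<close> are non-empty; otherwise the union alone would be an upper bound.\<close>
  have "\<zero>\<^bsub>V\<^esub> \<in> carrier V" by simp
  then have "insert \<zero>\<^bsub>V\<^esub> (\<Union>(unlabel ` S)) \<in> \<D>"
    using S unlabel_in by (fastforce simp: \<D>_def)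
  then show "\<exists>u\<in>I. \<forall>s\<in>S. (s, u) \<in> r"
    using S label_in by (intro bexI[of _ "label (insert \<zero>\<^bsub>V\<^esub> (\<Union>(unlabel ` S)))"]) (auto simp: r_def)
qed

lemma sub_simps:
  "carrier (sub D) = cspan V D (\<lambda>x. x)" "add (sub D) = add V" "smult (sub D) = smult V" "mnorm (sub D) = mnorm V"
  by (simp_all add: sub_def)

lemma F_simps: "fobj F i = sub (unlabel i)" "farr F i j a = (\<lambda>x\<in>carrier (sub (unlabel i)). x)"
  by (simp_all add: F_def)

lemma \<D>_gens: "D \<in> \<D> \<Longrightarrow> (\<lambda>x. x) ` D \<subseteq> carrier V"
  by (auto simp: \<D>_def)

lemma sub_gen: "D \<in> \<D> \<Longrightarrow> x \<in> D \<Longrightarrow> x \<in> carrier (sub D)"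
  unfolding sub_simps by (rule cspan_gen[OF \<D>_gens])

lemma sub_subset: "D \<in> \<D> \<Longrightarrow> carrier (sub D) \<subseteq> carrier V"
  unfolding sub_simps by (rule cspan_subset[OF \<D>_gens])

lemma sub_mono: "D \<subseteq> D' \<Longrightarrow> carrier (sub D) \<subseteq> carrier (sub D')"
  unfolding sub_simps by (rule cspan_mono)

lemma sub_os: "D \<in> \<D> \<Longrightarrow> os (sub D)"
  unfolding sub_def by (rule os_cspan(1)[OF \<D>_gens])

lemma sub_Obj: "D \<in> \<D> \<Longrightarrow> sub D \<in> Obj OS"
  using sub_os[of D] small_subset[OF sub_subset, of D] V by (simp add: OS_simps os_iff small_type)

lemma sub_vsp: "D \<in> \<D> \<Longrightarrow> vsp (sub D)"
  by (rule Obj_vsp[OF sub_Obj])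

lemma sub_presentable: "D \<in> \<D> \<Longrightarrow> countably_presentable TYPE('u) OS (sub D)"
  using gens_cspan[OF \<D>_gens, of D]
  by (intro countably_generated_presentable[OF sub_Obj, of D D "\<lambda>x. x"]) (auto simp: sub_def \<D>_def)

text \<open>One statement for the transition maps, where \<open>W\<close> is a larger span, and for
  the legs of the cocone, where \<open>W = V\<close>.\<close>

lemma inclusion_Hom:
  assumes "W = V \<or> (\<exists>D'\<in>\<D>. D \<subseteq> D' \<and> W = sub D')" "D \<in> \<D>"
  shows "(\<lambda>x\<in>carrier (sub D). x) \<in> Hom OS (sub D) W"
proof (rule Hom_restrict[OF _ _ sub_vsp[OF assms(2)]])
  have sub: "carrier (sub D) \<subseteq> carrier W"
    using assms(1)
  proof
    assume "W = V"
    then show ?thesis using sub_subset[OF assms(2)] by simp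
  next
    assume "\<exists>D'\<in>\<D>. D \<subseteq> D' \<and> W = sub D'"
    then show ?thesis using sub_mono by blast
  qed
  have W: "add W = add V" "smult W = smult V" "mnorm W = mnorm V"
    using assms(1) by (auto simp: sub_simps(2-4))
  show "(\<lambda>x. x) \<in> lin (sub D) W"
    using sub by (auto simp: lin_iff W sub_simps(2,3))
  show "complete_contraction (sub D) W (\<lambda>x. x)"
    unfolding complete_contraction_def W(3) sub_simps(4)
    using map_mat_id'[of _ _ "sub D" "\<lambda>x. x"] by fastforce
qed

lemma functor_F: "is_functor (poset_category I r) OS F"
  unfolding is_functor_def
proof (intro conjI ballI)
  let ?J = "poset_category I r"
  have J: "Obj ?J = I" "\<And>i j. Hom ?J i j = {(i, j)} \<inter> r" by (simp_all add: poset_category_def)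
  show "fobj F i \<in> Obj OS" if "i \<in> Obj ?J" for i
    using that sub_Obj[OF unlabel_in] by (simp add: J F_simps)
  show "farr F i j a \<in> Hom OS (fobj F i) (fobj F j)"
    if "i \<in> Obj ?J" "j \<in> Obj ?J" "a \<in> Hom ?J i j" for i j a
  proof -
    have "i \<in> I" "j \<in> I" "(i, j) \<in> r" using that by (auto simp: J)
    then have "unlabel i \<in> \<D>" "unlabel j \<in> \<D>" "unlabel i \<subseteq> unlabel j"
      by (auto simp: r_def unlabel_in)
    then show ?thesis unfolding F_simps by (intro inclusion_Hom) auto
  qed
  show "farr F i i (Ident ?J i) = Ident OS (fobj F i)" for i
    by (simp add: F_simps OS_simps)
  show "farr F i k (Comp ?J i j k b a) = Comp OS (fobj F i) (fobj F j) (fobj F k) (farr F j k b) (farr F i j a)"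
    if "a \<in> Hom ?J i j" for i j k a b
  proof -
    have "(i, j) \<in> r" using that by (auto simp: J)
    then have "carrier (sub (unlabel i)) \<subseteq> carrier (sub (unlabel j))"
      by (intro sub_mono) (simp add: r_def)
    then show ?thesis
      by (auto simp: F_simps OS_simps compose_def intro!: restrict_ext)
  qed
qed

text \<open>Every matrix over \<open>V\<close> already lives over the span of its finitely many
  entries, so these subspaces cover \<open>V\<close> without taking a closure, and maps are glued
  pointwise.\<close>

lemma colimit_F: "is_colimit (poset_category I r) OS F V c"
  unfolding is_colimit_def
proof (intro conjI allI impI)
  let ?J = "poset_category I r"
  have J: "Obj ?J = I" "\<And>i j. Hom ?J i j = {(i, j)} \<inter> r" by (simp_all add: poset_category_def)
  show "is_cocone ?J OS F V c"
  proof (rule coconeI[OF V]; unfold J F_simps)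
    show "c i \<in> Hom OS (sub (unlabel i)) V" if "i \<in> I" for i
      unfolding c_def using inclusion_Hom[of V] unlabel_in[OF that] by simp
    show "c j ((\<lambda>x\<in>carrier (sub (unlabel i)). x) x) = c i x"
      if "i \<in> I" "j \<in> I" "a \<in> {(i, j)} \<inter> r" "x \<in> carrier (sub (unlabel i))" for i j a x
      using that sub_mono[of "unlabel i" "unlabel j"] by (auto simp: c_def r_def)
  qed
  fix L' c' assume cone: "is_cocone ?J OS F L' c'"
  have c'_Hom: "c' (label D) \<in> Hom OS (sub D) L'" if "D \<in> \<D>" for D
    using coconeD(2)[OF cone, of "label D"] that by (simp add: J F_simps label_in)
  have c'_mono: "c' (label D') x = c' (label D) x" if "D \<in> \<D>" "D' \<in> \<D>" "D \<subseteq> D'" "x \<in> carrier (sub D)" for D D' x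
  proof -
    have "(label D, label D') \<in> r" using that by (simp add: r_def label_in)
    then show ?thesis
      using coconeD(3)[OF cone, of "label D" "label D'" "(label D, label D')" x] that
      by (simp add: J F_simps label_in)
  qed
  \<comment> \<open>The leg of \<open>{x}\<close> gives the value at \<open>x\<close>. Comparison
    through \<open>insert x D\<close> shows that any \<open>D\<close> whose span contains
    \<open>x\<close> gives the same value.\<close>
  define h where "h x = c' (label {x}) x" for x
  have h: "h x = c' (label D) x" if D: "D \<in> \<D>" and x: "x \<in> carrier (sub D)" for D x
  proof -
    have xV: "{x} \<in> \<D>" using sub_subset[OF D] x by (auto simp: \<D>_def)
    have xD: "insert x D \<in> \<D>" using sub_subset[OF D] x D by (auto simp: \<D>_def)
    show ?thesis
      unfolding h_def using c'_mono[OF D xD _ x] c'_mono[OF xV xD _ sub_gen[OF xV]] by auto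
  qed
  have L': "L' \<in> Obj OS" by (rule coconeD(1)[OF cone])
  have h_Hom: "restrict h (carrier V) \<in> Hom OS V L'"
  proof (rule Hom_restrict[OF _ _ vsp_axioms])
    show "h \<in> lin V L'"
      unfolding lin_iff
    proof (intro conjI ballI allI)
      fix x assume x: "x \<in> carrier V"
      have D: "{x} \<in> \<D>" using x by (auto simp: \<D>_def)
      note xD = sub_gen[OF D, of x, simplified]
      note l = HomD(2)[OF c'_Hom[OF D]]
      show "h x \<in> carrier L'" using h[OF D xD] linD(1)[OF l xD] by simp
      fix a
      have "a \<odot>\<^bsub>V\<^esub> x \<in> carrier (sub {x})"
        using vsp.smult_in[OF sub_vsp[OF D] xD, of a] by (simp add: sub_simps(3))
      then show "h (a \<odot>\<^bsub>V\<^esub> x) = a \<odot>\<^bsub>L'\<^esub> h x"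
        using h[OF D] xD linD(3)[OF l xD, of a] by (simp add: sub_simps(3))
    next
      fix x y assume x: "x \<in> carrier V" and y: "y \<in> carrier V"
      have D: "{x, y} \<in> \<D>" using x y by (auto simp: \<D>_def)
      have xy: "x \<in> carrier (sub {x, y})" "y \<in> carrier (sub {x, y})" using sub_gen[OF D] by auto
      have "x \<oplus>\<^bsub>V\<^esub> y \<in> carrier (sub {x, y})"
        using abelian_groupE(1)[OF vsp_abelian_group[OF sub_vsp[OF D]] xy] by (simp add: sub_simps(2))
      then show "h (x \<oplus>\<^bsub>V\<^esub> y) = h x \<oplus>\<^bsub>L'\<^esub> h y"
        using h[OF D] xy linD(2)[OF HomD(2)[OF c'_Hom[OF D]] xy] by (simp add: sub_simps(2))
    qed
    show "complete_contraction V L' h"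
      unfolding complete_contraction_def
    proof (intro allI impI ballI)
      fix n x assume n: "1 \<le> n" and x: "x \<in> mats n V"
      \<comment> \<open>The finite set of entries of \<open>x\<close> is itself a member of
        \<open>\<D>\<close>, so the norm bound is that of a single leg.\<close>
      let ?D = "elements_mat x"
      have el: "x $$ (i, j) \<in> ?D" if "i < n" "j < n" for i j
        using x that by (auto simp: mats_def intro: elements_matI)
      have D: "?D \<in> \<D>"
        using x el[of 0 0] n by (auto simp: \<D>_def mats_def elements_mat_def countable_finite)
      have xD: "x \<in> mats n (sub ?D)"
        using matsD[OF x] x sub_gen[OF D el] by (auto simp: in_mats)
      have "map_mat h x = map_mat (c' (label ?D)) x"
        by (rule map_mat_cong'[OF xD h[OF D]])
      then show "mnorm L' (map_mat h x) \<le> mnorm V x"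
        using HomD(3)[OF c'_Hom[OF D]] n xD by (simp add: complete_contraction_def sub_simps(4))
    qed
  qed
  show "\<exists>!h. h \<in> Hom OS V L' \<and> (\<forall>i\<in>Obj ?J. Comp OS (fobj F i) V L' h (c i) = c' i)"
  proof (rule ex1I[of _ "restrict h (carrier V)"], intro conjI ballI h_Hom; unfold J F_simps)
    fix i assume i: "i \<in> I"
    have "c' i \<in> extensional (carrier (sub (unlabel i)))"
      using HomD(1)[OF c'_Hom[OF unlabel_in[OF i]]] i by simp
    then show "Comp OS (sub (unlabel i)) V L' (restrict h (carrier V)) (c i) = c' i"
      using h[OF unlabel_in[OF i]] i sub_subset[OF unlabel_in[OF i]]
      by (intro extensionalityI[of _ "carrier (sub (unlabel i))"]) (auto simp: OS_simps compose_def c_def)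
  next
    fix g assume g: "g \<in> Hom OS V L' \<and> (\<forall>i\<in>I. Comp OS (sub (unlabel i)) V L' g (c i) = c' i)"
    show "g = restrict h (carrier V)"
    proof (rule extensionalityI[of _ "carrier V"])
      fix x assume x: "x \<in> carrier V"
      have D: "{x} \<in> \<D>" using x by (auto simp: \<D>_def)
      have eq: "Comp OS (sub {x}) V L' g (c (label {x})) = c' (label {x})"
        using g label_in[OF D] D by force
      show "g x = restrict h (carrier V) x"
        using Comp_OS_D[OF eq sub_gen[OF D]] x sub_gen[OF D] D by (simp add: c_def h_def)
    qed (use g HomD(1) in auto)
  qed
qed

text \<open>The identity is an element of the hom-set at the colimit, so by
  \<open>set_colimit_surj\<close> it factors through some leg; as the legs are inclusions, the span
  of one countable set is everything.\<close>

lemma presentable_countably_generated: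
  assumes "countably_presentable TYPE('u) OS V"
  obtains D where "D \<in> \<D>" "gens V D (\<lambda>x. x)"
proof -
  interpret directed_system U I r F
    by unfold_locales (fact small_I directed functor_F)+
  have colim: "is_colimit J set_category (functor_comp (hom_functor OS V) F) (fobj (hom_functor OS V) V)
      (\<lambda>i. farr (hom_functor OS V) (fobj F i) V (c i))"
    using assms small_I directed functor_F colimit_F
    unfolding countably_presentable_def preserves_countably_directed_colimits_def small_type by blast
  obtain p q :: 'u where pq: "p \<noteq> q"
    using infinite_univ by (metis finite.intros(1) finite_insert insertI1 finite_subset subsetI UNIV_I singletonD)
  have id: "(\<lambda>x\<in>carrier V. x) \<in> fobj (hom_functor OS V) V"
    unfolding hom_functor_simps using is_category_OS V by (auto simp: is_category_def OS_simps(3))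
  have "\<exists>i\<in>Obj J. \<exists>f\<in>fobj (functor_comp (hom_functor OS V) F) i.
      (\<lambda>x\<in>carrier V. x) = farr (hom_functor OS V) (fobj F i) V (c i) f"
  proof (rule set_colimit_surj[OF colim _ id])
    \<comment> \<open>Elements of the hom-sets are functions from \<open>'u\<close> to
      \<open>'u\<close>; two constant functions are the required distinct ones.\<close>
    show "(\<lambda>_ :: 'u. p) \<noteq> (\<lambda>_. q)" using pq by (metis)
    fix i j a f assume "i \<in> Obj J" "j \<in> Obj J" "a \<in> Hom J i j" "f \<in> fobj (functor_comp (hom_functor OS V) F) i"
    then show "farr (functor_comp (hom_functor OS V) F) i j a f \<in> fobj (functor_comp (hom_functor OS V) F) j"
      using Hom_compose[OF _ functorD(2)[OF functor_F] vsp_axioms] by (simp add: hom_functor_simps)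
  qed
  then obtain i f where i: "i \<in> I" and f: "f \<in> Hom OS V (sub (unlabel i))"
    and eq: "(\<lambda>x\<in>carrier V. x) = compose (carrier V) (c i) f"
    by (auto simp: hom_functor_simps F_simps poset_simps)
  have "x \<in> carrier (sub (unlabel i))" if x: "x \<in> carrier V" for x
    using fun_cong[OF eq, of x] x linD(1)[OF HomD(2)[OF f] x] by (simp add: compose_def c_def)
  then have "gens V (unlabel i) (\<lambda>x. x)"
    using \<D>_gens[OF unlabel_in[OF i]] by (auto simp: gens_def sub_simps)
  then show thesis using unlabel_in[OF i] that by blast
qed

end

text \<open>The norms of the rational matrices in the generators, encoded as Dedekind cuts: with
  reals replaced by sets of rationals, the whole datum is a subset of one fixed countable
  set.\<close>

definition norm_data :: "'a opspace \<Rightarrow> (nat \<Rightarrow> 'a) \<Rightarrow> ((complex \<times> nat) list mat \<times> rat) set" where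
  "norm_data V a = {(P, q). (\<exists>n. P \<in> carrier_mat n n \<and> elements_mat P \<subseteq> qlists UNIV) \<and>
     of_rat q < mnorm V (map_mat (lc V a) P)}"

lemma norm_data_eq:
  assumes "norm_data V a = norm_data W b" "P \<in> carrier_mat n n" "elements_mat P \<subseteq> qlists UNIV"
  shows "mnorm V (map_mat (lc V a) P) = mnorm W (map_mat (lc W b) P)"
proof -
  have iff: "of_rat q < mnorm V (map_mat (lc V a) P) \<longleftrightarrow> of_rat q < mnorm W (map_mat (lc W b) P)" for q
  proof -
    have "(P, q) \<in> norm_data V a \<longleftrightarrow> (P, q) \<in> norm_data W b" using assms(1) by simp
    then show ?thesis using assms(2,3) unfolding norm_data_def by blast
  qed
  show ?thesis
  proof (rule linorder_cases)
    assume "mnorm V (map_mat (lc V a) P) < mnorm W (map_mat (lc W b) P)"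
    from of_rat_dense[OF this] obtain q where
      "mnorm V (map_mat (lc V a) P) < of_rat q" "of_rat q < mnorm W (map_mat (lc W b) P)" by blast
    then show ?thesis using iff[of q] by linarith
  next
    assume "mnorm W (map_mat (lc W b) P) < mnorm V (map_mat (lc V a) P)"
    from of_rat_dense[OF this] obtain q where
      "mnorm W (map_mat (lc W b) P) < of_rat q" "of_rat q < mnorm V (map_mat (lc V a) P)" by blast
    then show ?thesis using iff[of q] by linarith
  qed
qed

text \<open>Equal norms allow \<open>hom_extension\<close> in both directions, exchanging the two
  families of generators; the composites fix the generators and so are identities.\<close>

lemma isomorphic_if_norm_data_eq:
  assumes V: "V \<in> Obj OS" and W: "W \<in> Obj OS" and a: "gens V UNIV a" and b: "gens W UNIV b"
    and eq: "norm_data V a = norm_data W b"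
  shows "isomorphic OS V W"
proof -
  have os: "os V" "os W" using V W by (simp_all add: Obj_os)
  have ext: "\<exists>f\<in>Hom OS A B. \<forall>k. f (a k) = b k"
    if A: "A \<in> Obj OS" "gens A UNIV a" and B: "B \<in> Obj OS" "gens B UNIV b" and eq: "norm_data A a = norm_data B b"
    for A B :: "'a opspace" and a b
  proof -
    obtain f where f: "f \<in> lin A B" "complete_contraction A B f" "\<And>k. k \<in> UNIV \<Longrightarrow> f (a k) = b k"
    proof (rule hom_extension[OF Obj_os[OF A(1)] Obj_os[OF B(1)] A(2)])
      show "range b \<subseteq> carrier B" using B(2) by (simp add: gens_def)
      show "mnorm B (map_mat (lc B b) P) \<le> mnorm A (map_mat (lc A a) P)"
        if "P \<in> carrier_mat n n" "elements_mat P \<subseteq> qlists UNIV" for n P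
        using norm_data_eq[OF eq that] by simp
    qed blast
    moreover have "a k \<in> carrier A" for k using A(2) by (auto simp: gens_def)
    ultimately show ?thesis using Hom_restrict[OF f(1,2) Obj_vsp[OF A(1)]] by (intro bexI) auto
  qed
  obtain f where f: "f \<in> Hom OS V W" "\<And>k. f (a k) = b k" using ext[OF V a W b eq] by blast
  obtain g where g: "g \<in> Hom OS W V" "\<And>k. g (b k) = a k" using ext[OF W b V a eq[symmetric]] by blast
  have inv: "compose (carrier A) g f = (\<lambda>x\<in>carrier A. x)"
    if A: "A \<in> Obj OS" "gens A UNIV a" and f: "f \<in> Hom OS A B" and g: "g \<in> Hom OS B A"
      and fg: "\<And>k. g (f (a k)) = a k" for A B :: "'a opspace" and f g a
  proof -
    note f' = HomD[OF f] and g' = HomD[OF g]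
    have "g (f x) = x" if x: "x \<in> carrier A" for x
      by (rule hom_eq_on_gens[OF Obj_os[OF A(1)] Obj_os[OF A(1)] A(2) lin_compose[OF f'(2) g'(2)]
          contraction_compose[OF f'(2,3) g'(3)] _ contraction_id fg x]) (simp add: lin_iff)
    then show ?thesis unfolding compose_def by (intro restrict_ext)
  qed
  have "compose (carrier V) g f = (\<lambda>x\<in>carrier V. x)" "compose (carrier W) f g = (\<lambda>x\<in>carrier W. x)"
    using inv[OF V a f(1) g(1)] inv[OF W b g(1) f(1)] f(2) g(2) by auto
  then show ?thesis unfolding isomorphic_def OS_simps(3,4) using f(1) g(1) by blast
qed

lemma (in univ) small_presentable:
  "\<exists>S. S \<subseteq> Obj OS \<and> small TYPE('u) S \<and>
     (\<forall>A :: 'u opspace. countably_presentable TYPE('u) OS A \<longrightarrow> (\<exists>B\<in>S. isomorphic OS A B))"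
proof -
  define Q where "Q V d \<longleftrightarrow> V \<in> Obj OS \<and> (\<exists>a. gens V UNIV a \<and> norm_data V a = d)" for V :: "'u opspace" and d
  define \<C> where "\<C> = {d. \<exists>V. Q V d}"
  \<comment> \<open>One space for each datum that occurs. The data are subsets of the countable set
    \<open>?C\<close>, so the chosen spaces form a small set.\<close>
  define rep where "rep d = (SOME V. Q V d)" for d
  have rep: "Q (rep d) d" if "d \<in> \<C>" for d
    using that unfolding \<C>_def rep_def by (auto intro: someI_ex)
  let ?C = "{P :: (complex \<times> nat) list mat. \<exists>n. P \<in> carrier_mat n n \<and> elements_mat P \<subseteq> qlists UNIV} \<times> (UNIV :: rat set)"
  have "countable ?C"
    by (intro countable_SIGMA countable_square_mats countable_qlists) auto
  moreover have "\<C> \<subseteq> Pow ?C" by (auto simp: \<C>_def Q_def norm_data_def)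
  ultimately have "small U \<C>" using small_Pow_countable small_subset by blast
  then have "small U (rep ` \<C>)" by (rule small_image)
  moreover have "rep ` \<C> \<subseteq> Obj OS" using rep by (auto simp: Q_def)
  moreover have "\<exists>B\<in>rep ` \<C>. isomorphic OS A B" if A: "countably_presentable TYPE('u) OS A" for A :: "'u opspace"
  proof -
    have AO: "A \<in> Obj OS" using A by (simp add: countably_presentable_def)
    interpret separable_subspaces U A by unfold_locales (rule AO)
    obtain D where D: "D \<in> \<D>" "gens A D (\<lambda>x. x)" by (rule presentable_countably_generated[OF A])
    let ?a = "from_nat_into D"
    have a: "gens A UNIV ?a" using D by (intro gens_reindex) (auto simp: \<D>_def)
    have "norm_data A ?a \<in> \<C>" using AO a by (auto simp: \<C>_def Q_def)
    moreover obtain b where "gens (rep (norm_data A ?a)) UNIV b"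
      "norm_data (rep (norm_data A ?a)) b = norm_data A ?a" "rep (norm_data A ?a) \<in> Obj OS"
      using rep[OF calculation] by (auto simp: Q_def)
    ultimately show ?thesis using isomorphic_if_norm_data_eq[OF AO _ a] by (metis imageI)
  qed
  ultimately show ?thesis unfolding small_type by blast
qed

theorem theorem4p35:
  assumes "universe TYPE('u)"
  shows "locally_countably_presentable TYPE('u) (OS :: ('u opspace, 'u \<Rightarrow> 'u) category)"
proof -
  interpret univ "TYPE('u)" by unfold_locales fact
  show ?thesis
    unfolding locally_countably_presentable_def
  proof (intro conjI ballI is_category_OS cocomplete_OS small_presentable)
    fix X :: "'u opspace" assume X: "X \<in> Obj OS"
    interpret S: separable_subspaces "TYPE('u)" X by unfold_locales (rule X)
    have "countably_presentable TYPE('u) OS (fobj S.F i)" if "i \<in> S.I" for i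
      unfolding S.F_simps by (rule S.sub_presentable[OF S.unlabel_in[OF that]])
    then show "\<exists>(I :: 'u set) r F c.
        small TYPE('u) I \<and> countably_directed I r \<and> is_functor (poset_category I r) OS F \<and>
        (\<forall>i\<in>I. countably_presentable TYPE('u) OS (fobj F i)) \<and>
        is_colimit (poset_category I r) OS F X c"
      using S.small_I S.directed S.functor_F S.colimit_F by blast
  qed
qed

end
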